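(* There exists an absolute constant $c>0$ such that the following holds. Let $S_1,\dots,S_L$ be (deterministic) linear subspaces of $\mathbb{R}^m$ of dimensions $d_1,\dots,d_L$, and for each $l\in\{1,\dots,L\}$ let $U^{(l)}\in\mathbb{R}^{m\times d_l}$ be a matrix whose columns form an orthonormal basis of $S_l$. Let $\sigma\ge 0$, let $q\geq 1$ be an integer, and for each $l$ let $n_l=\rho_l q$ be an integer with $\rho_l\ge 6$. Set $N=\sum_{l=1}^L n_l$ and $d_{\max}=\max_l d_l$. For each $l$, let $\mathcal{X}_l$ consist of the $n_l$ points $$x_j^{(l)}=U^{(l)}a_j^{(l)}+e_j^{(l)},\qquad j=1,\dots,n_l,$$ where the $a_j^{(l)}$ are independent (across $j$ and $l$) with $a_j^{(l)}$ uniformly distributed on the unit sphere of $\mathbb{R}^{d_l}$, and the $e_j^{(l)}$ are i.i.d. (across $j$ and $l$) $\mathcal{N}(0,(\sigma^2/m)I)$ random vectors in $\mathbb{R}^m$, independent of the $a_j^{(l)}$. Let $\mathcal{X}=\mathcal{X}_1\cup\dots\cup\mathcal{X}_L$. Suppose that $m\ge 6\log N$ and $$\max_{k,l\colon k\ne l}\operatorname{aff}(S_k,S_l)+\frac{\sigma(1+\sigma)}{\sqrt{\log N}}\,\frac{\sqrt{d_{\max}}}{\sqrt{m}}\le\frac{1}{12\log N}.$$ Then, with probability at least $$1-\frac{10}{N}-\sum_{l=1}^L n_l e^{-c(n_l-1)},$$ the subspace detection property holds for $\mathcal{X}=\mathcal{X}_1\cup\dots\cup\mathcal{X}_L$ and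 the adjacency matrix $A$ constructed from $\mathcal{X}$ by the thresholding-based subspace clustering (TSC) algorithm with parameter $q$.
   Context: $\log$ is the natural logarithm, and $\mathcal{N}(\mu,\Sigma)$ denotes a Gaussian random vector with mean $\mu$ and covariance $\Sigma$. Affinity: for subspaces $S_k,S_l$ of $\mathbb{R}^m$ of dimensions $d_k,d_l$ with orthonormal basis matrices $U^{(k)},U^{(l)}$, $$\operatorname{aff}(S_k,S_l)=\frac{1}{\sqrt{\min(d_k,d_l)}}\,\big\|(U^{(k)})^{T}U^{(l)}\big\|_F,$$ where $\|\cdot\|_F$ is the Frobenius norm. TSC adjacency matrix with parameter $q$: enumerate the points of $\mathcal{X}$ as $x_1,\dots,x_N$. For every $j\in\{1,\dots,N\}$ let $T_j\subset\{1,\dots,N\}\setminus\{j\}$ be a set of cardinality $q$ such that $|\langle x_j,x_i\rangle|\ge|\langle x_j,x_p\rangle|$ for all $i\in T_j$ and all $p\notin T_j$, $p\ne j$ (i.e. $T_j$ indexes the $q$ points other than $x_j$ having largest absolute inner product with $x_j$). Let $z_j\in\mathbb{R}^N$ be the vector whose $i$th entry is $|\langle x_j,x_i\rangle|$ if $i\in T_j$ and $0$ if $i\notin T_j$. The adjacency matrix $A\in\mathbb{R}^{N\times N}$ is $A_{ij}=|[z_j]_i|+|[z_i]_j|$. Subspace detection property: it holds for $\mathcal{X}=\mathcal{X}_1\cup\dots\cup\mathcal{X}_L$ and $A$ if (i) $A_{ij}\ne 0$ only if $x_i$ and $x_j$ belong to the same set $\mathcal{X}_l$; and (ii) for every $i\in\{1,\dots,N\}$,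 $A_{ij}\ne 0$ for at least $q$ points $x_j$ that belong to the same set $\mathcal{X}_l$ as $x_i$. *)

theory Defs
  imports "HOL-Probability.Probability" "Jordan_Normal_Form.VS_Connect"
begin

no_notation inner (infix \<open>\<bullet>\<close> 70)

text \<open>
  Dimensions vary inside the theorem, so vectors and matrices over the reals are those of
  \<^theory>\<open>Jordan_Normal_Form.Matrix\<close>. Random vectors in dimension \<open>d\<close> are sampled as functions on
  \<open>{..<d}\<close>, where the product measures of the library are available.
\<close>

section \<open>Subspaces and affinity\<close>

definition orthonormal_basis_mat :: "nat \<Rightarrow> real vec set \<Rightarrow> real mat \<Rightarrow> bool" where
  "orthonormal_basis_mat m S U \<longleftrightarrow>
     U \<in> carrier_mat m (dim_col U) \<and>
     (\<forall>i<dim_col U. \<forall>j<dim_col U. col U i \<bullet> col U j = (if i = j then 1 else 0)) \<and>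
     vec_space.col_space m U = S"

definition frobenius_norm :: "real mat \<Rightarrow> real" where
  "frobenius_norm B = sqrt (\<Sum>i<dim_row B. \<Sum>j<dim_col B. (B $$ (i, j))\<^sup>2)"

text \<open>The affinity of two subspaces, in terms of orthonormal basis matrices of them.\<close>

definition aff :: "real mat \<Rightarrow> real mat \<Rightarrow> real" where
  "aff U V = 1 / sqrt (real (min (dim_col U) (dim_col V))) * frobenius_norm (transpose_mat U * V)"

section \<open>The data model\<close>

text \<open>
  Normalized surface measure on the unit sphere of dimension \<open>d - 1\<close>, for \<open>d \<ge> 1\<close>: the measure of a
  set of unit vectors is the share of the unit ball filled by the cone over this set.
\<close>

definition sphere_uniform :: "nat \<Rightarrow> (nat \<Rightarrow> real) measure" where
  "sphere_uniform d =
     distr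
       (uniform_measure (\<Pi>\<^sub>M i\<in>{..<d}. lborel)
          {x \<in> space (\<Pi>\<^sub>M i\<in>{..<d}. lborel). L2_set x {..<d} \<le> 1})
       (\<Pi>\<^sub>M i\<in>{..<d}. borel)
       (\<lambda>x. \<lambda>i\<in>{..<d}. x i / L2_set x {..<d})"

lemma prob_space_sphere_uniform: "prob_space (sphere_uniform d)"
proof -
  let ?P = "\<Pi>\<^sub>M i\<in>{..<d}. (lborel :: real measure)"
  let ?B = "{x \<in> space ?P. L2_set x {..<d} \<le> 1}"
  have B: "?B = {f. sqrt (\<Sum>i\<in>{..<d}. (f i)\<^sup>2) \<le> 1} \<inter> space ?P"
    by (auto simp: L2_set_def)
  have "emeasure ?P ?B = ennreal (unit_ball_vol (real d) * 1 ^ d)"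
    unfolding B by (subst emeasure_cball_aux) auto
  then have "prob_space (uniform_measure ?P ?B)"
    by (intro prob_space_uniform_measure) (use unit_ball_vol_pos[of "real d"] in \<open>auto simp: ennreal_eq_0_iff not_le\<close>)
  then show ?thesis
    unfolding sphere_uniform_def L2_set_def
    by (rule prob_space.prob_space_distr) measurable
qed

lemma AE_sphere_uniform:
  assumes "1 \<le> d"
  shows "AE x in sphere_uniform d. L2_set x {..<d} = 1"
proof -
  let ?P = "\<Pi>\<^sub>M i\<in>{..<d}. (lborel :: real measure)"
  let ?B = "{x \<in> space ?P. L2_set x {..<d} \<le> 1}"
  interpret product_sigma_finite "\<lambda>_::nat. (lborel :: real measure)" ..
  have [measurable]: "(\<lambda>x. L2_set x {..<d}) \<in> borel_measurable ?P" unfolding L2_set_def by measurable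
  let ?Z = "\<Pi>\<^sub>E i\<in>{..<d}. (if i = 0 then {0::real} else UNIV)"
  have "emeasure ?P ?Z = (\<Prod>i<d. emeasure lborel (if i = 0 then {0::real} else UNIV))"
    by (intro emeasure_PiM) auto
  also have "\<dots> = 0" using assms by (intro prod_zero) (auto intro!: bexI[of _ 0])
  finally have "?Z \<in> null_sets ?P" by (auto intro!: null_setsI sets_PiM_I_finite)
  then have Z: "AE x in ?P. x \<notin> ?Z" by (rule AE_not_in)
  have unit: "L2_set (\<lambda>i\<in>{..<d}. x i / L2_set x {..<d}) {..<d} = 1"
    if x: "x \<in> space ?P" "x \<notin> ?Z" for x
  proof -
    have "x 0 \<noteq> 0" using x assms by (auto simp: space_PiM PiE_def Pi_def split: if_splits)
    then have pos: "(\<Sum>i<d. (x i)\<^sup>2) > 0" using assms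
      by (intro sum_pos2[of _ 0]) auto
    show ?thesis using pos
      by (simp add: L2_set_def power_divide sum_divide_distrib[symmetric] sum_nonneg)
  qed
  have "AE x in ?P. L2_set (\<lambda>i\<in>{..<d}. x i / L2_set x {..<d}) {..<d} = 1"
    using Z AE_space[of ?P] by eventually_elim (rule unit)
  then have *: "AE x in uniform_measure ?P ?B. L2_set (\<lambda>i\<in>{..<d}. x i / L2_set x {..<d}) {..<d} = 1"
    by (intro AE_uniform_measureI) auto
  show ?thesis unfolding sphere_uniform_def
    apply (subst AE_distr_iff)
    subgoal unfolding L2_set_def by measurable
    subgoal unfolding L2_set_def by measurable
    using * by simp
qed

text \<open>The law of a Gaussian vector in dimension \<open>m\<close> with mean 0 and covariance \<open>v\<close> times the
  identity; for \<open>v = 0\<close>, where the library's density is not one, it is the point mass at 0.\<close>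

definition gaussian_iso :: "nat \<Rightarrow> real \<Rightarrow> (nat \<Rightarrow> real) measure" where
  "gaussian_iso m v =
     (\<Pi>\<^sub>M i\<in>{..<m}. if v = 0 then return borel 0 else density lborel (normal_density 0 (sqrt v)))"

lemma prob_space_gaussian_iso:
  assumes "0 \<le> v"
  shows "prob_space (gaussian_iso m v)"
  unfolding gaussian_iso_def using assms
  by (intro prob_space_PiM) (auto simp: prob_space_return intro: prob_space_normal_density)

text \<open>The \<open>j\<close>th point of the \<open>l\<close>th set is indexed by the pair \<open>(l, j)\<close>.\<close>

definition point_index :: "nat \<Rightarrow> (nat \<Rightarrow> nat) \<Rightarrow> (nat \<times> nat) set" where
  "point_index L n = (SIGMA l:{..<L}. {..<n l})"

text \<open>The joint law of all the \<open>a\<close> (first component) and all the \<open>e\<close> (second component).\<close>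

definition data_model ::
  "nat \<Rightarrow> (nat \<Rightarrow> nat) \<Rightarrow> (nat \<Rightarrow> nat) \<Rightarrow> nat \<Rightarrow> real \<Rightarrow>
    ((nat \<times> nat \<Rightarrow> nat \<Rightarrow> real) \<times> (nat \<times> nat \<Rightarrow> nat \<Rightarrow> real)) measure" where
  "data_model L n d m \<sigma> =
     (\<Pi>\<^sub>M i\<in>point_index L n. sphere_uniform (d (fst i))) \<Otimes>\<^sub>M
     (\<Pi>\<^sub>M i\<in>point_index L n. gaussian_iso m (\<sigma>\<^sup>2 / real m))"

lemma prob_space_data_model: "prob_space (data_model L n d m \<sigma>)"
proof -
  interpret A: prob_space "\<Pi>\<^sub>M i\<in>point_index L n. sphere_uniform (d (fst i))"
    by (intro prob_space_PiM prob_space_sphere_uniform)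
  interpret E: prob_space "\<Pi>\<^sub>M i\<in>point_index L n. gaussian_iso m (\<sigma>\<^sup>2 / real m)"
    by (intro prob_space_PiM prob_space_gaussian_iso) simp
  interpret pair_prob_space "\<Pi>\<^sub>M i\<in>point_index L n. sphere_uniform (d (fst i))"
    "\<Pi>\<^sub>M i\<in>point_index L n. gaussian_iso m (\<sigma>\<^sup>2 / real m)" ..
  show ?thesis unfolding data_model_def by (rule prob_space_axioms)
qed

definition data_point ::
  "nat \<Rightarrow> (nat \<Rightarrow> real mat) \<Rightarrow>
    (nat \<times> nat \<Rightarrow> nat \<Rightarrow> real) \<times> (nat \<times> nat \<Rightarrow> nat \<Rightarrow> real) \<Rightarrow> nat \<times> nat \<Rightarrow> real vec" where
  "data_point m U \<omega> i =
     U (fst i) *\<^sub>v vec (dim_col (U (fst i))) (fst \<omega> i) + vec m (snd \<omega> i)"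

section \<open>Thresholding-based subspace clustering\<close>

text \<open>\<open>I\<close> is the index set of the points \<open>x\<close>. The \<open>q\<close> nearest neighbours need not be unique, so a
  choice \<open>T\<close> of them is a parameter.\<close>

definition tsc_neighbours :: "'i set \<Rightarrow> ('i \<Rightarrow> real vec) \<Rightarrow> nat \<Rightarrow> ('i \<Rightarrow> 'i set) \<Rightarrow> bool" where
  "tsc_neighbours I x q T \<longleftrightarrow>
     (\<forall>j\<in>I. T j \<subseteq> I - {j} \<and> card (T j) = q \<and>
        (\<forall>i\<in>T j. \<forall>p\<in>I. p \<notin> T j \<longrightarrow> p \<noteq> j \<longrightarrow> \<bar>x j \<bullet> x i\<bar> \<ge> \<bar>x j \<bullet> x p\<bar>))"

definition tsc_coeff :: "('i \<Rightarrow> real vec) \<Rightarrow> ('i \<Rightarrow> 'i set) \<Rightarrow> 'i \<Rightarrow> 'i \<Rightarrow> real" where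
  "tsc_coeff x T j i = (if i \<in> T j then \<bar>x j \<bullet> x i\<bar> else 0)"

definition tsc_adjacency :: "('i \<Rightarrow> real vec) \<Rightarrow> ('i \<Rightarrow> 'i set) \<Rightarrow> 'i \<Rightarrow> 'i \<Rightarrow> real" where
  "tsc_adjacency x T i j = \<bar>tsc_coeff x T j i\<bar> + \<bar>tsc_coeff x T i j\<bar>"

text \<open>\<open>lab i\<close> tells which of the sets the point with index \<open>i\<close> belongs to. Points are counted by
  their indices, that is, with multiplicity.\<close>

definition subspace_detection ::
  "'i set \<Rightarrow> ('i \<Rightarrow> 'l) \<Rightarrow> nat \<Rightarrow> ('i \<Rightarrow> 'i \<Rightarrow> real) \<Rightarrow> bool" where
  "subspace_detection I lab q A \<longleftrightarrow>
     (\<forall>i\<in>I. \<forall>j\<in>I. A i j \<noteq> 0 \<longrightarrow> lab i = lab j) \<and>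
     (\<forall>i\<in>I. q \<le> card {j \<in> I. lab j = lab i \<and> A i j \<noteq> 0})"

end

theory Submission
  imports Defs
begin

text \<open>
  Condition on all the noise and on one point \<open>x\<^sub>i\<close>. Its inner product with a point of the same
  cluster is \<open>\<langle>y, a\<^sub>j\<rangle> + s\<close> with \<open>a\<^sub>j\<close> uniform on the sphere and \<open>y\<close> of norm almost 1, and a
  Paley--Zygmund bound makes it at least \<open>\<bar>y\<bar> / (2 sqrt d)\<close> in absolute value with probability at
  least 1/5. As \<open>q\<close> is at most a sixth of the cluster, a Chernoff bound yields \<open>q\<close> such neighbours
  outside an event of probability \<open>exp (-c (n\<^sub>l - 1))\<close>. The inner product of points of different
  clusters splits into a bilinear form in two sphere variables, whose moment generating function is
  controlled by the Frobenius norm of the cross Gram matrix, that is by the affinity, and two noise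
  terms; outside an event of probability \<open>10 / N\<close> all of these stay below \<open>1 / (3 sqrt d)\<close>.
  The sphere enters only through its even moments: direction and length of a standard Gaussian
  vector are independent, and \<open>E \<bar>g\<bar>\<^bsup>2k\<^esup> \<ge> d\<^bsup>k\<^esup>\<close>. Since \<open>c\<close> is small, the claimed bound is vacuous
  unless every cluster is large.
\<close>

section \<open>Polar coordinates\<close>

text \<open>Coordinates of a point of the sphere are dependent, so exponential moments do not factor
  over them. They are bounded through power series instead, coefficient by coefficient, and
  \<open>cosh\<close> serves for two-sided tails because its series contains even moments only. A
  linear form in a sphere variable is subgaussian, but a bilinear form has only exponential tails. A
  failure probability of order N^-3 per pair, needed for about N^2 pairs, therefore costs a factor
  log N in the signal term and only its square root in the noise terms; this is the shape of the
  assumption on affinity and noise. The separating threshold 5/(12 sqrt d) belongs to one point and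
  uses only the dimension of its own subspace. Four times the bound 1/12 of the assumption puts the
  cross terms at 4/(12 sqrt d), just below it; losing 1/6 of the length 1 of a signal to noise and
  half of the rest to anticoncentration gives 5/12. In the Chernoff bound a tilt of 1/10 makes q
  cost at most n/60, against a gain of (n - 1)/55.\<close>

definition unitize :: "nat \<Rightarrow> (nat \<Rightarrow> real) \<Rightarrow> nat \<Rightarrow> real" where
  "unitize d x = (\<lambda>i\<in>{..<d}. x i / L2_set x {..<d})"

abbreviation lborel_pi :: "nat \<Rightarrow> (nat \<Rightarrow> real) measure" where
  "lborel_pi d \<equiv> \<Pi>\<^sub>M i\<in>{..<d}. lborel"

abbreviation borel_pi :: "nat \<Rightarrow> (nat \<Rightarrow> real) measure" where
  "borel_pi d \<equiv> \<Pi>\<^sub>M i\<in>{..<d}. borel"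

lemma sets_lborel_pi [measurable_cong]: "sets (lborel_pi d) = sets (borel_pi d)"
  by (intro sets_PiM_cong) auto

lemma measurable_L2_set [measurable]: "(\<lambda>x. L2_set x {..<d}) \<in> borel_measurable (borel_pi d)"
  unfolding L2_set_def by measurable

lemma measurable_unitize [measurable]: "unitize d \<in> borel_pi d \<rightarrow>\<^sub>M borel_pi d"
  unfolding unitize_def by measurable

lemma L2_set_scale: "L2_set (\<lambda>i\<in>A. c * x i) A = \<bar>c\<bar> * L2_set x A"
proof -
  have "(\<Sum>i\<in>A. ((\<lambda>i\<in>A. c * x i) i)\<^sup>2) = c\<^sup>2 * (\<Sum>i\<in>A. (x i)\<^sup>2)"
    by (simp add: sum_distrib_left power_mult_distrib)
  then show ?thesis by (simp add: L2_set_def real_sqrt_mult)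
qed

lemma unitize_scale:
  assumes "c > 0"
  shows "unitize d (\<lambda>i\<in>{..<d}. c * x i) = unitize d x"
  using assms unfolding unitize_def L2_set_scale by (auto simp: restrict_def)

text \<open>By Fubini each coordinate contributes one factor |c| through the affine substitution on
  the line. Positive \<open>c\<close> yields the homogeneity of balls, and \<open>c = -1\<close> the
  reflection symmetry of the sphere.\<close>

lemma nn_integral_lborel_PiM_scale:
  assumes "finite I" "c \<noteq> 0" "f \<in> borel_measurable (\<Pi>\<^sub>M i\<in>I. (lborel :: real measure))"
  shows "(\<integral>\<^sup>+x. f x \<partial>(\<Pi>\<^sub>M i\<in>I. lborel)) =
    ennreal (\<bar>c\<bar> ^ card I) * (\<integral>\<^sup>+x. f (\<lambda>i\<in>I. c * x i) \<partial>(\<Pi>\<^sub>M i\<in>I. lborel))"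
  using assms(1,3)
proof (induction I arbitrary: f)
  case empty
  interpret product_sigma_finite "\<lambda>_. (lborel :: real measure)" ..
  show ?case
    using nn_integral_empty[of f] nn_integral_empty[of "\<lambda>x. f (\<lambda>i\<in>{}. c * x i)"]
    by (simp add: restrict_def)
next
  case (insert i I)
  interpret product_sigma_finite "\<lambda>_. (lborel :: real measure)" ..
  interpret I: finite_product_sigma_finite "\<lambda>_. (lborel :: real measure)" I by standard (use insert in auto)
  note [measurable] = insert.prems
  have eq: "(\<lambda>k\<in>insert i I. c * (x(i := y)) k) = (\<lambda>k\<in>I. c * x k)(i := c * y)" for x y
    using \<open>i \<notin> I\<close> by auto
  have "(\<integral>\<^sup>+x. f x \<partial>(\<Pi>\<^sub>M i\<in>insert i I. lborel)) =
    (\<integral>\<^sup>+x. (\<integral>\<^sup>+y. f (x(i := y)) \<partial>lborel) \<partial>(\<Pi>\<^sub>M i\<in>I. lborel))"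
    by (rule product_nn_integral_insert) (use insert in auto)
  also have "\<dots> = ennreal (\<bar>c\<bar> ^ card I) *
      (\<integral>\<^sup>+x. (\<integral>\<^sup>+y. f ((\<lambda>i\<in>I. c * x i)(i := y)) \<partial>lborel) \<partial>(\<Pi>\<^sub>M i\<in>I. lborel))"
    by (rule insert.IH) measurable
  also have "(\<integral>\<^sup>+x. (\<integral>\<^sup>+y. f ((\<lambda>i\<in>I. c * x i)(i := y)) \<partial>lborel) \<partial>(\<Pi>\<^sub>M i\<in>I. lborel)) =
     (\<integral>\<^sup>+x. \<bar>c\<bar> * (\<integral>\<^sup>+y. f ((\<lambda>i\<in>I. c * x i)(i := c * y)) \<partial>lborel) \<partial>(\<Pi>\<^sub>M i\<in>I. lborel))"
  proof (rule nn_integral_cong)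
    fix x :: "'a \<Rightarrow> real"
    have "(\<lambda>i\<in>I. c * x i) \<in> space (\<Pi>\<^sub>M i\<in>I. (lborel :: real measure))" by (simp add: space_PiM)
    from measurable_comp[OF measurable_component_update[OF this \<open>i \<notin> I\<close>] insert.prems]
    have "(\<lambda>y. f ((\<lambda>i\<in>I. c * x i)(i := y))) \<in> borel_measurable lborel"
      by (simp only: comp_def)
    then show "(\<integral>\<^sup>+y. f ((\<lambda>i\<in>I. c * x i)(i := y)) \<partial>lborel) =
       \<bar>c\<bar> * (\<integral>\<^sup>+y. f ((\<lambda>i\<in>I. c * x i)(i := c * y)) \<partial>lborel)"
      by (subst nn_integral_real_affine[where c=c and t=0]) (use assms in auto)
  qed
  also have "\<dots> = \<bar>c\<bar> * (\<integral>\<^sup>+x. (\<integral>\<^sup>+y. f ((\<lambda>i\<in>I. c * x i)(i := c * y)) \<partial>lborel) \<partial>(\<Pi>\<^sub>M i\<in>I. lborel))"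
    by (rule nn_integral_cmult) measurable
  also have "(\<integral>\<^sup>+x. (\<integral>\<^sup>+y. f ((\<lambda>i\<in>I. c * x i)(i := c * y)) \<partial>lborel) \<partial>(\<Pi>\<^sub>M i\<in>I. lborel)) =
     (\<integral>\<^sup>+x. f (\<lambda>k\<in>insert i I. c * x k) \<partial>(\<Pi>\<^sub>M i\<in>insert i I. lborel))"
    by (subst product_nn_integral_insert) (use insert in \<open>auto simp only: eq\<close>, measurable)
  finally show ?case
    using insert.hyps by (simp add: ennreal_mult mult_ac del: restrict_apply)
qed

lemma emeasure_lborel_pi_cball:
  "emeasure (lborel_pi d) {x \<in> space (lborel_pi d). L2_set x {..<d} \<le> 1} = ennreal (unit_ball_vol (real d))"
proof -
  have B: "{x \<in> space (lborel_pi d). L2_set x {..<d} \<le> 1} = {f. sqrt (\<Sum>i\<in>{..<d}. (f i)\<^sup>2) \<le> 1} \<inter> space (lborel_pi d)"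
    by (auto simp: L2_set_def)
  show ?thesis
    unfolding B by (subst emeasure_cball_aux) auto
qed

lemma nn_integral_sphere_uniform:
  assumes [measurable]: "f \<in> borel_measurable (borel_pi d)"
  shows "(\<integral>\<^sup>+a. f a \<partial>sphere_uniform d) =
    (\<integral>\<^sup>+x. f (unitize d x) * indicator {..1} (L2_set x {..<d}) \<partial>lborel_pi d) / ennreal (unit_ball_vol (real d))"
proof -
  let ?B = "{x \<in> space (lborel_pi d). L2_set x {..<d} \<le> 1}"
  have "(\<integral>\<^sup>+a. f a \<partial>sphere_uniform d) = (\<integral>\<^sup>+x. f (unitize d x) \<partial>uniform_measure (lborel_pi d) ?B)"
    unfolding sphere_uniform_def unitize_def by (subst nn_integral_distr) auto
  also have "\<dots> = (\<integral>\<^sup>+x. f (unitize d x) * indicator ?B x \<partial>lborel_pi d) / emeasure (lborel_pi d) ?B"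
    by (subst nn_integral_uniform_measure) auto
  also have "(\<integral>\<^sup>+x. f (unitize d x) * indicator ?B x \<partial>lborel_pi d) =
      (\<integral>\<^sup>+x. f (unitize d x) * indicator {..1} (L2_set x {..<d}) \<partial>lborel_pi d)"
    by (intro nn_integral_cong) (auto simp: indicator_def)
  finally show ?thesis by (simp add: emeasure_lborel_pi_cball)
qed

text \<open>Dilation by \<open>r\<close> keeps the direction and multiplies the length, so the
  integral of a function of the direction over a ball is homogeneous of degree \<open>d\<close> in
  the radius.\<close>

lemma nn_integral_open_ball_scale:
  assumes [measurable]: "f \<in> borel_measurable (borel_pi d)" and "r > 0"
  shows "(\<integral>\<^sup>+x. f (unitize d x) * indicator {..<r} (L2_set x {..<d}) \<partial>lborel_pi d) =
    ennreal (r ^ d) * (\<integral>\<^sup>+x. f (unitize d x) * indicator {..<1} (L2_set x {..<d}) \<partial>lborel_pi d)"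
  using assms(2)
  by (subst nn_integral_lborel_PiM_scale[of "{..<d}" r])
     (auto simp: unitize_scale L2_set_scale abs_of_pos indicator_def intro!: arg_cong2[where f="(*)"] nn_integral_cong)

text \<open>A null open unit ball would, by homogeneity, make the open ball of radius 2 null, and
  with it the closed unit ball, whose volume is known to be positive.\<close>

lemma nn_integral_open_ball_pos:
  "(\<integral>\<^sup>+x. indicator {..<1} (L2_set x {..<d}) \<partial>lborel_pi d) \<noteq> 0"
proof
  assume 0: "(\<integral>\<^sup>+x. indicator {..<1} (L2_set x {..<d}) \<partial>lborel_pi d) = 0"
  have "ennreal (unit_ball_vol (real d)) = (\<integral>\<^sup>+x. indicator {x \<in> space (lborel_pi d). L2_set x {..<d} \<le> 1} x \<partial>lborel_pi d)"
    by (subst nn_integral_indicator) (auto simp: emeasure_lborel_pi_cball)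
  also have "\<dots> \<le> (\<integral>\<^sup>+x. 1 * indicator {..<2} (L2_set x {..<d}) \<partial>lborel_pi d)"
    by (intro nn_integral_mono) (auto simp: indicator_def)
  also have "\<dots> = 0"
    by (subst nn_integral_open_ball_scale[of "\<lambda>_. 1"]) (auto simp: 0)
  finally show False using unit_ball_vol_pos[OF of_nat_0_le_iff, of d] by (simp add: ennreal_eq_0_iff)
qed

lemma nn_integral_open_ball_finite:
  assumes [measurable]: "f \<in> borel_measurable (borel_pi d)" and C: "\<And>x. f (unitize d x) \<le> ennreal C"
  shows "(\<integral>\<^sup>+x. f (unitize d x) * indicator {..<1} (L2_set x {..<d}) \<partial>lborel_pi d) < \<infinity>"
proof -
  let ?B = "{x \<in> space (lborel_pi d). L2_set x {..<d} \<le> 1}"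
  have "(\<integral>\<^sup>+x. f (unitize d x) * indicator {..<1} (L2_set x {..<d}) \<partial>lborel_pi d) \<le>
     (\<integral>\<^sup>+x. ennreal C * indicator ?B x \<partial>lborel_pi d)"
    by (intro nn_integral_mono) (auto simp: indicator_def C)
  also have "\<dots> = ennreal C * ennreal (unit_ball_vol (real d))"
    by (subst nn_integral_cmult_indicator) (auto simp: emeasure_lborel_pi_cball)
  also have "\<dots> < \<infinity>" by (simp add: ennreal_mult_less_top)
  finally show ?thesis .
qed

text \<open>Both sides integrate \<open>h\<close> against a radial measure, one with weight
  \<open>k1 * f\<close> and one with the constant weight \<open>kf\<close>. Homogeneity gives each
  open ball of radius r the mass r^d * k1 * kf in both cases, and the balls determine the radial
  measure. Boundedness of \<open>f\<close> keeps these masses finite, and multiplying crosswise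
  avoids a division.\<close>

lemma nn_integral_polar_aux:
  fixes f :: "(nat \<Rightarrow> real) \<Rightarrow> ennreal"
  assumes [measurable]: "f \<in> borel_measurable (borel_pi d)" "h \<in> borel_measurable borel"
    and C: "\<And>x. f (unitize d x) \<le> ennreal C"
  defines "k1 \<equiv> (\<integral>\<^sup>+x. indicator {..<1} (L2_set x {..<d}) \<partial>lborel_pi d)"
    and "kf \<equiv> (\<integral>\<^sup>+x. f (unitize d x) * indicator {..<1} (L2_set x {..<d}) \<partial>lborel_pi d)"
  shows "k1 * (\<integral>\<^sup>+x. f (unitize d x) * h (L2_set x {..<d}) \<partial>lborel_pi d) =
    kf * (\<integral>\<^sup>+x. h (L2_set x {..<d}) \<partial>lborel_pi d)"
proof -
  have k1: "k1 < \<infinity>"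
    unfolding k1_def using nn_integral_open_ball_finite[of "\<lambda>_. 1" d 1] by simp
  have kf: "kf < \<infinity>"
    unfolding kf_def by (rule nn_integral_open_ball_finite[OF assms(1) C])
  \<comment> \<open>The minus sign makes the half-line \<open>{x<..}\<close> pull back to the open
    ball of radius -x, of finite mass, rather than to the complement of a ball.\<close>
  let ?M = "\<lambda>g. distr (density (lborel_pi d) g) borel (\<lambda>x. - L2_set x {..<d})"
  have em: "emeasure (?M g) {x<..} = (\<integral>\<^sup>+y. g y * indicator {..<-x} (L2_set y {..<d}) \<partial>lborel_pi d)"
    if [measurable]: "g \<in> borel_measurable (borel_pi d)" for g x
    by (subst emeasure_distr, simp, simp, subst emeasure_density)
       (auto intro!: nn_integral_cong simp: indicator_def)
  have e1: "emeasure (?M (\<lambda>x. k1 * f (unitize d x))) {x<..} = (if x < 0 then ennreal ((-x)^d) * (k1 * kf) else 0)" for x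
  proof (cases "x < 0")
    case True
    have "emeasure (?M (\<lambda>x. k1 * f (unitize d x))) {x<..} =
       k1 * (\<integral>\<^sup>+y. f (unitize d y) * indicator {..<-x} (L2_set y {..<d}) \<partial>lborel_pi d)"
      by (subst em) (auto simp: mult.assoc nn_integral_cmult)
    then show ?thesis using True
      by (subst (asm) nn_integral_open_ball_scale) (auto simp: kf_def mult_ac)
  next
    case False
    then have "- x \<le> L2_set y {..<d}" for y
      by (meson L2_set_nonneg neg_le_0_iff_le not_less order_trans)
    then have "indicator {..<-x} (L2_set y {..<d}) = (0::ennreal)" for y
      by (simp add: indicator_def not_less)
    with False show ?thesis by (subst em) auto
  qed
  have e2: "emeasure (?M (\<lambda>x. kf)) {x<..} = (if x < 0 then ennreal ((-x)^d) * (k1 * kf) else 0)" for x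
  proof (cases "x < 0")
    case True
    have "emeasure (?M (\<lambda>x. kf)) {x<..} =
       kf * (\<integral>\<^sup>+y. 1 * indicator {..<-x} (L2_set y {..<d}) \<partial>lborel_pi d)"
      by (subst em) (auto simp: nn_integral_cmult)
    then show ?thesis using True
      by (subst (asm) nn_integral_open_ball_scale[of "\<lambda>_. 1"]) (auto simp: k1_def mult_ac)
  next
    case False
    then have "- x \<le> L2_set y {..<d}" for y
      by (meson L2_set_nonneg neg_le_0_iff_le not_less order_trans)
    then have "indicator {..<-x} (L2_set y {..<d}) = (0::ennreal)" for y
      by (simp add: indicator_def not_less)
    with False show ?thesis by (subst em) auto
  qed
  have eq: "?M (\<lambda>x. k1 * f (unitize d x)) = ?M (\<lambda>x. kf)"
    by (rule measure_eqI_lessThan) (use k1 kf in \<open>auto simp only: e1 e2 sets_distr, auto simp: ennreal_mult_less_top\<close>)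
  have int: "(\<integral>\<^sup>+y. h (- y) \<partial>?M g) = (\<integral>\<^sup>+x. g x * h (L2_set x {..<d}) \<partial>lborel_pi d)"
    if [measurable]: "g \<in> borel_measurable (borel_pi d)" for g
    by (subst nn_integral_distr, simp, simp, subst nn_integral_density) auto
  from eq have "(\<integral>\<^sup>+y. h (- y) \<partial>?M (\<lambda>x. k1 * f (unitize d x))) = (\<integral>\<^sup>+y. h (- y) \<partial>?M (\<lambda>x. kf))"
    by simp
  then show ?thesis
    by (subst (asm) (1 2) int) (auto simp: mult.assoc nn_integral_cmult)
qed

text \<open>Direction and length are independent under every radial density, the direction being
  uniform on the sphere.\<close>

lemma nn_integral_polar:
  fixes f :: "(nat \<Rightarrow> real) \<Rightarrow> ennreal"
  assumes [measurable]: "f \<in> borel_measurable (borel_pi d)" "h \<in> borel_measurable borel"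
    and C: "\<And>x. f (unitize d x) \<le> ennreal C"
  shows "(\<integral>\<^sup>+x. f (unitize d x) * h (L2_set x {..<d}) \<partial>lborel_pi d) =
    (\<integral>\<^sup>+a. f a \<partial>sphere_uniform d) * (\<integral>\<^sup>+x. h (L2_set x {..<d}) \<partial>lborel_pi d)"
proof -
  define k1 where "k1 = (\<integral>\<^sup>+x. indicator {..<1} (L2_set x {..<d}) \<partial>lborel_pi d)"
  define kf where "kf = (\<integral>\<^sup>+x. f (unitize d x) * indicator {..<1} (L2_set x {..<d}) \<partial>lborel_pi d)"
  define V where "V = ennreal (unit_ball_vol (real d))"
  define F where "F = (\<integral>\<^sup>+x. f (unitize d x) * indicator {..1} (L2_set x {..<d}) \<partial>lborel_pi d)"
  have k1: "k1 < \<infinity>" "k1 \<noteq> 0"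
    unfolding k1_def using nn_integral_open_ball_finite[of "\<lambda>_. 1" d 1] nn_integral_open_ball_pos by simp_all
  have "0 < V" by (simp add: V_def)
  then have V: "V \<noteq> 0" "V < \<infinity>" by (simp, simp add: V_def)
  have V': "(\<integral>\<^sup>+x. indicator {..1} (L2_set x {..<d}) \<partial>lborel_pi d) = V"
  proof -
    have "(\<integral>\<^sup>+x. indicator {..1} (L2_set x {..<d}) \<partial>lborel_pi d) =
      (\<integral>\<^sup>+x. indicator {x \<in> space (lborel_pi d). L2_set x {..<d} \<le> 1} x \<partial>lborel_pi d)"
      by (intro nn_integral_cong) (auto simp: indicator_def)
    then show ?thesis unfolding V_def
      by (subst (asm) nn_integral_indicator) (auto simp: emeasure_lborel_pi_cball)
  qed
  let ?h = "\<integral>\<^sup>+x. h (L2_set x {..<d}) \<partial>lborel_pi d"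
  have 1: "k1 * (\<integral>\<^sup>+x. f (unitize d x) * h (L2_set x {..<d}) \<partial>lborel_pi d) = kf * ?h"
    unfolding k1_def kf_def by (rule nn_integral_polar_aux[OF assms])
  \<comment> \<open>Choosing the indicator of \<open>{..1}\<close> for \<open>h\<close> identifies
    the ratio of \<open>kf\<close> and \<open>k1\<close> with the mean of \<open>f\<close> under
    \<open>sphere_uniform\<close>.\<close>
  have "k1 * F = kf * V"
    unfolding k1_def kf_def F_def V'[symmetric] by (rule nn_integral_polar_aux[OF assms(1) _ C]) auto
  then have "k1 * (F / V) = kf"
    using V by (subst ennreal_times_divide) (simp add: ennreal_mult_divide_eq)
  then have "kf * ?h = k1 * ((F / V) * ?h)" by (metis mult.assoc)
  with 1 have "(\<integral>\<^sup>+x. f (unitize d x) * h (L2_set x {..<d}) \<partial>lborel_pi d) = (F / V) * ?h"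
    using k1 by (simp only: \<open>kf * ?h = _\<close>, subst (asm) ennreal_mult_cancel_left) auto
  then show ?thesis by (simp add: nn_integral_sphere_uniform F_def V_def)
qed

lemma nn_integral_sphere_uniform_uminus:
  assumes [measurable]: "f \<in> borel_measurable (borel_pi d)"
  shows "(\<integral>\<^sup>+a. f (\<lambda>i\<in>{..<d}. - a i) \<partial>sphere_uniform d) = (\<integral>\<^sup>+a. f a \<partial>sphere_uniform d)"
proof -
  have u: "unitize d (\<lambda>i\<in>{..<d}. - x i) = (\<lambda>i\<in>{..<d}. - unitize d x i)" "L2_set (\<lambda>i\<in>{..<d}. - x i) {..<d} = L2_set x {..<d}" for x
    using L2_set_scale[of "-1" x "{..<d}"] by (auto simp: unitize_def)
  show ?thesis
    unfolding nn_integral_sphere_uniform[OF assms]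
    by (subst nn_integral_sphere_uniform, simp, subst (2) nn_integral_lborel_PiM_scale[of _ "-1"]) (auto simp: u)
qed

section \<open>Moments of the uniform distribution on the sphere\<close>

lemma power_double_nonneg: "0 \<le> (x::real) ^ (2 * k)"
  by (simp add: power_mult)

section \<open>Standard Gaussian vectors: density, independence of the coordinates, moments\<close>

lemma indicator_PiE_eq_prod:
  assumes "finite I" "x \<in> extensional I"
  shows "indicator (Pi\<^sub>E I A) x = (\<Prod>i\<in>I. indicator (A i) (x i) :: ennreal)"
proof (cases "\<forall>i\<in>I. x i \<in> A i")
  case True
  then show ?thesis using assms by (simp add: PiE_def Pi_def)
next
  case False
  then obtain i where i: "i \<in> I" "x i \<notin> A i" by blast
  then have "(\<Prod>i\<in>I. indicator (A i) (x i) :: ennreal) = 0"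
    using assms(1) by (intro prod_zero) (auto intro!: bexI[of _ i])
  then show ?thesis using i by (auto simp: indicator_def PiE_def Pi_def)
qed

text \<open>Boxes determine a product measure, and on a box both the density and the indicator
  factor over the coordinates.\<close>

lemma density_PiM_prod:
  fixes g :: "real \<Rightarrow> ennreal"
  assumes "finite I" and [measurable]: "g \<in> borel_measurable borel" and "sigma_finite_measure (density lborel g)"
  shows "density (\<Pi>\<^sub>M i\<in>I. lborel) (\<lambda>x. \<Prod>i\<in>I. g (x i)) = (\<Pi>\<^sub>M i\<in>I. density lborel g)"
proof -
  interpret L: product_sigma_finite "\<lambda>_. (lborel :: real measure)" ..
  interpret G: product_sigma_finite "\<lambda>_. density lborel g"
    by (rule product_sigma_finite.intro) (rule assms(3))
  show ?thesis
  proof (rule G.PiM_eqI[OF assms(1)])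
    show "sets (density (\<Pi>\<^sub>M i\<in>I. lborel) (\<lambda>x. \<Prod>i\<in>I. g (x i))) = sets (\<Pi>\<^sub>M i\<in>I. density lborel g)"
      by (simp, intro sets_PiM_cong) simp_all
    fix A :: "'a \<Rightarrow> real set"
    assume "\<And>i. i \<in> I \<Longrightarrow> A i \<in> sets (density lborel g)"
    then have A: "\<And>i. i \<in> I \<Longrightarrow> A i \<in> sets borel" by simp
    have AD: "Pi\<^sub>E I A \<in> sets (\<Pi>\<^sub>M i\<in>I. lborel)"
      using assms(1) by (intro sets_PiM_I_finite) (simp_all add: A)
    have "emeasure (density (\<Pi>\<^sub>M i\<in>I. lborel) (\<lambda>x. \<Prod>i\<in>I. g (x i))) (Pi\<^sub>E I A) =
       (\<integral>\<^sup>+x. (\<Prod>i\<in>I. g (x i)) * indicator (Pi\<^sub>E I A) x \<partial>(\<Pi>\<^sub>M i\<in>I. lborel))"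
      by (rule emeasure_density[OF _ AD]) measurable
    also have "\<dots> = (\<integral>\<^sup>+x. (\<Prod>i\<in>I. g (x i) * indicator (A i) (x i)) \<partial>(\<Pi>\<^sub>M i\<in>I. lborel))"
      by (rule nn_integral_cong, subst indicator_PiE_eq_prod)
         (simp_all only: assms(1) prod.distrib space_PiM PiE_def IntD2)
    also have "\<dots> = (\<Prod>i\<in>I. \<integral>\<^sup>+y. g y * indicator (A i) y \<partial>lborel)"
      using A by (intro L.product_nn_integral_prod assms(1)) simp
    also have "\<dots> = (\<Prod>i\<in>I. emeasure (density lborel g) (A i))"
      by (intro prod.cong refl) (simp add: emeasure_density A)
    finally show "emeasure (density (\<Pi>\<^sub>M i\<in>I. lborel) (\<lambda>x. \<Prod>i\<in>I. g (x i))) (Pi\<^sub>E I A) =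
      (\<Prod>i\<in>I. emeasure (density lborel g) (A i))" .
  qed
qed

lemma nn_integral_std_gaussian:
  assumes [measurable]: "f \<in> borel_measurable (borel_pi d)"
  shows "(\<integral>\<^sup>+x. f x \<partial>gaussian_iso d 1) =
    (\<integral>\<^sup>+x. f x * ennreal ((1 / sqrt (2 * pi)) ^ d * exp (- (L2_set x {..<d})\<^sup>2 / 2)) \<partial>lborel_pi d)"
proof -
  have "(\<Prod>i<d. ennreal (std_normal_density (x i))) =
    ennreal ((1 / sqrt (2 * pi)) ^ d * exp (- (L2_set x {..<d})\<^sup>2 / 2))" for x
  proof -
    have "(\<Prod>i<d. ennreal (std_normal_density (x i))) = ennreal (\<Prod>i<d. std_normal_density (x i))"
      by (rule prod_ennreal) (rule normal_density_nonneg)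
    also have "(\<Prod>i<d. std_normal_density (x i)) = (\<Prod>i<d. (1 / sqrt (2 * pi))) * (\<Prod>i<d. exp (- (x i)\<^sup>2 / 2))"
      unfolding std_normal_density_def by (rule prod.distrib)
    also have "(\<Prod>i<d. exp (- (x i)\<^sup>2 / 2)) = exp (\<Sum>i<d. - (x i)\<^sup>2 / 2)"
      by (simp add: exp_sum)
    also have "(\<Sum>i<d. - (x i)\<^sup>2 / 2) = - (L2_set x {..<d})\<^sup>2 / 2"
      by (simp add: L2_set_def sum_nonneg sum_negf sum_divide_distrib)
    finally show ?thesis by simp
  qed
  moreover have "gaussian_iso d 1 = density (lborel_pi d) (\<lambda>x. \<Prod>i<d. ennreal (std_normal_density (x i)))"
    by (subst density_PiM_prod)
       (simp_all add: gaussian_iso_def prob_space_imp_sigma_finite prob_space_normal_density)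
  ultimately show ?thesis
    by (subst nn_integral_density[symmetric]) (simp_all add: nn_integral_density mult.commute)
qed
lemma sets_gaussian_iso [measurable_cong]: "sets (gaussian_iso m v) = sets (borel_pi m)"
  unfolding gaussian_iso_def by (intro sets_PiM_cong) auto

lemma sets_sphere_uniform [measurable_cong]: "sets (sphere_uniform d) = sets (borel_pi d)"
  by (simp add: sphere_uniform_def)

lemma std_gaussian_component:
  assumes "i < d"
  shows "distr (gaussian_iso d 1) borel (\<lambda>x. x i) = density lborel (\<lambda>x. ennreal (std_normal_density x))"
proof -
  have "distr (gaussian_iso d 1) (density lborel (\<lambda>x. ennreal (std_normal_density x))) (\<lambda>x. x i) =
     density lborel (\<lambda>x. ennreal (std_normal_density x))"
    unfolding gaussian_iso_def
    by (simp, rule distr_PiM_component) (use assms prob_space_normal_density in auto)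
  also have "distr (gaussian_iso d 1) (density lborel (\<lambda>x. ennreal (std_normal_density x))) (\<lambda>x. x i) =
     distr (gaussian_iso d 1) borel (\<lambda>x. x i)"
    by (intro distr_cong) auto
  finally show ?thesis .
qed

lemma std_gaussian_indep_components:
  "prob_space.indep_vars (gaussian_iso d 1) (\<lambda>_. borel) (\<lambda>i x. x i) {..<d}"
proof (cases "d = 0")
  case False
  interpret prob_space "gaussian_iso d 1" by (rule prob_space_gaussian_iso) simp
  let ?g = "density lborel (\<lambda>x. ennreal (std_normal_density x))"
  have "distr (gaussian_iso d 1) (borel_pi d) (\<lambda>x. \<lambda>i\<in>{..<d}. x i) = distr (gaussian_iso d 1) (gaussian_iso d 1) (\<lambda>x. x)"
    by (intro distr_cong refl) (simp add: sets_gaussian_iso, simp add: gaussian_iso_def space_PiM PiE_def extensional_restrict)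
  also have "\<dots> = gaussian_iso d 1" by (simp add: distr_id2)
  also have "\<dots> = (\<Pi>\<^sub>M i\<in>{..<d}. ?g)" by (simp add: gaussian_iso_def)
  also have "\<dots> = (\<Pi>\<^sub>M i\<in>{..<d}. distr (gaussian_iso d 1) borel (\<lambda>x. x i))"
    by (intro PiM_cong) (auto simp: std_gaussian_component)
  finally show ?thesis
    using False by (subst indep_vars_iff_distr_eq_PiM') auto
next
  case True
  interpret prob_space "gaussian_iso d 1" by (rule prob_space_gaussian_iso) simp
  show ?thesis unfolding indep_vars_def indep_sets_def by (simp add: True)
qed

lemma std_gaussian_inner_distributed:
  assumes "(\<Sum>i<d. (b i)\<^sup>2) > 0"
  shows "distributed (gaussian_iso d 1) lborel (\<lambda>x. \<Sum>i<d. b i * x i)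
     (normal_density 0 (sqrt (\<Sum>i<d. (b i)\<^sup>2)))"
proof -
  interpret prob_space "gaussian_iso d 1" by (rule prob_space_gaussian_iso) simp
  \<comment> \<open>The rule for sums of independent normal variables wants positive standard
    deviations and a nonempty index set, so vanishing coefficients are dropped first.\<close>
  let ?S = "{i\<in>{..<d}. b i \<noteq> 0}"
  have ne: "?S \<noteq> {}"
  proof
    assume "?S = {}"
    then have "(\<Sum>i<d. (b i)\<^sup>2) = 0" by (intro sum.neutral) auto
    with assms show False by simp
  qed
  have "indep_vars (\<lambda>_. borel) (\<lambda>i x. x i) ?S"
    by (rule indep_vars_subset[OF std_gaussian_indep_components]) auto
  from indep_vars_compose2[OF this, of "\<lambda>i x. b i * x" "\<lambda>_. borel"]
  have ind: "indep_vars (\<lambda>_. borel) (\<lambda>i x. b i * x i) ?S" by simp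
  have "distributed (gaussian_iso d 1) lborel (\<lambda>x. \<Sum>i\<in>?S. b i * x i)
     (normal_density (\<Sum>i\<in>?S. 0) (sqrt (\<Sum>i\<in>?S. (\<bar>b i\<bar>)\<^sup>2)))"
  proof (rule sum_indep_normal[OF _ ne ind])
    fix i assume i: "i \<in> ?S"
    then show "0 < \<bar>b i\<bar>" by simp
    have "distributed (gaussian_iso d 1) lborel (\<lambda>x. x i) (normal_density 0 1)"
      using i std_gaussian_component[of i d]
      by (auto simp: distributed_def intro: trans[OF distr_cong[OF refl _ refl, of lborel borel]])
    from normal_density_affine[OF this, of "b i" 0]
    show "distributed (gaussian_iso d 1) lborel (\<lambda>x. b i * x i) (normal_density 0 \<bar>b i\<bar>)"
      using i by simp
  qed auto
  moreover have "(\<Sum>i\<in>?S. b i * x i) = (\<Sum>i<d. b i * x i)" for x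
    by (intro sum.mono_neutral_left) auto
  moreover have "(\<Sum>i\<in>?S. (\<bar>b i\<bar>)\<^sup>2) = (\<Sum>i<d. (b i)\<^sup>2)"
    by (simp, intro sum.mono_neutral_left) auto
  ultimately show ?thesis by simp
qed

text \<open>The factor \<open>fact (2 * k) / (2 ^ k * fact k)\<close> is the double factorial
  (2k-1)!!, the moment of order 2k of a standard normal variable. For \<open>b = 0\<close> the form
  has no normal density and is treated separately.\<close>

lemma std_gaussian_even_moment:
  "(\<integral>\<^sup>+x. ennreal ((\<Sum>i<d. b i * x i) ^ (2 * k)) \<partial>gaussian_iso d 1) =
    ennreal (fact (2 * k) / (2 ^ k * fact k) * (\<Sum>i<d. (b i)\<^sup>2) ^ k)"
proof -
  interpret prob_space "gaussian_iso d 1" by (rule prob_space_gaussian_iso) simp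
  let ?s = "\<Sum>i<d. (b i)\<^sup>2"
  show ?thesis
  proof (cases "?s > 0")
    case True
    have "(\<integral>\<^sup>+x. ennreal ((\<Sum>i<d. b i * x i) ^ (2 * k)) \<partial>gaussian_iso d 1) =
      (\<integral>\<^sup>+y. ennreal (normal_density 0 (sqrt ?s) y) * ennreal (y ^ (2 * k)) \<partial>lborel)"
      by (subst distributed_nn_integral[OF std_gaussian_inner_distributed[OF True]]) auto
    also have "\<dots> = (\<integral>\<^sup>+y. ennreal (normal_density 0 (sqrt ?s) y * (y - 0) ^ (2 * k)) \<partial>lborel)"
      by (intro nn_integral_cong) (simp add: ennreal_mult normal_density_nonneg power_mult)
    also have "\<dots> = ennreal (fact (2 * k) / ((2 / (sqrt ?s)\<^sup>2) ^ k * fact k))"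
    proof (subst nn_integral_eq_integral)
      show "integrable lborel (\<lambda>y. normal_density 0 (sqrt ?s) y * (y - 0) ^ (2 * k))"
        using True by (intro integrable_normal_moment) simp
      show "AE y in lborel. 0 \<le> normal_density 0 (sqrt ?s) y * (y - 0) ^ (2 * k)"
        by (simp add: normal_density_nonneg power_mult)
    qed (use True in \<open>simp only: integral_normal_moment_even real_sqrt_gt_0_iff\<close>)
    also have "fact (2 * k) / ((2 / (sqrt ?s)\<^sup>2) ^ k * fact k) = fact (2 * k) / (2 ^ k * fact k) * ?s ^ k"
      using True by (simp add: power_divide)
    finally show ?thesis .
  next
    case False
    then have s: "?s = 0" by (meson sum_nonneg not_less order_antisym zero_le_power2)
    then have "\<forall>i\<in>{..<d}. (b i)\<^sup>2 = 0" by (subst (asm) sum_nonneg_eq_0_iff) auto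
    then have "(\<Sum>i<d. b i * x i) = 0" for x by (intro sum.neutral) auto
    then show ?thesis unfolding s
      by (cases k) (auto simp: emeasure_space_1)
  qed
qed

lemma std_gaussian_norm_sq:
  "(\<integral>\<^sup>+x. ennreal ((L2_set x {..<d})\<^sup>2) \<partial>gaussian_iso d 1) = ennreal (real d)"
proof -
  have "(\<integral>\<^sup>+x. ennreal ((L2_set x {..<d})\<^sup>2) \<partial>gaussian_iso d 1) =
     (\<integral>\<^sup>+x. (\<Sum>i<d. ennreal ((\<Sum>j<d. (if j = i then 1 else 0) * x j) ^ (2 * 1))) \<partial>gaussian_iso d 1)"
    by (intro nn_integral_cong) (simp add: L2_set_def sum_nonneg if_distrib if_distribR sum.delta cong: if_cong)
  also have "\<dots> = (\<Sum>i<d. \<integral>\<^sup>+x. ennreal ((\<Sum>j<d. (if j = i then 1 else 0) * x j) ^ (2 * 1)) \<partial>gaussian_iso d 1)"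
    by (rule nn_integral_sum) measurable
  also have "\<dots> = (\<Sum>i<d. 1)"
  proof (intro sum.cong refl, subst std_gaussian_even_moment)
    fix i assume "i \<in> {..<d}"
    then have "(\<Sum>j<d. (if j = i then 1 else 0::real)\<^sup>2) = 1"
      by (subst sum.cong[OF refl, of _ _ "\<lambda>j. if j = i then 1 else 0"]) auto
    then show "ennreal (fact (2 * 1) / (2 ^ 1 * fact 1) * (\<Sum>j<d. (if j = i then 1 else 0::real)\<^sup>2) ^ 1) = 1"
      by simp
  qed
  also have "\<dots> = ennreal (real d)" by (simp add: ennreal_of_nat_eq_real_of_nat)
  finally show ?thesis .
qed

text \<open>This is Jensen's inequality for z^k, where z is the squared length, of mean
  \<open>d\<close>. The tangent at z = d is used explicitly, with its negative part moved to the
  other side because subtraction in \<open>ennreal\<close> is truncated.\<close>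

lemma std_gaussian_norm_even_moment:
  "(\<integral>\<^sup>+x. ennreal ((L2_set x {..<d}) ^ (2 * k)) \<partial>gaussian_iso d 1) \<ge> ennreal (real d ^ k)"
proof (cases "d = 0 \<or> k = 0")
  case True
  interpret prob_space "gaussian_iso d 1" by (rule prob_space_gaussian_iso) simp
  show ?thesis using True
    by (cases "k = 0") (auto simp: emeasure_space_1 power_0_left)
next
  case False
  interpret prob_space "gaussian_iso d 1" by (rule prob_space_gaussian_iso) simp
  let ?R = "\<integral>\<^sup>+x. ennreal ((L2_set x {..<d}) ^ (2 * k)) \<partial>gaussian_iso d 1"
  \<comment> \<open>Bernoulli's inequality at z/d - 1 is the tangent inequality after
    rescaling.\<close>
  have tangent: "real d ^ k + k * real d ^ (k - 1) * z \<le> z ^ k + k * real d ^ k" if "z \<ge> 0" for z :: real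
  proof -
    have "1 + real k * (z / d - 1) \<le> (1 + (z / d - 1)) ^ k"
      using that False by (intro Bernoulli_inequality) auto
    then have "real d ^ k * (1 + real k * (z / d - 1)) \<le> real d ^ k * (z / d) ^ k"
      by (intro mult_left_mono) auto
    also have "\<dots> = z ^ k" using False by (simp add: power_divide)
    also have "real d ^ k * (1 + real k * (z / d - 1)) = real d ^ k + k * real d ^ (k - 1) * z - k * real d ^ k"
      using False by (cases k) (auto simp: field_simps)
    finally show ?thesis by simp
  qed
  have "ennreal (real d ^ k) + ennreal (k * real d ^ k) =
     (\<integral>\<^sup>+x. ennreal (real d ^ k) + ennreal (k * real d ^ (k - 1)) * ennreal ((L2_set x {..<d})\<^sup>2) \<partial>gaussian_iso d 1)"
  proof -
    have "(\<integral>\<^sup>+x. ennreal (real d ^ k) + ennreal (k * real d ^ (k - 1)) * ennreal ((L2_set x {..<d})\<^sup>2) \<partial>gaussian_iso d 1)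
      = ennreal (real d ^ k) + ennreal (k * real d ^ (k - 1)) * ennreal (real d)"
      by (subst nn_integral_add, simp, simp, subst nn_integral_cmult)
         (simp_all add: std_gaussian_norm_sq emeasure_space_1)
    also have "ennreal (k * real d ^ (k - 1)) * ennreal (real d) = ennreal (k * real d ^ k)"
      using False power_minus_mult[of k "real d"] by (simp add: ennreal_mult[symmetric] mult.assoc)
    finally show ?thesis ..
  qed
  also have "\<dots> \<le> (\<integral>\<^sup>+x. ennreal ((L2_set x {..<d}) ^ (2 * k)) + ennreal (k * real d ^ k) \<partial>gaussian_iso d 1)"
  proof (rule nn_integral_mono)
    fix x :: "nat \<Rightarrow> real"
    let ?z = "(L2_set x {..<d})\<^sup>2"
    have "ennreal (real d ^ k) + ennreal (k * real d ^ (k - 1)) * ennreal ?z = ennreal (real d ^ k + k * real d ^ (k - 1) * ?z)"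
      by (simp add: ennreal_mult)
    also have "\<dots> \<le> ennreal (?z ^ k + k * real d ^ k)"
      by (rule ennreal_leI[OF tangent]) simp
    also have "\<dots> = ennreal ((L2_set x {..<d}) ^ (2 * k)) + ennreal (k * real d ^ k)"
      by (simp add: power_mult)
    finally show "ennreal (real d ^ k) + ennreal (k * real d ^ (k - 1)) * ennreal ?z \<le>
       ennreal ((L2_set x {..<d}) ^ (2 * k)) + ennreal (k * real d ^ k)" .
  qed
  also have "\<dots> = ?R + ennreal (k * real d ^ k)"
    by (subst nn_integral_add) (auto simp: emeasure_space_1)
  finally show ?thesis
    by (simp add: ennreal_add_left_cancel_le add.commute)
qed

text \<open>A Gaussian vector is its length times its direction, and these are independent, so the
  moment of a linear form is a product. The sphere moment thus becomes a quotient of two Gaussian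
  moments.\<close>

lemma sphere_gaussian_even_moment:
  "(\<integral>\<^sup>+a. ennreal ((\<Sum>i<d. b i * a i) ^ (2 * k)) \<partial>sphere_uniform d) *
     (\<integral>\<^sup>+x. ennreal ((L2_set x {..<d}) ^ (2 * k)) \<partial>gaussian_iso d 1) =
   ennreal (fact (2 * k) / (2 ^ k * fact k) * (\<Sum>i<d. (b i)\<^sup>2) ^ k)"
proof -
  let ?f = "\<lambda>a. ennreal ((\<Sum>i<d. b i * a i) ^ (2 * k))"
  let ?gd = "\<lambda>r::real. ennreal ((1 / sqrt (2 * pi)) ^ d * exp (- r\<^sup>2 / 2))"
  let ?h = "\<lambda>r. ennreal (r ^ (2 * k)) * ?gd r"
  \<comment> \<open>The polar formula asks for a bounded function of the direction. Coordinates of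
    \<open>unitize d x\<close> are at most 1 in absolute value, also at the origin, where division
    by zero gives 0.\<close>
  have bound: "?f (unitize d x) \<le> ennreal ((\<Sum>i<d. \<bar>b i\<bar>) ^ (2 * k))" for x
  proof -
    have u: "\<bar>unitize d x i\<bar> \<le> 1" if "i < d" for i
    proof (cases "L2_set x {..<d} = 0")
      case False
      then have "L2_set x {..<d} > 0" using L2_set_nonneg[of x "{..<d}"] by linarith
      moreover have "\<bar>x i\<bar> \<le> L2_set x {..<d}"
        using member_le_L2_set[of "{..<d}" i "\<lambda>i. \<bar>x i\<bar>"] that by (simp add: L2_set_def)
      ultimately show ?thesis using that by (simp add: unitize_def)
    qed (simp add: unitize_def that)
    have "\<bar>\<Sum>i<d. b i * unitize d x i\<bar> \<le> (\<Sum>i<d. \<bar>b i * unitize d x i\<bar>)" by (rule sum_abs)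
    also have "\<dots> \<le> (\<Sum>i<d. \<bar>b i\<bar>)"
      by (intro sum_mono) (auto simp: abs_mult intro!: mult_left_le u)
    finally have "\<bar>\<Sum>i<d. b i * unitize d x i\<bar> ^ (2 * k) \<le> (\<Sum>i<d. \<bar>b i\<bar>) ^ (2 * k)"
      by (intro power_mono) auto
    then show ?thesis by (intro ennreal_leI) (simp add: power_mult)
  qed
  have dec: "(\<Sum>i<d. b i * x i) = L2_set x {..<d} * (\<Sum>i<d. b i * unitize d x i)" for x
  proof (cases "L2_set x {..<d} = 0")
    case True
    then have "\<forall>i\<in>{..<d}. x i = 0" by (subst (asm) L2_set_eq_0_iff) auto
    then show ?thesis by (simp add: True)
  next
    case False
    then show ?thesis by (simp add: unitize_def sum_distrib_left)
  qed
  have "ennreal (fact (2 * k) / (2 ^ k * fact k) * (\<Sum>i<d. (b i)\<^sup>2) ^ k) =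
    (\<integral>\<^sup>+x. ?f x * ?gd (L2_set x {..<d}) \<partial>lborel_pi d)"
    using nn_integral_std_gaussian[of ?f d] std_gaussian_even_moment[where b=b and d=d and k=k] by simp
  also have "\<dots> = (\<integral>\<^sup>+x. ?f (unitize d x) * ?h (L2_set x {..<d}) \<partial>lborel_pi d)"
  proof (rule nn_integral_cong)
    fix x :: "nat \<Rightarrow> real"
    have "?f x = ?f (unitize d x) * ennreal (L2_set x {..<d} ^ (2 * k))"
      by (subst dec[of x], subst power_mult_distrib, subst ennreal_mult)
         (rule power_double_nonneg | simp only: mult.commute)+
    then show "?f x * ?gd (L2_set x {..<d}) = ?f (unitize d x) * ?h (L2_set x {..<d})"
      by (simp only: mult.assoc)
  qed
  also have "\<dots> = (\<integral>\<^sup>+a. ?f a \<partial>sphere_uniform d) * (\<integral>\<^sup>+x. ?h (L2_set x {..<d}) \<partial>lborel_pi d)"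
    by (rule nn_integral_polar[where C="(\<Sum>i<d. \<bar>b i\<bar>) ^ (2 * k)"]) (simp, simp, rule bound)
  also have "(\<integral>\<^sup>+x. ?h (L2_set x {..<d}) \<partial>lborel_pi d) =
     (\<integral>\<^sup>+x. ennreal ((L2_set x {..<d}) ^ (2 * k)) \<partial>gaussian_iso d 1)"
    by (rule nn_integral_std_gaussian[symmetric]) measurable
  finally show ?thesis by simp
qed

lemma ennreal_mult_le_divide:
  assumes "x * ennreal c \<le> y" "0 < c"
  shows "x \<le> y / ennreal c"
proof -
  have "x = x * ennreal c / ennreal c"
    using assms(2) by (subst ennreal_mult_divide_eq) auto
  also have "\<dots> \<le> y / ennreal c" by (rule divide_right_mono_ennreal[OF assms(1)])
  finally show ?thesis .
qed

text \<open>The lower bound for the moments of the length sits in the denominator. Hence the even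
  moments are dominated by those of a normal variable with variance |b|^2 / d.\<close>

lemma sphere_even_moment:
  assumes "1 \<le> d"
  shows "(\<integral>\<^sup>+a. ennreal ((\<Sum>i<d. b i * a i) ^ (2 * k)) \<partial>sphere_uniform d)
    \<le> ennreal (fact (2 * k) / (2 ^ k * fact k) * ((\<Sum>i<d. (b i)\<^sup>2) / d) ^ k)"
proof -
  let ?x = "\<integral>\<^sup>+a. ennreal ((\<Sum>i<d. b i * a i) ^ (2 * k)) \<partial>sphere_uniform d"
  have "?x * ennreal (real d ^ k) \<le> ennreal (fact (2 * k) / (2 ^ k * fact k) * (\<Sum>i<d. (b i)\<^sup>2) ^ k)"
    unfolding sphere_gaussian_even_moment[symmetric]
    by (intro mult_left_mono std_gaussian_norm_even_moment) auto
  then have "?x \<le> ennreal (fact (2 * k) / (2 ^ k * fact k) * (\<Sum>i<d. (b i)\<^sup>2) ^ k) / ennreal (real d ^ k)"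
    using assms by (intro ennreal_mult_le_divide) auto
  also have "\<dots> = ennreal (fact (2 * k) / (2 ^ k * fact k) * ((\<Sum>i<d. (b i)\<^sup>2) / d) ^ k)"
    using assms by (subst divide_ennreal) (auto simp: power_divide sum_nonneg)
  finally show ?thesis .
qed

text \<open>For \<open>k = 1\<close> the moment of the length is exactly \<open>d\<close>, so
  equality holds; anticoncentration needs this value from below as well.\<close>

lemma sphere_second_moment:
  assumes "1 \<le> d"
  shows "(\<integral>\<^sup>+a. ennreal ((\<Sum>i<d. b i * a i)\<^sup>2) \<partial>sphere_uniform d) = ennreal ((\<Sum>i<d. (b i)\<^sup>2) / d)"
proof -
  define X where "X = (\<integral>\<^sup>+a. ennreal ((\<Sum>i<d. b i * a i)\<^sup>2) \<partial>sphere_uniform d)"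
  have eq: "X * ennreal (real d) = ennreal (\<Sum>i<d. (b i)\<^sup>2)"
    using sphere_gaussian_even_moment[where b=b and d=d and k=1] by (simp add: std_gaussian_norm_sq X_def)
  have "X = X * ennreal (real d) / ennreal (real d)"
    using assms by (intro ennreal_mult_divide_eq[symmetric]) auto
  also have "\<dots> = ennreal ((\<Sum>i<d. (b i)\<^sup>2) / d)"
    using assms unfolding eq by (intro divide_ennreal) (auto simp: sum_nonneg)
  finally show ?thesis by (simp add: X_def)
qed

section \<open>Exponential moments of linear and bilinear forms\<close>

text \<open>Monotone convergence lets a power series with nonnegative terms be bounded coefficient
  by coefficient.\<close>

lemma nn_integral_sums_le:
  fixes f :: "nat \<Rightarrow> 'a \<Rightarrow> real"
  assumes [measurable]: "\<And>k. f k \<in> borel_measurable M"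
    and nonneg: "\<And>k x. 0 \<le> f k x" "\<And>k. 0 \<le> c k"
    and F: "\<And>x. (\<lambda>k. f k x) sums F x" and C: "c sums C"
    and le: "\<And>k. (\<integral>\<^sup>+x. ennreal (f k x) \<partial>M) \<le> ennreal (c k)"
  shows "(\<integral>\<^sup>+x. ennreal (F x) \<partial>M) \<le> ennreal C"
proof -
  have "(\<integral>\<^sup>+x. ennreal (F x) \<partial>M) = (\<integral>\<^sup>+x. (\<Sum>k. ennreal (f k x)) \<partial>M)"
    by (intro nn_integral_cong suminf_ennreal_eq[symmetric] nonneg F)
  also have "\<dots> = (\<Sum>k. \<integral>\<^sup>+x. ennreal (f k x) \<partial>M)"
    by (rule nn_integral_suminf) measurable
  also have "\<dots> \<le> (\<Sum>k. ennreal (c k))"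
    by (intro suminf_le le) auto
  also have "\<dots> = ennreal C" by (rule suminf_ennreal_eq[OF nonneg(2) C])
  finally show ?thesis .
qed

lemma cosh_sums_even: "(\<lambda>k. (x::real) ^ (2 * k) / fact (2 * k)) sums cosh x"
proof -
  have "strict_mono (\<lambda>k::nat. 2 * k)" by (rule strict_monoI) simp
  then have "(\<lambda>k. if even (2 * k) then x ^ (2 * k) /\<^sub>R fact (2 * k) else 0) sums cosh x"
    by (subst sums_mono_reindex[of "\<lambda>k. 2 * k" "\<lambda>n. if even n then x ^ n /\<^sub>R fact n else 0"])
       (auto simp: image_iff intro: cosh_converges elim!: evenE)
  then show ?thesis by (simp add: divide_inverse mult.commute)
qed

lemma exp_sums_divide: "(\<lambda>k. (x::real) ^ k / fact k) sums exp x"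
  using exp_converges[of x] by (simp add: divide_inverse mult.commute)

text \<open>Dividing (2k-1)!! by (2k)! leaves 1/(2^k k!), so the bounds on the terms add up to an
  exponential: the form is subgaussian with variance proxy |b|^2 / d.\<close>

lemma nn_integral_sphere_cosh:
  assumes "1 \<le> d"
  shows "(\<integral>\<^sup>+a. ennreal (cosh (\<Sum>i<d. b i * a i)) \<partial>sphere_uniform d)
    \<le> ennreal (exp ((\<Sum>i<d. (b i)\<^sup>2) / (2 * d)))"
proof (rule nn_integral_sums_le[where f="\<lambda>k a. (\<Sum>i<d. b i * a i) ^ (2 * k) / fact (2 * k)"
      and c="\<lambda>k. ((\<Sum>i<d. (b i)\<^sup>2) / (2 * d)) ^ k / fact k"])
  let ?s = "(\<Sum>i<d. (b i)\<^sup>2) / (2 * d)"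
  show "(\<lambda>k. ?s ^ k / fact k) sums exp ?s"
    by (rule exp_sums_divide)
  show "(\<lambda>k. (\<Sum>i<d. b i * a i) ^ (2 * k) / fact (2 * k)) sums cosh (\<Sum>i<d. b i * a i)" for a
    by (rule cosh_sums_even)
  show "0 \<le> (\<Sum>i<d. b i * x i) ^ (2 * k) / fact (2 * k)" for k and x :: "nat \<Rightarrow> real"
    by (intro divide_nonneg_nonneg power_double_nonneg) simp
  show "0 \<le> ?s ^ k / fact k" for k by (simp add: sum_nonneg)
  fix k
  have "(\<integral>\<^sup>+a. ennreal ((\<Sum>i<d. b i * a i) ^ (2 * k) / fact (2 * k)) \<partial>sphere_uniform d) =
     ennreal (1 / fact (2 * k)) * (\<integral>\<^sup>+a. ennreal ((\<Sum>i<d. b i * a i) ^ (2 * k)) \<partial>sphere_uniform d)"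
    by (subst nn_integral_cmult[symmetric], measurable)
       (simp add: ennreal_mult'[symmetric])
  also have "\<dots> \<le> ennreal (1 / fact (2 * k)) * ennreal (fact (2 * k) / (2 ^ k * fact k) * ((\<Sum>i<d. (b i)\<^sup>2) / d) ^ k)"
    by (intro mult_left_mono sphere_even_moment assms) auto
  also have "\<dots> = ennreal (?s ^ k / fact k)"
    by (simp add: ennreal_mult[symmetric] sum_nonneg power_divide power_mult_distrib)
  finally show "(\<integral>\<^sup>+a. ennreal ((\<Sum>i<d. b i * a i) ^ (2 * k) / fact (2 * k)) \<partial>sphere_uniform d) \<le> ennreal (?s ^ k / fact k)" .
qed measurable

text \<open>The left side is the central binomial coefficient over 2^k, and that coefficient is at
  most its row sum 4^k.\<close>

lemma central_fact_le: "fact (2 * k) / (2 ^ k * fact k * fact k :: real) \<le> 2 ^ k"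
proof -
  have "fact (2 * k) / (fact k * fact k :: real) = real ((2 * k) choose k)"
    by (subst binomial_fact) auto
  also have "real ((2 * k) choose k) \<le> real (\<Sum>j\<le>2 * k. (2 * k) choose j)"
    by (intro of_nat_mono member_le_sum) auto
  also have "\<dots> = 4 ^ k" by (subst choose_row_sum) (simp add: power_mult)
  finally have *: "fact (2 * k) / (fact k * fact k) \<le> (4::real) ^ k" .
  have "fact (2 * k) / (2 ^ k * fact k * fact k :: real) = (fact (2 * k) / (fact k * fact k)) / 2 ^ k"
    by simp
  also have "\<dots> \<le> 4 ^ k / 2 ^ k" by (intro divide_right_mono *) auto
  also have "\<dots> = (2::real) ^ k" by (simp add: power_divide[symmetric])
  finally show ?thesis .
qed

text \<open>The moment bounds turn the exponential series into one dominated by a geometric series.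
  For a normal variable the value would be the square root of this bound; the loss is
  harmless.\<close>

lemma nn_integral_sphere_exp_square:
  assumes "1 \<le> d" "0 \<le> s" and less: "2 * s * (\<Sum>i<d. (b i)\<^sup>2) / d < 1"
  shows "(\<integral>\<^sup>+a. ennreal (exp (s * (\<Sum>i<d. b i * a i)\<^sup>2)) \<partial>sphere_uniform d)
    \<le> ennreal (1 / (1 - 2 * s * (\<Sum>i<d. (b i)\<^sup>2) / d))"
proof (rule nn_integral_sums_le)
  let ?\<beta> = "(\<Sum>i<d. (b i)\<^sup>2) / d"
  let ?f = "\<lambda>k a. s ^ k / fact k * (\<Sum>i<d. b i * a i) ^ (2 * k)"
  have \<beta>: "0 \<le> ?\<beta>" by (simp add: sum_nonneg)
  show "?f k \<in> borel_measurable (sphere_uniform d)" for k by measurable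
  show "0 \<le> ?f k a" for k a using assms by (simp add: power_double_nonneg)
  show "(\<lambda>k. ?f k a) sums exp (s * (\<Sum>i<d. b i * a i)\<^sup>2)" for a
  proof -
    have "?f k a = (s * (\<Sum>i<d. b i * a i)\<^sup>2) ^ k /\<^sub>R fact k" for k
      unfolding power_mult by (simp add: divide_inverse power_mult_distrib)
    then show ?thesis using exp_converges[of "s * (\<Sum>i<d. b i * a i)\<^sup>2"] by simp
  qed
  show "(\<lambda>k. (2 * s * ?\<beta>) ^ k) sums (1 / (1 - 2 * s * (\<Sum>i<d. (b i)\<^sup>2) / d))"
  proof -
    have "0 \<le> 2 * s * ?\<beta>" using assms(2) \<beta> by (intro mult_nonneg_nonneg) auto
    then have "\<bar>2 * s * ?\<beta>\<bar> < 1" using less by (simp only: abs_of_nonneg times_divide_eq_right)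
    then show ?thesis using geometric_sums[of "2 * s * ?\<beta>"] by simp
  qed
  show "0 \<le> (2 * s * ?\<beta>) ^ k" for k using assms(2) \<beta> by (intro zero_le_power mult_nonneg_nonneg) auto
  fix k
  have "(\<integral>\<^sup>+a. ennreal (?f k a) \<partial>sphere_uniform d) =
     ennreal (s ^ k / fact k) * (\<integral>\<^sup>+a. ennreal ((\<Sum>i<d. b i * a i) ^ (2 * k)) \<partial>sphere_uniform d)"
    using assms by (subst nn_integral_cmult[symmetric]) (auto simp: ennreal_mult[symmetric] power_double_nonneg)
  also have "\<dots> \<le> ennreal (s ^ k / fact k) * ennreal (fact (2 * k) / (2 ^ k * fact k) * ?\<beta> ^ k)"
    by (intro mult_left_mono sphere_even_moment assms) auto
  also have "\<dots> = ennreal (fact (2 * k) / (2 ^ k * fact k * fact k) * (s * ?\<beta>) ^ k)"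
  proof -
    have "s ^ k / fact k * (fact (2 * k) / (2 ^ k * fact k) * z ^ k) =
      fact (2 * k) / (2 ^ k * fact k * fact k) * (s * z) ^ k" for z
      by (simp add: power_mult_distrib mult_ac)
    then show ?thesis
      using assms(2) by (subst ennreal_mult'[symmetric]) (simp, simp only:)
  qed
  also have "\<dots> \<le> ennreal (2 ^ k * (s * ?\<beta>) ^ k)"
    using assms(2) \<beta> by (intro ennreal_leI mult_right_mono central_fact_le zero_le_power mult_nonneg_nonneg)
  also have "2 ^ k * (s * ?\<beta>) ^ k = (2 * s * ?\<beta>) ^ k"
    by (simp add: power_mult_distrib[symmetric] mult.assoc)
  finally show "(\<integral>\<^sup>+a. ennreal (?f k a) \<partial>sphere_uniform d) \<le> ennreal ((2 * s * ?\<beta>) ^ k)" .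
qed

text \<open>The \<open>p\<close> squares are dependent and their exponential does not factor.
  Convexity of \<open>exp\<close> separates them, with weights proportional to the squared column
  norms, so that every summand obeys the same bound and only the Frobenius norm survives, not
  \<open>p\<close>.\<close>

lemma nn_integral_sphere_exp_sum_squares:
  fixes B :: "nat \<Rightarrow> nat \<Rightarrow> real"
  assumes "1 \<le> d" "0 \<le> s" and less: "2 * s * (\<Sum>j<p. \<Sum>i<d. (B i j)\<^sup>2) / d < 1"
  shows "(\<integral>\<^sup>+a. ennreal (exp (s * (\<Sum>j<p. (\<Sum>i<d. B i j * a i)\<^sup>2))) \<partial>sphere_uniform d)
    \<le> ennreal (1 / (1 - 2 * s * (\<Sum>j<p. \<Sum>i<d. (B i j)\<^sup>2) / d))"
proof -
  interpret prob_space "sphere_uniform d" by (rule prob_space_sphere_uniform)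
  define c where "c j = (\<Sum>i<d. (B i j)\<^sup>2)" for j
  define G where "G = (\<Sum>j<p. c j)"
  have c0: "0 \<le> c j" for j by (simp add: c_def sum_nonneg)
  have zero: "(\<Sum>i<d. B i j * a i) = 0" if "c j = 0" for j a
  proof -
    have "\<forall>i\<in>{..<d}. (B i j)\<^sup>2 = 0"
      using that sum_nonneg_eq_0_iff[OF finite_lessThan, of d "\<lambda>i. (B i j)\<^sup>2"] unfolding c_def by auto
    then show ?thesis by (intro sum.neutral) auto
  qed
  have less': "2 * s * G / d < 1" using less by (simp add: G_def c_def)
  have G0: "0 \<le> G" by (simp add: G_def c0 sum_nonneg)
  show ?thesis
  proof (cases "G = 0")
    case True
    then have "c j = 0" if "j < p" for j
      using that c0 sum_nonneg_eq_0_iff[OF finite_lessThan, of p c] unfolding G_def by auto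
    then have "(\<Sum>j<p. (\<Sum>i<d. B i j * a i)\<^sup>2) = 0" for a
      by (intro sum.neutral) (simp add: zero)
    moreover have "(\<Sum>j<p. \<Sum>i<d. (B i j)\<^sup>2) = 0" using True by (simp add: G_def c_def)
    ultimately show ?thesis by (simp add: emeasure_space_1)
  next
    case False
    with G0 have G: "G > 0" by simp
    then have "p > 0" by (auto simp: G_def intro: gr0I)
    \<comment> \<open>The weight \<open>c j / G\<close> is compensated by \<open>G / c j\<close> in
      the exponent. Where \<open>c j = 0\<close> the linear form vanishes identically, so the
      division by zero does no harm.\<close>
    have jensen: "exp (s * (\<Sum>j<p. (\<Sum>i<d. B i j * a i)\<^sup>2)) \<le>
      (\<Sum>j<p. c j / G * exp (s * G / c j * (\<Sum>i<d. B i j * a i)\<^sup>2))" for a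
    proof -
      have "s * (\<Sum>j<p. (\<Sum>i<d. B i j * a i)\<^sup>2) = (\<Sum>j<p. c j / G * (s * G / c j * (\<Sum>i<d. B i j * a i)\<^sup>2))"
        unfolding sum_distrib_left
      proof (intro sum.cong refl)
        fix j
        show "s * (\<Sum>i<d. B i j * a i)\<^sup>2 = c j / G * (s * G / c j * (\<Sum>i<d. B i j * a i)\<^sup>2)"
          using G zero[of j a] by (cases "c j = 0") auto
      qed
      moreover have "exp (\<Sum>j<p. (c j / G) *\<^sub>R (s * G / c j * (\<Sum>i<d. B i j * a i)\<^sup>2)) \<le>
        (\<Sum>j<p. c j / G * exp (s * G / c j * (\<Sum>i<d. B i j * a i)\<^sup>2))"
        using G c0 \<open>p > 0\<close>
        by (intro convex_on_sum[OF _ _ exp_convex]) (auto simp: sum_divide_distrib[symmetric] G_def[symmetric])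
      ultimately show ?thesis by simp
    qed
    let ?K = "1 / (1 - 2 * s * G / d)"
    have "(\<integral>\<^sup>+a. ennreal (exp (s * (\<Sum>j<p. (\<Sum>i<d. B i j * a i)\<^sup>2))) \<partial>sphere_uniform d) \<le>
      (\<integral>\<^sup>+a. ennreal (\<Sum>j<p. c j / G * exp (s * G / c j * (\<Sum>i<d. B i j * a i)\<^sup>2)) \<partial>sphere_uniform d)"
      by (intro nn_integral_mono ennreal_leI jensen)
    also have "\<dots> = (\<integral>\<^sup>+a. (\<Sum>j<p. ennreal (c j / G) * ennreal (exp (s * G / c j * (\<Sum>i<d. B i j * a i)\<^sup>2))) \<partial>sphere_uniform d)"
    proof (rule nn_integral_cong)
      fix a :: "nat \<Rightarrow> real"
      let ?E = "\<lambda>j. exp (s * G / c j * (\<Sum>i<d. B i j * a i)\<^sup>2)"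
      have "(\<Sum>j<p. ennreal (c j / G) * ennreal (?E j)) = (\<Sum>j<p. ennreal (c j / G * ?E j))"
        using c0 G by (intro sum.cong refl ennreal_mult[symmetric]) auto
      also have "\<dots> = ennreal (\<Sum>j<p. c j / G * ?E j)"
        using c0 G by (intro sum_ennreal mult_nonneg_nonneg) auto
      finally show "ennreal (\<Sum>j<p. c j / G * ?E j) = (\<Sum>j<p. ennreal (c j / G) * ennreal (?E j))" ..
    qed
    also have "\<dots> = (\<Sum>j<p. \<integral>\<^sup>+a. ennreal (c j / G) * ennreal (exp (s * G / c j * (\<Sum>i<d. B i j * a i)\<^sup>2)) \<partial>sphere_uniform d)"
      by (rule nn_integral_sum) measurable
    also have "\<dots> = (\<Sum>j<p. ennreal (c j / G) * (\<integral>\<^sup>+a. ennreal (exp (s * G / c j * (\<Sum>i<d. B i j * a i)\<^sup>2)) \<partial>sphere_uniform d))"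
      by (intro sum.cong refl nn_integral_cmult) measurable
    also have "\<dots> \<le> (\<Sum>j<p. ennreal (c j / G) * ennreal ?K)"
    proof (rule sum_mono)
      fix j
      show "ennreal (c j / G) * (\<integral>\<^sup>+a. ennreal (exp (s * G / c j * (\<Sum>i<d. B i j * a i)\<^sup>2)) \<partial>sphere_uniform d)
         \<le> ennreal (c j / G) * ennreal ?K"
      proof (cases "c j = 0")
        case False
        then have eq: "2 * (s * G / c j) * (\<Sum>i<d. (B i j)\<^sup>2) / d = 2 * s * G / d"
          by (simp add: c_def[symmetric])
        have "(\<integral>\<^sup>+a. ennreal (exp (s * G / c j * (\<Sum>i<d. B i j * a i)\<^sup>2)) \<partial>sphere_uniform d) \<le> ennreal ?K"
          using nn_integral_sphere_exp_square[of d "s * G / c j" "\<lambda>i. B i j"] assms G c0 less'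
          unfolding eq by simp
        then show ?thesis by (intro mult_left_mono) auto
      qed simp
    qed
    also have "\<dots> = (\<Sum>j<p. ennreal (c j / G)) * ennreal ?K"
      by (simp add: sum_distrib_right)
    also have "(\<Sum>j<p. ennreal (c j / G)) = ennreal (\<Sum>j<p. c j / G)"
      using c0 G by (intro sum_ennreal) auto
    also have "(\<Sum>j<p. c j / G) = 1" using G by (simp add: sum_divide_distrib[symmetric] G_def[symmetric])
    finally show ?thesis by (simp add: G_def c_def)
  qed
qed

text \<open>For fixed \<open>a\<close> the form is linear in \<open>a'\<close>; the subgaussian
  bound leaves the exponential of a squared length that is a sum of squares of linear forms in
  \<open>a\<close>.\<close>

lemma nn_integral_sphere_bilinear_cosh:
  assumes "1 \<le> d" "1 \<le> p" and less: "t\<^sup>2 * (\<Sum>j<p. \<Sum>i<d. (B i j)\<^sup>2) / (real d * real p) < 1"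
  shows "(\<integral>\<^sup>+a. (\<integral>\<^sup>+a'. ennreal (cosh (t * (\<Sum>j<p. (\<Sum>i<d. B i j * a i) * a' j))) \<partial>sphere_uniform p) \<partial>sphere_uniform d)
    \<le> ennreal (1 / (1 - t\<^sup>2 * (\<Sum>j<p. \<Sum>i<d. (B i j)\<^sup>2) / (real d * real p)))"
proof -
  have "(\<integral>\<^sup>+a. (\<integral>\<^sup>+a'. ennreal (cosh (t * (\<Sum>j<p. (\<Sum>i<d. B i j * a i) * a' j))) \<partial>sphere_uniform p) \<partial>sphere_uniform d)
     \<le> (\<integral>\<^sup>+a. ennreal (exp (t\<^sup>2 / (2 * p) * (\<Sum>j<p. (\<Sum>i<d. B i j * a i)\<^sup>2))) \<partial>sphere_uniform d)"
  proof (rule nn_integral_mono)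
    fix a :: "nat \<Rightarrow> real"
    have "t * (\<Sum>j<p. X j * a' j) = (\<Sum>j<p. (t * X j) * a' j)" for X a' :: "nat \<Rightarrow> real"
      by (simp add: sum_distrib_left mult.assoc)
    then have "(\<integral>\<^sup>+a'. ennreal (cosh (t * (\<Sum>j<p. (\<Sum>i<d. B i j * a i) * a' j))) \<partial>sphere_uniform p) \<le>
      ennreal (exp ((\<Sum>j<p. (t * (\<Sum>i<d. B i j * a i))\<^sup>2) / (2 * p)))"
      using nn_integral_sphere_cosh[OF assms(2), of "\<lambda>j. t * (\<Sum>i<d. B i j * a i)"]
      by simp
    also have "(\<Sum>j<p. (t * (\<Sum>i<d. B i j * a i))\<^sup>2) / (2 * p) = t\<^sup>2 / (2 * p) * (\<Sum>j<p. (\<Sum>i<d. B i j * a i)\<^sup>2)"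
      by (simp add: power_mult_distrib sum_distrib_left[symmetric])
    finally show "(\<integral>\<^sup>+a'. ennreal (cosh (t * (\<Sum>j<p. (\<Sum>i<d. B i j * a i) * a' j))) \<partial>sphere_uniform p) \<le>
      ennreal (exp (t\<^sup>2 / (2 * p) * (\<Sum>j<p. (\<Sum>i<d. B i j * a i)\<^sup>2)))" .
  qed
  also have "\<dots> \<le> ennreal (1 / (1 - t\<^sup>2 * (\<Sum>j<p. \<Sum>i<d. (B i j)\<^sup>2) / (real d * real p)))"
    using nn_integral_sphere_exp_sum_squares[OF assms(1), of "t\<^sup>2 / (2 * p)" B p] less assms
    by (simp add: field_simps)
  finally show ?thesis .
qed

section \<open>Gaussian vectors and anticoncentration on the sphere\<close>

abbreviation gaussian1 :: "real \<Rightarrow> real measure" where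
  "gaussian1 v \<equiv> (if v = 0 then return borel 0 else density lborel (normal_density 0 (sqrt v)))"

lemma prob_space_gaussian1: "0 \<le> v \<Longrightarrow> prob_space (gaussian1 v)"
  by (auto simp: prob_space_return intro: prob_space_normal_density)

lemma product_sigma_finite_gaussian1: "0 \<le> v \<Longrightarrow> product_sigma_finite (\<lambda>_. gaussian1 v)"
  by (rule product_sigma_finite.intro) (rule prob_space_imp_sigma_finite[OF prob_space_gaussian1])

lemma nn_integral_normal_density:
  assumes "0 < s" shows "(\<integral>\<^sup>+x. ennreal (normal_density \<mu> s x) \<partial>lborel) = 1"
  using assms by (subst nn_integral_eq_integral) (auto simp: normal_density_nonneg)

lemma nn_integral_gaussian1_exp:
  assumes "0 \<le> v"
  shows "(\<integral>\<^sup>+x. ennreal (exp (b * x)) \<partial>gaussian1 v) = ennreal (exp (v * b\<^sup>2 / 2))"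
proof (cases "v = 0")
  case True
  then show ?thesis by (simp add: nn_integral_return)
next
  case False
  with assms have v: "v > 0" by simp
  have eq: "normal_density 0 (sqrt v) x * exp (b * x) = exp (v * b\<^sup>2 / 2) * normal_density (v * b) (sqrt v) x" for x
  proof -
    have "- (x - 0)\<^sup>2 / (2 * (sqrt v)\<^sup>2) + b * x = v * b\<^sup>2 / 2 + - (x - v * b)\<^sup>2 / (2 * (sqrt v)\<^sup>2)"
      using v by (simp add: field_simps power2_eq_square)
    then have "exp (- (x - 0)\<^sup>2 / (2 * (sqrt v)\<^sup>2)) * exp (b * x) = exp (v * b\<^sup>2 / 2) * exp (- (x - v * b)\<^sup>2 / (2 * (sqrt v)\<^sup>2))"
      by (simp only: exp_add[symmetric])
    then show ?thesis unfolding normal_density_def by (simp only: mult.assoc mult.left_commute)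
  qed
  have "(\<integral>\<^sup>+x. ennreal (exp (b * x)) \<partial>gaussian1 v) =
    (\<integral>\<^sup>+x. ennreal (normal_density 0 (sqrt v) x) * ennreal (exp (b * x)) \<partial>lborel)"
    using False by (simp add: nn_integral_density)
  also have "\<dots> = (\<integral>\<^sup>+x. ennreal (exp (v * b\<^sup>2 / 2)) * ennreal (normal_density (v * b) (sqrt v) x) \<partial>lborel)"
    by (intro nn_integral_cong) (simp only: eq ennreal_mult'[OF normal_density_nonneg, symmetric] ennreal_mult'[OF exp_ge_zero, symmetric])
  also have "\<dots> = ennreal (exp (v * b\<^sup>2 / 2))"
    using v by (subst nn_integral_cmult) (auto simp: nn_integral_normal_density)
  finally show ?thesis .
qed

text \<open>Tilting a centred normal density by \<open>exp (s * x\<^sup>2)\<close> changes its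
  variance from \<open>v\<close> to v/(1 - 2sv); the value is the quotient of the normalizing
  constants.\<close>

lemma nn_integral_gaussian1_exp_square:
  assumes "0 \<le> v" and less: "2 * s * v < 1"
  shows "(\<integral>\<^sup>+x. ennreal (exp (s * x\<^sup>2)) \<partial>gaussian1 v) = ennreal (1 / sqrt (1 - 2 * s * v))"
proof (cases "v = 0")
  case True
  then show ?thesis by (simp add: nn_integral_return)
next
  case False
  with assms have v: "v > 0" by simp
  let ?w = "v / (1 - 2 * s * v)"
  have w: "?w > 0" using v less by simp
  have eq: "normal_density 0 (sqrt v) x * exp (s * x\<^sup>2) = 1 / sqrt (1 - 2 * s * v) * normal_density 0 (sqrt ?w) x" for x
  proof -
    have "- (x - 0)\<^sup>2 / (2 * (sqrt v)\<^sup>2) + s * x\<^sup>2 = - (x - 0)\<^sup>2 / (2 * (sqrt ?w)\<^sup>2)"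
      using v w less by (simp add: field_simps)
    then have e: "exp (- (x - 0)\<^sup>2 / (2 * (sqrt v)\<^sup>2)) * exp (s * x\<^sup>2) = exp (- (x - 0)\<^sup>2 / (2 * (sqrt ?w)\<^sup>2))"
      by (simp only: exp_add[symmetric])
    have "1 / sqrt (2 * pi * (sqrt v)\<^sup>2) = 1 / sqrt (1 - 2 * s * v) * (1 / sqrt (2 * pi * (sqrt ?w)\<^sup>2))"
      using v w less by (simp add: real_sqrt_mult real_sqrt_divide)
    with e show ?thesis unfolding normal_density_def by (simp only: mult.assoc)
  qed
  have "(\<integral>\<^sup>+x. ennreal (exp (s * x\<^sup>2)) \<partial>gaussian1 v) =
    (\<integral>\<^sup>+x. ennreal (normal_density 0 (sqrt v) x) * ennreal (exp (s * x\<^sup>2)) \<partial>lborel)"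
    using False by (simp add: nn_integral_density)
  also have "\<dots> = (\<integral>\<^sup>+x. ennreal (1 / sqrt (1 - 2 * s * v)) * ennreal (normal_density 0 (sqrt ?w) x) \<partial>lborel)"
    using less by (intro nn_integral_cong)
      (simp only: eq ennreal_mult'[OF normal_density_nonneg, symmetric] ennreal_mult''[OF normal_density_nonneg, symmetric])
  also have "\<dots> = ennreal (1 / sqrt (1 - 2 * s * v))"
    using w by (subst nn_integral_cmult) (auto simp: nn_integral_normal_density)
  finally show ?thesis .
qed

lemma nn_integral_gaussian_exp:
  assumes "0 \<le> v"
  shows "(\<integral>\<^sup>+e. ennreal (exp (\<Sum>r<m. b r * e r)) \<partial>gaussian_iso m v) = ennreal (exp (v * (\<Sum>r<m. (b r)\<^sup>2) / 2))"
proof -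
  interpret product_sigma_finite "\<lambda>_::nat. gaussian1 v" by (rule product_sigma_finite_gaussian1[OF assms])
  have "(\<integral>\<^sup>+e. ennreal (exp (\<Sum>r<m. b r * e r)) \<partial>gaussian_iso m v) =
     (\<integral>\<^sup>+e. (\<Prod>r<m. ennreal (exp (b r * e r))) \<partial>(\<Pi>\<^sub>M i\<in>{..<m}. gaussian1 v))"
    unfolding gaussian_iso_def by (intro nn_integral_cong) (simp add: exp_sum prod_ennreal)
  also have "\<dots> = (\<Prod>r<m. ennreal (exp (v * (b r)\<^sup>2 / 2)))"
    by (subst product_nn_integral_prod) (simp_all add: nn_integral_gaussian1_exp[OF assms] del: if_split)
  also have "\<dots> = ennreal (exp (\<Sum>r<m. v * (b r)\<^sup>2 / 2))"
    by (simp add: exp_sum prod_ennreal)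
  also have "(\<Sum>r<m. v * (b r)\<^sup>2 / 2) = v * (\<Sum>r<m. (b r)\<^sup>2) / 2"
    by (simp add: sum_distrib_left sum_divide_distrib)
  finally show ?thesis .
qed

lemma nn_integral_gaussian_exp_norm_square:
  assumes "0 \<le> v" "2 * s * v < 1"
  shows "(\<integral>\<^sup>+e. ennreal (exp (s * (\<Sum>r<m. (e r)\<^sup>2))) \<partial>gaussian_iso m v) = ennreal ((1 / sqrt (1 - 2 * s * v)) ^ m)"
proof -
  interpret product_sigma_finite "\<lambda>_::nat. gaussian1 v" by (rule product_sigma_finite_gaussian1[OF assms(1)])
  have "(\<integral>\<^sup>+e. ennreal (exp (s * (\<Sum>r<m. (e r)\<^sup>2))) \<partial>gaussian_iso m v) =
     (\<integral>\<^sup>+e. (\<Prod>r<m. ennreal (exp (s * (e r)\<^sup>2))) \<partial>(\<Pi>\<^sub>M i\<in>{..<m}. gaussian1 v))"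
    unfolding gaussian_iso_def by (intro nn_integral_cong) (simp add: exp_sum prod_ennreal sum_distrib_left)
  also have "\<dots> = (\<Prod>r<m. ennreal (1 / sqrt (1 - 2 * s * v)))"
    by (subst product_nn_integral_prod) (simp_all add: nn_integral_gaussian1_exp_square[OF assms] del: if_split)
  also have "\<dots> = ennreal ((1 / sqrt (1 - 2 * s * v)) ^ m)"
    using assms by (subst prod_ennreal) auto
  finally show ?thesis .
qed

text \<open>Given \<open>e\<close> the form is a centred normal variable with variance v |e|^2, so
  the outer integral is an exponential moment of |e|^2.\<close>

lemma nn_integral_gaussian_bilinear_exp:
  assumes "0 \<le> v" "(t * v)\<^sup>2 < 1"
  shows "(\<integral>\<^sup>+e. (\<integral>\<^sup>+e'. ennreal (exp (t * (\<Sum>r<m. e r * e' r))) \<partial>gaussian_iso m v) \<partial>gaussian_iso m v) =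
    ennreal ((1 / sqrt (1 - (t * v)\<^sup>2)) ^ m)"
proof -
  have "(\<integral>\<^sup>+e'. ennreal (exp (t * (\<Sum>r<m. e r * e' r))) \<partial>gaussian_iso m v) = ennreal (exp (v * t\<^sup>2 / 2 * (\<Sum>r<m. (e r)\<^sup>2)))" for e
  proof -
    have "t * (\<Sum>r<m. e r * e' r) = (\<Sum>r<m. (t * e r) * e' r)" for e'
      by (simp add: sum_distrib_left mult.assoc)
    moreover have "v * (\<Sum>r<m. (t * e r)\<^sup>2) / 2 = v * t\<^sup>2 / 2 * (\<Sum>r<m. (e r)\<^sup>2)"
      by (simp add: power_mult_distrib sum_distrib_left[symmetric])
    ultimately show ?thesis
      using nn_integral_gaussian_exp[OF assms(1), of m "\<lambda>r. t * e r"] by simp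
  qed
  then show ?thesis
    using nn_integral_gaussian_exp_norm_square[OF assms(1), of "v * t\<^sup>2 / 2" m] assms(2)
    by (simp add: power2_eq_square mult_ac)
qed

lemma AE_gaussian_iso_0: "AE e in gaussian_iso m 0. \<forall>r<m. e r = 0"
proof -
  have "AE e in gaussian_iso m 0. e r = 0" if "r < m" for r
    unfolding gaussian_iso_def using that
    by (intro AE_PiM_component[where P="\<lambda>x. x = 0"]) (auto simp: prob_space_return AE_return)
  then have "AE e in gaussian_iso m 0. \<forall>r\<in>{..<m}. e r = 0"
    by (subst AE_finite_all) auto
  then show ?thesis by eventually_elim auto
qed

section \<open>Symmetry, moments and anticoncentration on the sphere\<close>

lemma distr_sphere_uniform_uminus:
  "distr (sphere_uniform d) (sphere_uniform d) (\<lambda>a. \<lambda>i\<in>{..<d}. - a i) = sphere_uniform d"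
proof (rule measure_eqI)
  fix A assume A: "A \<in> sets (distr (sphere_uniform d) (sphere_uniform d) (\<lambda>a. \<lambda>i\<in>{..<d}. - a i))"
  then have [measurable]: "A \<in> sets (borel_pi d)" by (simp add: sets_sphere_uniform)
  have "emeasure (distr (sphere_uniform d) (sphere_uniform d) (\<lambda>a. \<lambda>i\<in>{..<d}. - a i)) A =
    (\<integral>\<^sup>+a. indicator A a \<partial>distr (sphere_uniform d) (sphere_uniform d) (\<lambda>a. \<lambda>i\<in>{..<d}. - a i))"
    using A by simp
  also have "\<dots> = (\<integral>\<^sup>+a. indicator A (\<lambda>i\<in>{..<d}. - a i) \<partial>sphere_uniform d)"
    by (rule nn_integral_distr) measurable
  also have "\<dots> = (\<integral>\<^sup>+a. indicator A a \<partial>sphere_uniform d)"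
    by (rule nn_integral_sphere_uniform_uminus) measurable
  finally show "emeasure (distr (sphere_uniform d) (sphere_uniform d) (\<lambda>a. \<lambda>i\<in>{..<d}. - a i)) A = emeasure (sphere_uniform d) A"
    using A by simp
qed simp

lemma sphere_odd_moment:
  assumes "odd k"
  shows "(\<integral>a. (\<Sum>i<d. b i * a i) ^ k \<partial>sphere_uniform d) = 0"
proof -
  let ?X = "\<lambda>a. (\<Sum>i<d. b i * a i) ^ k"
  have "(\<integral>a. ?X a \<partial>sphere_uniform d) =
     (\<integral>a. ?X a \<partial>distr (sphere_uniform d) (sphere_uniform d) (\<lambda>a. \<lambda>i\<in>{..<d}. - a i))"
    by (simp add: distr_sphere_uniform_uminus)
  also have "\<dots> = (\<integral>a. ?X (\<lambda>i\<in>{..<d}. - a i) \<partial>sphere_uniform d)"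
    by (rule integral_distr) measurable
  also have "\<dots> = (\<integral>a. - ?X a \<partial>sphere_uniform d)"
    using assms by (simp add: sum_negf)
  finally show ?thesis by simp
qed

lemma sphere_integrable_even:
  assumes "1 \<le> d"
  shows "integrable (sphere_uniform d) (\<lambda>a. (\<Sum>i<d. b i * a i) ^ (2 * k))"
  by (rule integrableI_nonneg)
     (use le_less_trans[OF sphere_even_moment[OF assms, of b k] ennreal_less_top] in \<open>auto simp: power_double_nonneg\<close>)

lemma sphere_integrable_power:
  assumes "1 \<le> d"
  shows "integrable (sphere_uniform d) (\<lambda>a. (\<Sum>i<d. b i * a i) ^ k)"
proof (rule Bochner_Integration.integrable_bound)
  interpret prob_space "sphere_uniform d" by (rule prob_space_sphere_uniform)
  show "integrable (sphere_uniform d) (\<lambda>a. 1 + (\<Sum>i<d. b i * a i) ^ (2 * k))"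
    by (intro Bochner_Integration.integrable_add sphere_integrable_even assms) simp
  have "\<bar>x ^ k\<bar> \<le> 1 + x ^ (2 * k)" for x :: real
  proof -
    have "0 \<le> (1 - \<bar>x ^ k\<bar>)\<^sup>2" "0 \<le> \<bar>x ^ k\<bar>" by simp_all
    moreover have "x ^ (2 * k) = \<bar>x ^ k\<bar>\<^sup>2" by (simp add: power_mult[symmetric] mult.commute)
    ultimately show ?thesis unfolding power2_diff by simp
  qed
  then show "AE a in sphere_uniform d. norm ((\<Sum>i<d. b i * a i) ^ k) \<le> norm (1 + (\<Sum>i<d. b i * a i) ^ (2 * k))"
    by (auto intro!: AE_I2 order_trans[OF _ abs_ge_self])
qed measurable

lemma sphere_moment2:
  assumes "1 \<le> d"
  shows "(\<integral>a. (\<Sum>i<d. b i * a i)\<^sup>2 \<partial>sphere_uniform d) = (\<Sum>i<d. (b i)\<^sup>2) / d"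
  by (rule integral_eq_nn_integral[THEN trans])
     (auto simp: sphere_second_moment[OF assms] sum_nonneg)

lemma sphere_moment4:
  assumes "1 \<le> d"
  shows "(\<integral>a. (\<Sum>i<d. b i * a i) ^ 4 \<partial>sphere_uniform d) \<le> 3 * ((\<Sum>i<d. (b i)\<^sup>2) / d)\<^sup>2"
  by (rule integral_real_bounded)
     (use sphere_even_moment[OF assms, of b 2] in \<open>auto simp: fact_numeral\<close>)

text \<open>A Paley--Zygmund argument: for \<open>Z = (\<langle>b, a\<rangle> + s)\<^sup>2 / M\<close> with mean 1 and second moment at most 3, the
  concave quadratic \<open>3/5 (Z - 1/4) - 9/100 (Z - 1/4)\<^sup>2\<close> is a minorant of the indicator of \<open>Z \<ge> 1/4\<close>.\<close>

lemma sphere_small_ball: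
  assumes "1 \<le> d"
  shows "measure (sphere_uniform d)
     {a \<in> space (sphere_uniform d). L2_set b {..<d} / (2 * sqrt d) \<le> \<bar>(\<Sum>i<d. b i * a i) + s\<bar>} \<ge> 1 / 5"
proof -
  interpret prob_space "sphere_uniform d" by (rule prob_space_sphere_uniform)
  define X where "X a = (\<Sum>i<d. b i * a i)" for a
  define \<beta> where "\<beta> = (\<Sum>i<d. (b i)\<^sup>2) / d"
  define M where "M = \<beta> + s\<^sup>2"
  have \<beta>: "0 \<le> \<beta>" by (simp add: \<beta>_def sum_nonneg)
  have [measurable]: "X \<in> borel_measurable (sphere_uniform d)" unfolding X_def by measurable
  let ?A = "{a \<in> space (sphere_uniform d). L2_set b {..<d} / (2 * sqrt d) \<le> \<bar>X a + s\<bar>}"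
  have L2: "(L2_set b {..<d} / (2 * sqrt d))\<^sup>2 = \<beta> / 4"
    by (simp add: L2_set_def \<beta>_def power_divide power_mult_distrib sum_nonneg)
  have "prob ?A \<ge> 1 / 5"
  proof (cases "M = 0")
    case True
    then have "\<beta> = 0" using \<beta> by (auto simp: M_def add_nonneg_eq_0_iff)
    then have "L2_set b {..<d} / (2 * sqrt d) = 0" using L2 by simp
    then have "?A = space (sphere_uniform d)" by auto
    then show ?thesis by (simp add: prob_space)
  next
    case False
    then have M: "M > 0" using \<beta> by (simp add: M_def less_le)
    define h where "h = 1 / M"
    have h: "h > 0" "h * M = 1" using M by (simp_all add: h_def)
    \<comment> \<open>The quadratic 3/5 u - 9/100 u^2 is 1 - (3u/10 - 1)^2: it is at most 1, with
      the maximum at u = 10/3, and it is negative for u < 0.\<close>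
    define \<phi> where "\<phi> a = 3/5 * ((X a + s)\<^sup>2 * h - 1/4) - 9/100 * ((X a + s)\<^sup>2 * h - 1/4)\<^sup>2" for a
    have int: "integrable (sphere_uniform d) (\<lambda>a. X a ^ k)" for k
      unfolding X_def by (rule sphere_integrable_power[OF assms])
    have E: "expectation (\<lambda>a. X a) = 0" "expectation (\<lambda>a. X a ^ 3) = 0"
      using sphere_odd_moment[of 1 d b] sphere_odd_moment[of 3 d b] by (simp_all add: X_def)
    have E2: "expectation (\<lambda>a. (X a)\<^sup>2) = \<beta>" unfolding X_def \<beta>_def by (rule sphere_moment2[OF assms])
    have E4: "expectation (\<lambda>a. X a ^ 4) \<le> 3 * \<beta>\<^sup>2" unfolding X_def \<beta>_def by (rule sphere_moment4[OF assms])
    note int1 = int[of 1, simplified]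
    \<comment> \<open>These are the coefficients of \<open>\<phi>\<close> as a quartic in
      \<open>X\<close>. By symmetry those of odd degree drop out in the mean; \<open>c4\<close> is
      negative, so the upper bound on the fourth moment acts in the right direction.\<close>
    define c4 c3 c2 c1 c0 where "c4 = - 9/100 * h\<^sup>2" and "c3 = - 36/100 * s * h\<^sup>2"
      and "c2 = 129/200 * h - 54/100 * s\<^sup>2 * h\<^sup>2"
      and "c1 = 129/100 * s * h - 36/100 * s ^ 3 * h\<^sup>2"
      and "c0 = 129/200 * s\<^sup>2 * h - 9/100 * s ^ 4 * h\<^sup>2 - 249/1600"
    note c_defs = c4_def c3_def c2_def c1_def c0_def
    have \<phi>: "\<phi> a = c4 * X a ^ 4 + c3 * X a ^ 3 + c2 * (X a)\<^sup>2 + c1 * X a + c0" for a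
      unfolding \<phi>_def c_defs
      by (simp add: algebra_simps power2_eq_square power3_eq_cube power4_eq_xxxx)
    have int\<phi>: "integrable (sphere_uniform d) \<phi>"
      unfolding \<phi> by (intro Bochner_Integration.integrable_add integrable_mult_right int int1) simp
    have "1 / 5 \<le> c4 * (3 * \<beta>\<^sup>2) + c2 * \<beta> + c0"
    proof -
      \<comment> \<open>The shares of variance and shift in \<open>M\<close> add up to 1. The
        resulting minimum 351/1600 exceeds 320/1600 = 1/5, and a shift can only raise the
        value.\<close>
      define P Q where "P = h * \<beta>" and "Q = h * s\<^sup>2"
      have "Q = 1 - P" using h(2) by (simp add: P_def Q_def M_def algebra_simps)
      have "c4 * (3 * \<beta>\<^sup>2) + c2 * \<beta> + c0 =
        129/200 * (P + Q) - 27/100 * P\<^sup>2 - 54/100 * P * Q - 9/100 * Q\<^sup>2 - 249/1600"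
        unfolding c_defs P_def Q_def by (simp add: algebra_simps power2_eq_square power4_eq_xxxx)
      also have "\<dots> = 351/1600 + 18/100 * Q\<^sup>2"
        unfolding \<open>Q = 1 - P\<close> by (simp add: field_simps power2_eq_square)
      finally show ?thesis using zero_le_power2[of Q] by linarith
    qed
    also have "\<dots> \<le> c4 * expectation (\<lambda>a. X a ^ 4) + c2 * \<beta> + c0"
      using mult_left_mono_neg[OF E4, of c4] by (simp add: c4_def)
    also have "\<dots> = expectation \<phi>"
      unfolding \<phi> using int int1 by (simp add: E E2 prob_space)
    also have "\<dots> \<le> expectation (indicator ?A)"
    proof (rule integral_mono[OF int\<phi>])
      show "integrable (sphere_uniform d) (indicator ?A :: _ \<Rightarrow> real)" by (intro integrable_real_indicator) (auto simp: emeasure_eq_measure)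
      fix a assume a: "a \<in> space (sphere_uniform d)"
      let ?u = "(X a + s)\<^sup>2 * h - 1/4"
      show "\<phi> a \<le> indicator ?A a"
      proof (cases "a \<in> ?A")
        case True
        have "3/5 * u - 9/100 * u\<^sup>2 \<le> 1" for u :: real
          using zero_le_power2[of "3/10 * u - 1"] by (simp add: power2_eq_square field_simps)
        then have "\<phi> a \<le> 1" unfolding \<phi>_def .
        with True show ?thesis by simp
      next
        case False
        then have "\<bar>X a + s\<bar> < L2_set b {..<d} / (2 * sqrt d)" using a by auto
        then have "\<bar>X a + s\<bar>\<^sup>2 < (L2_set b {..<d} / (2 * sqrt d))\<^sup>2"
          by (intro power_strict_mono) auto
        then have "(X a + s)\<^sup>2 < \<beta> / 4" unfolding L2 by simp
        also have "\<dots> \<le> M / 4" by (simp add: M_def)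
        finally have "?u < 0" using M by (simp add: h_def field_simps)
        moreover have "3/5 * u - 9/100 * u\<^sup>2 \<le> 0" if "u < 0" for u :: real
          using zero_le_power2[of u] that by linarith
        ultimately have "\<phi> a \<le> 0" unfolding \<phi>_def by blast
        with False show ?thesis by simp
      qed
    qed
    also have "\<dots> = prob ?A" by simp
    finally show ?thesis .
  qed
  then show ?thesis by (simp add: X_def)
qed

text \<open>One factor of the Chernoff bound for the number of neighbours. The hit probability 1/5
  is multiplied by 1 - exp(-1/10) \<ge> 1/11, and 1 - 1/55 \<le> exp(-1/55). The tilt 1/10 is small
  enough for 1/55 to exceed 1/60, the cost per point of \<open>q\<close> being a sixth of the
  cluster.\<close>

lemma nn_integral_sphere_small_ball:
  assumes "1 \<le> d"
  shows "(\<integral>\<^sup>+a. ennreal (if L2_set b {..<d} / (2 * sqrt d) \<le> \<bar>(\<Sum>i<d. b i * a i) + s\<bar> then exp (- 1/10) else 1) \<partial>sphere_uniform d)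
    \<le> ennreal (exp (- 1/55))"
proof -
  interpret prob_space "sphere_uniform d" by (rule prob_space_sphere_uniform)
  let ?A = "{a \<in> space (sphere_uniform d). L2_set b {..<d} / (2 * sqrt d) \<le> \<bar>(\<Sum>i<d. b i * a i) + s\<bar>}"
  let ?f = "\<lambda>a. if L2_set b {..<d} / (2 * sqrt d) \<le> \<bar>(\<Sum>i<d. b i * a i) + s\<bar> then exp (- 1/10) else 1 :: real"
  have [measurable]: "?A \<in> sets (sphere_uniform d)" by measurable
  have "(\<integral>\<^sup>+a. ennreal (?f a) \<partial>sphere_uniform d) = ennreal (\<integral>a. ?f a \<partial>sphere_uniform d)"
    by (rule nn_integral_eq_integral, rule integrable_const_bound[where B=1]) auto
  also have "(\<integral>a. ?f a \<partial>sphere_uniform d) = (\<integral>a. 1 - (1 - exp (- 1/10)) * indicator ?A a \<partial>sphere_uniform d)"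
    by (intro Bochner_Integration.integral_cong) auto
  also have "\<dots> = 1 - (1 - exp (- 1/10)) * prob ?A"
    by (subst Bochner_Integration.integral_diff)
       (auto simp: prob_space emeasure_eq_measure intro!: integrable_mult_right integrable_real_indicator)
  also have "\<dots> \<le> 1 - (1 / 11) * (1 / 5)"
  proof -
    have "exp (1/10 :: real) \<ge> 11/10" using exp_ge_add_one_self[of "1/10 :: real"] by simp
    then have "exp (- 1/10 :: real) \<le> 10 / 11" by (simp add: exp_minus field_simps)
    then have "1 / 11 * (1 / 5) \<le> (1 - exp (- 1/10)) * prob ?A"
      by (intro mult_mono sphere_small_ball assms) auto
    then show ?thesis by simp
  qed
  also have "\<dots> \<le> exp (- 1/55)" using exp_ge_add_one_self[of "- 1/55 :: real"] by simp
  finally show ?thesis by (simp add: ennreal_leI)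
qed

section \<open>The data model\<close>

lemma nn_integral_PiM_component:
  assumes "\<And>i. i \<in> I \<Longrightarrow> prob_space (M i)" "i \<in> I" "f \<in> borel_measurable (M i)"
  shows "(\<integral>\<^sup>+\<omega>. f (\<omega> i) \<partial>PiM I M) = (\<integral>\<^sup>+x. f x \<partial>M i)"
proof -
  have "(\<integral>\<^sup>+x. f x \<partial>M i) = (\<integral>\<^sup>+x. f x \<partial>distr (PiM I M) (M i) (\<lambda>\<omega>. \<omega> i))"
    using assms by (subst distr_PiM_component) auto
  also have "\<dots> = (\<integral>\<^sup>+\<omega>. f (\<omega> i) \<partial>PiM I M)"
    using assms by (intro nn_integral_distr) auto
  finally show ?thesis ..
qed

lemma nn_integral_PiM_two_components:
  assumes "finite I" and prob: "\<And>i. prob_space (M i)" and ij: "i \<in> I" "j \<in> I" "i \<noteq> j"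
    and [measurable]: "(\<lambda>(x, y). f x y) \<in> borel_measurable (M i \<Otimes>\<^sub>M M j)"
  shows "(\<integral>\<^sup>+\<omega>. f (\<omega> i) (\<omega> j) \<partial>PiM I M) = (\<integral>\<^sup>+x. (\<integral>\<^sup>+y. f x y \<partial>M j) \<partial>M i)"
proof -
  interpret product_sigma_finite M
    by (rule product_sigma_finite.intro) (rule prob_space_imp_sigma_finite[OF prob])
  have I: "I = insert i (I - {i})" using ij by auto
  have [measurable]: "(\<lambda>\<omega>. \<omega> i) \<in> PiM (insert i (I - {i})) M \<rightarrow>\<^sub>M M i" "(\<lambda>\<omega>. \<omega> j) \<in> PiM (insert i (I - {i})) M \<rightarrow>\<^sub>M M j"
    using ij by (auto intro!: measurable_component_singleton)
  have meas: "(\<lambda>\<omega>. f (\<omega> i) (\<omega> j)) \<in> borel_measurable (PiM (insert i (I - {i})) M)"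
    by measurable
  have "(\<integral>\<^sup>+\<omega>. f (\<omega> i) (\<omega> j) \<partial>PiM (insert i (I - {i})) M) =
     (\<integral>\<^sup>+x. (\<integral>\<^sup>+\<omega>. f (fun_upd \<omega> i x i) (fun_upd \<omega> i x j) \<partial>PiM (I - {i}) M) \<partial>M i)"
    by (rule product_nn_integral_insert_rev[OF _ _ meas]) (use assms(1) in simp_all)
  also have "\<dots> = (\<integral>\<^sup>+x. (\<integral>\<^sup>+y. f x y \<partial>M j) \<partial>M i)"
  proof (rule nn_integral_cong)
    fix x assume x: "x \<in> space (M i)"
    then have "(\<lambda>y. f x y) \<in> borel_measurable (M j)" by simp
    then have "(\<integral>\<^sup>+\<omega>. f x (\<omega> j) \<partial>PiM (I - {i}) M) = (\<integral>\<^sup>+y. f x y \<partial>M j)"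
      using ij prob by (intro nn_integral_PiM_component) auto
    then show "(\<integral>\<^sup>+\<omega>. f (fun_upd \<omega> i x i) (fun_upd \<omega> i x j) \<partial>PiM (I - {i}) M) = (\<integral>\<^sup>+y. f x y \<partial>M j)"
      using ij by simp
  qed
  finally show ?thesis using I by simp
qed

lemma emeasure_tail_le_exp:
  assumes [measurable]: "X \<in> borel_measurable M" and "0 \<le> t" "0 \<le> C"
    and C: "(\<integral>\<^sup>+\<omega>. ennreal (exp (t * X \<omega>)) \<partial>M) \<le> ennreal C"
  shows "emeasure M {\<omega> \<in> space M. x < X \<omega>} \<le> ennreal (exp (- (t * x)) * C)"
proof -
  have "emeasure M {\<omega> \<in> space M. x < X \<omega>} = (\<integral>\<^sup>+\<omega>. indicator {\<omega> \<in> space M. x < X \<omega>} \<omega> \<partial>M)"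
    by simp
  also have "\<dots> \<le> (\<integral>\<^sup>+\<omega>. ennreal (exp (- (t * x))) * ennreal (exp (t * X \<omega>)) \<partial>M)"
  proof (rule nn_integral_mono)
    fix \<omega>
    have "1 \<le> exp (- (t * x)) * exp (t * X \<omega>)" if "x < X \<omega>"
      using that assms(2) by (simp add: exp_add[symmetric] mult_left_mono)
    then have "x < X \<omega> \<Longrightarrow> 1 \<le> ennreal (exp (- (t * x)) * exp (t * X \<omega>))"
      by (metis ennreal_1 ennreal_leI)
    then show "indicator {\<omega> \<in> space M. x < X \<omega>} \<omega> \<le> ennreal (exp (- (t * x))) * ennreal (exp (t * X \<omega>))"
      by (auto simp: indicator_def ennreal_mult')
  qed
  also have "\<dots> = ennreal (exp (- (t * x))) * (\<integral>\<^sup>+\<omega>. ennreal (exp (t * X \<omega>)) \<partial>M)"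
    by (rule nn_integral_cmult) measurable
  also have "\<dots> \<le> ennreal (exp (- (t * x))) * ennreal C" by (intro mult_left_mono C) simp
  also have "\<dots> = ennreal (exp (- (t * x)) * C)" by (simp add: ennreal_mult')
  finally show ?thesis .
qed

lemma borel_measurable_cosh [measurable (raw)]:
  fixes f :: "'a \<Rightarrow> real"
  assumes [measurable]: "f \<in> borel_measurable M"
  shows "(\<lambda>x. cosh (f x)) \<in> borel_measurable M"
  unfolding cosh_field_def by measurable

text \<open>As exp |y| \<le> 2 cosh y, a bound on the mean of \<open>cosh\<close> controls both
  tails at once, at the price of a factor 2.\<close>

lemma emeasure_abs_tail_le_cosh:
  assumes [measurable]: "X \<in> borel_measurable M" and "0 \<le> t" "0 \<le> C"
    and C: "(\<integral>\<^sup>+\<omega>. ennreal (cosh (t * X \<omega>)) \<partial>M) \<le> ennreal C"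
  shows "emeasure M {\<omega> \<in> space M. x < \<bar>X \<omega>\<bar>} \<le> ennreal (2 * exp (- (t * x)) * C)"
proof -
  have "(\<integral>\<^sup>+\<omega>. ennreal (exp (t * \<bar>X \<omega>\<bar>)) \<partial>M) \<le> (\<integral>\<^sup>+\<omega>. 2 * ennreal (cosh (t * X \<omega>)) \<partial>M)"
  proof (rule nn_integral_mono)
    fix \<omega>
    have "exp (t * \<bar>X \<omega>\<bar>) \<le> 2 * cosh (t * X \<omega>)"
      by (cases "X \<omega> \<ge> 0") (simp_all add: cosh_field_def)
    then have "ennreal (exp (t * \<bar>X \<omega>\<bar>)) \<le> ennreal (2 * cosh (t * X \<omega>))" by (rule ennreal_leI)
    then show "ennreal (exp (t * \<bar>X \<omega>\<bar>)) \<le> 2 * ennreal (cosh (t * X \<omega>))" by (simp add: ennreal_mult')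
  qed
  also have "\<dots> = 2 * (\<integral>\<^sup>+\<omega>. ennreal (cosh (t * X \<omega>)) \<partial>M)"
    by (rule nn_integral_cmult) measurable
  also have "\<dots> \<le> 2 * ennreal C" by (intro mult_left_mono C) simp
  also have "\<dots> = ennreal (2 * C)" by (simp add: ennreal_mult')
  finally have "(\<integral>\<^sup>+\<omega>. ennreal (exp (t * \<bar>X \<omega>\<bar>)) \<partial>M) \<le> ennreal (2 * C)" .
  from emeasure_tail_le_exp[OF _ assms(2) _ this, of x] assms(3)
  have "emeasure M {\<omega> \<in> space M. x < \<bar>X \<omega>\<bar>} \<le> ennreal (exp (- (t * x)) * (2 * C))" by simp
  also have "exp (- (t * x)) * (2 * C) = 2 * exp (- (t * x)) * C" by simp
  finally show ?thesis .
qed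

lemma nn_integral_cosh_le:
  assumes [measurable]: "X \<in> borel_measurable M" and "0 \<le> C"
    and C: "(\<integral>\<^sup>+\<omega>. ennreal (exp (t * X \<omega>)) \<partial>M) \<le> ennreal C" "(\<integral>\<^sup>+\<omega>. ennreal (exp (- t * X \<omega>)) \<partial>M) \<le> ennreal C"
  shows "(\<integral>\<^sup>+\<omega>. ennreal (cosh (t * X \<omega>)) \<partial>M) \<le> ennreal C"
proof -
  have "ennreal (cosh x) = ennreal (1/2) * (ennreal (exp x) + ennreal (exp (- x)))" for x
  proof -
    have "ennreal (1/2) * (ennreal (exp x) + ennreal (exp (- x))) = ennreal (1/2 * (exp x + exp (- x)))"
      by (simp only: ennreal_mult'[symmetric] ennreal_plus[symmetric] exp_ge_zero zero_le_divide_1_iff zero_le_numeral)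
    then show ?thesis by (simp add: cosh_field_def)
  qed
  then have "(\<integral>\<^sup>+\<omega>. ennreal (cosh (t * X \<omega>)) \<partial>M) =
     (\<integral>\<^sup>+\<omega>. ennreal (1/2) * (ennreal (exp (t * X \<omega>)) + ennreal (exp (- t * X \<omega>))) \<partial>M)"
    by simp
  also have "\<dots> = ennreal (1/2) * (\<integral>\<^sup>+\<omega>. ennreal (exp (t * X \<omega>)) + ennreal (exp (- t * X \<omega>)) \<partial>M)"
    by (rule nn_integral_cmult) measurable
  also have "(\<integral>\<^sup>+\<omega>. ennreal (exp (t * X \<omega>)) + ennreal (exp (- t * X \<omega>)) \<partial>M) =
     (\<integral>\<^sup>+\<omega>. ennreal (exp (t * X \<omega>)) \<partial>M) + (\<integral>\<^sup>+\<omega>. ennreal (exp (- t * X \<omega>)) \<partial>M)"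
    by (rule nn_integral_add) measurable
  also have "ennreal (1/2) * \<dots> \<le> ennreal (1/2) * (ennreal C + ennreal C)"
    by (intro mult_left_mono add_mono C) simp
  also have "ennreal C + ennreal C = ennreal (C + C)" by (intro ennreal_plus[symmetric] assms)
  also have "ennreal (1/2) * ennreal (C + C) = ennreal C"
    by (subst ennreal_mult'[symmetric]) auto
  finally show ?thesis .
qed

lemma measurable_gaussian_exp:
  "(\<lambda>e. ennreal (exp (\<Sum>r<m. b r * e r))) \<in> borel_measurable (gaussian_iso m v)"
  by measurable

lemma measurable_sphere_threshold:
  "(\<lambda>a. ennreal (if c \<le> \<bar>(\<Sum>i<d. b i * a i) + s\<bar> then x else y)) \<in> borel_measurable (sphere_uniform d)"
  by measurable

text \<open>\<open>W i\<close> holds the entries of the orthonormal basis matrix of the subspace of the point \<open>i\<close>.\<close>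

locale noisy_subspace_data =
  fixes I :: "'i set" and d :: "'i \<Rightarrow> nat" and m :: nat and v :: real
    and W :: "'i \<Rightarrow> nat \<Rightarrow> nat \<Rightarrow> real"
  assumes finite_I: "finite I" and d_pos: "\<And>i. i \<in> I \<Longrightarrow> 1 \<le> d i" and v_nonneg: "0 \<le> v"
    and orthonormal: "\<And>i k k'. i \<in> I \<Longrightarrow> k < d i \<Longrightarrow> k' < d i \<Longrightarrow>
      (\<Sum>r<m. W i r k * W i r k') = (if k = k' then 1 else 0)"
begin

definition "A = (\<Pi>\<^sub>M i\<in>I. sphere_uniform (d i))"
definition "G = (\<Pi>\<^sub>M i\<in>I. gaussian_iso m v)"
definition "D = A \<Otimes>\<^sub>M G"

definition sig :: "('i \<Rightarrow> nat \<Rightarrow> real) \<Rightarrow> 'i \<Rightarrow> nat \<Rightarrow> real" where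
  "sig a i r = (\<Sum>k<d i. W i r k * a i k)"

definition pt :: "('i \<Rightarrow> nat \<Rightarrow> real) \<times> ('i \<Rightarrow> nat \<Rightarrow> real) \<Rightarrow> 'i \<Rightarrow> nat \<Rightarrow> real" where
  "pt \<omega> i r = sig (fst \<omega>) i r + snd \<omega> i r"

definition ip :: "('i \<Rightarrow> nat \<Rightarrow> real) \<times> ('i \<Rightarrow> nat \<Rightarrow> real) \<Rightarrow> 'i \<Rightarrow> 'i \<Rightarrow> real" where
  "ip \<omega> i j = (\<Sum>r<m. pt \<omega> i r * pt \<omega> j r)"

sublocale A: prob_space A
  unfolding A_def by (intro prob_space_PiM prob_space_sphere_uniform)

sublocale G: prob_space G
  unfolding G_def by (intro prob_space_PiM prob_space_gaussian_iso v_nonneg)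

sublocale D: pair_prob_space A G ..

lemma prob_space_D: "prob_space D"
  unfolding D_def by (rule D.prob_space_axioms)

lemma measurable_A_component [measurable]:
  assumes "i \<in> I" "k < d i"
  shows "(\<lambda>a. a i k) \<in> borel_measurable A"
proof -
  have "(\<lambda>x. x k) \<in> borel_measurable (sphere_uniform (d i))"
    using assms by (subst measurable_cong_sets[OF sets_sphere_uniform refl]) (intro measurable_component_singleton, simp)
  moreover have "(\<lambda>a. a i) \<in> A \<rightarrow>\<^sub>M sphere_uniform (d i)"
    unfolding A_def using assms by (intro measurable_component_singleton)
  ultimately show ?thesis by (rule measurable_compose[rotated])
qed

lemma measurable_G_component [measurable]:
  assumes "i \<in> I" "r < m"
  shows "(\<lambda>e. e i r) \<in> borel_measurable G"
proof -
  have "(\<lambda>x. x r) \<in> borel_measurable (gaussian_iso m v)"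
    using assms by (subst measurable_cong_sets[OF sets_gaussian_iso refl]) (intro measurable_component_singleton, simp)
  moreover have "(\<lambda>e. e i) \<in> G \<rightarrow>\<^sub>M gaussian_iso m v"
    unfolding G_def using assms by (intro measurable_component_singleton)
  ultimately show ?thesis by (rule measurable_compose[rotated])
qed

lemma measurable_fst_D [measurable]: "fst \<in> D \<rightarrow>\<^sub>M A" by (simp add: D_def)
lemma measurable_snd_D [measurable]: "snd \<in> D \<rightarrow>\<^sub>M G" by (simp add: D_def)

lemma measurable_D_component [measurable]:
  shows "i \<in> I \<Longrightarrow> k < d i \<Longrightarrow> (\<lambda>\<omega>. fst \<omega> i k) \<in> borel_measurable D"
    and "i \<in> I \<Longrightarrow> r < m \<Longrightarrow> (\<lambda>\<omega>. snd \<omega> i r) \<in> borel_measurable D"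
  by (auto intro: measurable_compose[OF measurable_fst_D] measurable_compose[OF measurable_snd_D]
       measurable_A_component measurable_G_component)

lemma measurable_sig [measurable]:
  shows "i \<in> I \<Longrightarrow> (\<lambda>a. sig a i r) \<in> borel_measurable A"
    and "i \<in> I \<Longrightarrow> (\<lambda>\<omega>. sig (fst \<omega>) i r) \<in> borel_measurable D"
  unfolding sig_def by measurable

lemma measurable_pt [measurable]: "i \<in> I \<Longrightarrow> r < m \<Longrightarrow> (\<lambda>\<omega>. pt \<omega> i r) \<in> borel_measurable D"
  unfolding pt_def by measurable

lemma measurable_ip [measurable]: "i \<in> I \<Longrightarrow> j \<in> I \<Longrightarrow> (\<lambda>\<omega>. ip \<omega> i j) \<in> borel_measurable D"
  unfolding ip_def by measurable

lemma nn_integral_D: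
  assumes "f \<in> borel_measurable D"
  shows "(\<integral>\<^sup>+\<omega>. f \<omega> \<partial>D) = (\<integral>\<^sup>+a. (\<integral>\<^sup>+e. f (a, e) \<partial>G) \<partial>A)"
    and "(\<integral>\<^sup>+\<omega>. f \<omega> \<partial>D) = (\<integral>\<^sup>+e. (\<integral>\<^sup>+a. f (a, e) \<partial>A) \<partial>G)"
  using assms D.nn_integral_snd[of f] unfolding D_def
  by (auto simp: G.nn_integral_fst)

text \<open>Orthonormal columns act as an isometry. Signals are thus almost surely unit vectors, and
  the conditional variance of their inner product with noise does not depend on them.\<close>

lemma sum_sig_squares:
  assumes "i \<in> I"
  shows "(\<Sum>r<m. (sig a i r)\<^sup>2) = (\<Sum>k<d i. (a i k)\<^sup>2)"
proof -
  have "(\<Sum>r<m. (sig a i r)\<^sup>2) = (\<Sum>r<m. \<Sum>k<d i. \<Sum>k'<d i. (a i k * a i k') * (W i r k * W i r k'))"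
    by (simp add: sig_def power2_eq_square sum_product mult_ac)
  also have "\<dots> = (\<Sum>k<d i. \<Sum>k'<d i. \<Sum>r<m. (a i k * a i k') * (W i r k * W i r k'))"
  proof -
    have "(\<Sum>r<m. \<Sum>k<d i. \<Sum>k'<d i. (a i k * a i k') * (W i r k * W i r k')) =
      (\<Sum>k<d i. \<Sum>r<m. \<Sum>k'<d i. (a i k * a i k') * (W i r k * W i r k'))"
      by (rule sum.swap)
    also have "\<dots> = (\<Sum>k<d i. \<Sum>k'<d i. \<Sum>r<m. (a i k * a i k') * (W i r k * W i r k'))"
      by (rule sum.cong[OF refl], rule sum.swap)
    finally show ?thesis .
  qed
  also have "\<dots> = (\<Sum>k<d i. \<Sum>k'<d i. (a i k * a i k') * (if k = k' then 1 else 0))"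
    by (intro sum.cong refl) (simp add: sum_distrib_left[symmetric] orthonormal[OF assms])
  also have "\<dots> = (\<Sum>k<d i. (a i k)\<^sup>2)"
    by (intro sum.cong refl) (simp add: power2_eq_square if_distrib cong: if_cong)
  finally show ?thesis .
qed

lemma AE_A_unit: "AE a in A. \<forall>i\<in>I. (\<Sum>k<d i. (a i k)\<^sup>2) = 1"
proof -
  have "AE a in A. (\<Sum>k<d i. (a i k)\<^sup>2) = 1" if "i \<in> I" for i
  proof -
    have "AE x in sphere_uniform (d i). (\<Sum>k<d i. (x k)\<^sup>2) = 1"
      using AE_sphere_uniform[OF d_pos[OF that]] by eventually_elim (simp add: L2_set_def)
    then show ?thesis unfolding A_def using that
      by (intro AE_PiM_component[where P="\<lambda>x. (\<Sum>k<d i. (x k)\<^sup>2) = 1"]) (auto intro: prob_space_sphere_uniform)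
  qed
  then show ?thesis by (subst AE_finite_all[OF finite_I]) auto
qed

lemma AE_G_zero:
  assumes "v = 0"
  shows "AE e in G. \<forall>i\<in>I. \<forall>r<m. e i r = 0"
proof -
  have "AE e in G. \<forall>r<m. e i r = 0" if "i \<in> I" for i
    unfolding G_def using that AE_gaussian_iso_0[of m] assms
    by (intro AE_PiM_component[where P="\<lambda>x. \<forall>r<m. x r = 0"]) (auto intro: prob_space_gaussian_iso)
  then show ?thesis by (subst AE_finite_all[OF finite_I]) auto
qed

lemma AE_D_fst:
  assumes "AE a in A. P a"
  shows "AE \<omega> in D. P (fst \<omega>)"
proof -
  obtain N where N: "N \<in> null_sets A" "{a \<in> space A. \<not> P a} \<subseteq> N" using assms by (auto elim: AE_E simp: null_sets_def)
  then have "emeasure D (N \<times> space G) = 0"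
    unfolding D_def by (subst G.emeasure_pair_measure_Times) (auto simp: null_sets_def)
  moreover have "N \<times> space G \<in> sets D" unfolding D_def using N by (intro pair_measureI) auto
  ultimately show ?thesis
    using N by (intro AE_I'[of "N \<times> space G"]) (auto simp: D_def space_pair_measure)
qed

lemma AE_D_snd:
  assumes "AE e in G. P e"
  shows "AE \<omega> in D. P (snd \<omega>)"
proof -
  obtain N where N: "N \<in> null_sets G" "{e \<in> space G. \<not> P e} \<subseteq> N" using assms by (auto elim: AE_E simp: null_sets_def)
  then have "emeasure D (space A \<times> N) = 0"
    unfolding D_def by (subst G.emeasure_pair_measure_Times) (auto simp: null_sets_def)
  moreover have "space A \<times> N \<in> sets D" unfolding D_def using N by (intro pair_measureI) auto
  ultimately show ?thesis
    using N by (intro AE_I'[of "space A \<times> N"]) (auto simp: D_def space_pair_measure)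
qed

lemma emeasure_D_null:
  assumes "AE \<omega> in D. \<not> P \<omega>"
  shows "emeasure D {\<omega> \<in> space D. P \<omega>} = 0"
proof (cases "{\<omega> \<in> space D. P \<omega>} \<in> sets D")
  case True
  then show ?thesis using assms by (subst AE_iff_measurable[symmetric, where P="\<lambda>\<omega>. \<not> P \<omega>"]) auto
qed (rule emeasure_notin_sets)

lemma nn_integral_A_pair:
  assumes "i \<in> I" "j \<in> I" "i \<noteq> j" "(\<lambda>(x, y). f x y) \<in> borel_measurable (sphere_uniform (d i) \<Otimes>\<^sub>M sphere_uniform (d j))"
  shows "(\<integral>\<^sup>+a. f (a i) (a j) \<partial>A) = (\<integral>\<^sup>+x. (\<integral>\<^sup>+y. f x y \<partial>sphere_uniform (d j)) \<partial>sphere_uniform (d i))"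
  unfolding A_def by (rule nn_integral_PiM_two_components[OF finite_I _ assms]) (rule prob_space_sphere_uniform)

lemma nn_integral_G_pair:
  assumes "i \<in> I" "j \<in> I" "i \<noteq> j" "(\<lambda>(x, y). f x y) \<in> borel_measurable (gaussian_iso m v \<Otimes>\<^sub>M gaussian_iso m v)"
  shows "(\<integral>\<^sup>+e. f (e i) (e j) \<partial>G) = (\<integral>\<^sup>+x. (\<integral>\<^sup>+y. f x y \<partial>gaussian_iso m v) \<partial>gaussian_iso m v)"
  unfolding G_def by (rule nn_integral_PiM_two_components[OF finite_I _ assms]) (rule prob_space_gaussian_iso[OF v_nonneg])

definition gram :: "'i \<Rightarrow> 'i \<Rightarrow> nat \<Rightarrow> nat \<Rightarrow> real" where
  "gram i j k k' = (\<Sum>r<m. W i r k * W j r k')"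

text \<open>This is the squared Frobenius norm in the numerator of the affinity, with the columns
  summed outermost as in the bound for bilinear forms.\<close>

definition frob2 :: "'i \<Rightarrow> 'i \<Rightarrow> real" where
  "frob2 i j = (\<Sum>k'<d j. \<Sum>k<d i. (gram i j k k')\<^sup>2)"

lemma sig_inner: "(\<Sum>r<m. sig a i r * sig a j r) = (\<Sum>k'<d j. (\<Sum>k<d i. gram i j k k' * a i k) * a j k')"
proof -
  have "(\<Sum>r<m. sig a i r * sig a j r) = (\<Sum>r<m. \<Sum>k<d i. \<Sum>k'<d j. W i r k * W j r k' * a i k * a j k')"
    by (simp add: sig_def sum_product mult_ac)
  also have "\<dots> = (\<Sum>k<d i. \<Sum>r<m. \<Sum>k'<d j. W i r k * W j r k' * a i k * a j k')"
    by (rule sum.swap)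
  also have "\<dots> = (\<Sum>k<d i. \<Sum>k'<d j. \<Sum>r<m. W i r k * W j r k' * a i k * a j k')"
    by (rule sum.cong[OF refl], rule sum.swap)
  also have "\<dots> = (\<Sum>k'<d j. \<Sum>k<d i. \<Sum>r<m. W i r k * W j r k' * a i k * a j k')"
    by (rule sum.swap)
  also have "\<dots> = (\<Sum>k'<d j. (\<Sum>k<d i. gram i j k k' * a i k) * a j k')"
    by (simp add: gram_def sum_distrib_right)
  finally show ?thesis .
qed

text \<open>The tail of a bilinear form is exponential, hence the deviation linear in
  \<open>l\<close>. At l = log N the probability is of order N^-3. If the Gram matrix vanishes, so
  does the form, and the strict inequality leaves the empty event.\<close>

lemma cross_signal_tail:
  assumes ij: "i \<in> I" "j \<in> I" "i \<noteq> j"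
  shows "emeasure D {\<omega> \<in> space D. 4 * l * sqrt (frob2 i j / (real (d i) * real (d j))) < \<bar>\<Sum>r<m. sig (fst \<omega>) i r * sig (fst \<omega>) j r\<bar>}
    \<le> ennreal (32 / 7 * exp (- 3 * l))"
proof (cases "frob2 i j = 0")
  case True
  then have "\<forall>k'\<in>{..<d j}. (\<Sum>k<d i. (gram i j k k')\<^sup>2) = 0"
    unfolding frob2_def by (subst (asm) sum_nonneg_eq_0_iff) (auto simp: sum_nonneg)
  then have "gram i j k k' = 0" if "k < d i" "k' < d j" for k k'
    using that sum_nonneg_eq_0_iff[OF finite_lessThan, of "d i" "\<lambda>k. (gram i j k k')\<^sup>2"] by auto
  then have "(\<Sum>r<m. sig a i r * sig a j r) = 0" for a
    unfolding sig_inner by (intro sum.neutral) simp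
  then show ?thesis by (simp add: True)
next
  case False
  moreover have "frob2 i j \<ge> 0" by (simp add: frob2_def sum_nonneg)
  ultimately have F: "frob2 i j > 0" by simp
  have dd: "1 \<le> d i" "1 \<le> d j" using ij d_pos by auto
  let ?dd = "real (d i) * real (d j)"
  have dd': "?dd > 0" using dd by simp
  \<comment> \<open>The factor 3/4 brings the critical ratio to 9/16, so the mean of
    \<open>cosh\<close> is at most 16/7 while the exponent at the threshold is 3l.\<close>
  define t where "t = 3 / (4 * sqrt (frob2 i j / ?dd))"
  have t0: "t > 0" and tsq: "t\<^sup>2 = 9/16 * ?dd / frob2 i j"
    and tx: "t * (4 * l * sqrt (frob2 i j / ?dd)) = 3 * l"
    using F dd' by (auto simp: t_def power_divide power_mult_distrib)
  have less: "t\<^sup>2 * frob2 i j / ?dd = 9/16" using F dd unfolding tsq by simp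
  let ?f = "\<lambda>x y. ennreal (cosh (t * (\<Sum>k'<d j. (\<Sum>k<d i. gram i j k k' * x k) * y k')))"
  have "(\<integral>\<^sup>+\<omega>. ennreal (cosh (t * (\<Sum>r<m. sig (fst \<omega>) i r * sig (fst \<omega>) j r))) \<partial>D) =
      (\<integral>\<^sup>+a. ?f (a i) (a j) \<partial>A)"
    using ij by (subst nn_integral_D(1)) (auto simp: sig_inner G.emeasure_space_1)
  also have "\<dots> = (\<integral>\<^sup>+x. (\<integral>\<^sup>+y. ?f x y \<partial>sphere_uniform (d j)) \<partial>sphere_uniform (d i))"
    by (rule nn_integral_A_pair[OF ij]) measurable
  also have "\<dots> \<le> ennreal (1 / (1 - 9/16))"
    using nn_integral_sphere_bilinear_cosh[OF dd, of t "gram i j", folded frob2_def] unfolding less by simp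
  finally have "(\<integral>\<^sup>+\<omega>. ennreal (cosh (t * (\<Sum>r<m. sig (fst \<omega>) i r * sig (fst \<omega>) j r))) \<partial>D) \<le> ennreal (16/7)"
    by simp
  from emeasure_abs_tail_le_cosh[OF _ _ _ this, of "4 * l * sqrt (frob2 i j / ?dd)"] t0 ij
  show ?thesis by (simp add: tx)
qed

text \<open>Given the signals, which are unit vectors, the two summands are independent normal
  variables of variance \<open>v\<close>. A vanishing \<open>v\<close> is split off because the tilt
  divides by it.\<close>

lemma cross_noise_tail:
  assumes ij: "i \<in> I" "j \<in> I" "i \<noteq> j" and l: "0 \<le> l"
  shows "emeasure D {\<omega> \<in> space D. 4 * sqrt (l * v) <
      \<bar>\<Sum>r<m. sig (fst \<omega>) j r * snd \<omega> i r + sig (fst \<omega>) i r * snd \<omega> j r\<bar>} \<le> ennreal (2 * exp (- 4 * l))"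
proof (cases "v = 0")
  case True
  have "AE \<omega> in D. \<forall>i\<in>I. \<forall>r<m. snd \<omega> i r = 0" by (rule AE_D_snd[OF AE_G_zero[OF True]])
  then have "AE \<omega> in D. \<not> (4 * sqrt (l * v) < \<bar>\<Sum>r<m. sig (fst \<omega>) j r * snd \<omega> i r + sig (fst \<omega>) i r * snd \<omega> j r\<bar>)"
    by eventually_elim (use ij True in simp)
  then show ?thesis by (simp only: emeasure_D_null) simp
next
  case False
  then have v: "v > 0" using v_nonneg by simp
  \<comment> \<open>This is the minimizer of t^2 v - 4 t sqrt(l v), the exponent of the Chernoff
    bound.\<close>
  define t where "t = 2 * sqrt (l / v)"
  have t: "t \<ge> 0" "t\<^sup>2 * v = 4 * l" using v l by (auto simp: t_def power_mult_distrib)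
  have tx: "t * (4 * sqrt (l * v)) = 8 * l"
    using v l by (simp add: t_def real_sqrt_divide real_sqrt_mult)
  let ?X = "\<lambda>\<omega>. \<Sum>r<m. sig (fst \<omega>) j r * snd \<omega> i r + sig (fst \<omega>) i r * snd \<omega> j r"
  have mgf: "(\<integral>\<^sup>+\<omega>. ennreal (exp (s * ?X \<omega>)) \<partial>D) = ennreal (exp (4 * l))" if s: "s\<^sup>2 * v = 4 * l" for s
  proof -
    have "(\<integral>\<^sup>+\<omega>. ennreal (exp (s * ?X \<omega>)) \<partial>D) = (\<integral>\<^sup>+a. (\<integral>\<^sup>+e. ennreal (exp (s * ?X (a, e))) \<partial>G) \<partial>A)"
      using ij by (intro nn_integral_D(1)) measurable
    also have "\<dots> = (\<integral>\<^sup>+a. ennreal (exp (4 * l)) \<partial>A)"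
    proof (rule nn_integral_cong_AE, use AE_A_unit in eventually_elim)
      fix a :: "'i \<Rightarrow> nat \<Rightarrow> real" assume a: "\<forall>i\<in>I. (\<Sum>k<d i. (a i k)\<^sup>2) = 1"
      have unit: "(\<Sum>r<m. (s * sig a p r)\<^sup>2) = s\<^sup>2" if "p \<in> I" for p
        using a sum_sig_squares[OF that, of a] that by (simp add: power_mult_distrib sum_distrib_left[symmetric])
      let ?f = "\<lambda>x y. ennreal (exp (\<Sum>r<m. (s * sig a j r) * x r)) * ennreal (exp (\<Sum>r<m. (s * sig a i r) * y r))"
      have "s * ?X (a, e) = (\<Sum>r<m. (s * sig a j r) * e i r) + (\<Sum>r<m. (s * sig a i r) * e j r)" for e
        by (simp add: sum.distrib sum_distrib_left algebra_simps)
      then have "(\<integral>\<^sup>+e. ennreal (exp (s * ?X (a, e))) \<partial>G) = (\<integral>\<^sup>+e. ?f (e i) (e j) \<partial>G)"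
        by (simp only: exp_add ennreal_mult'[OF exp_ge_zero])
      also have "\<dots> = (\<integral>\<^sup>+x. (\<integral>\<^sup>+y. ?f x y \<partial>gaussian_iso m v) \<partial>gaussian_iso m v)"
        by (rule nn_integral_G_pair[OF ij]) measurable
      also have "\<dots> = (\<integral>\<^sup>+x. ennreal (exp (\<Sum>r<m. (s * sig a j r) * x r)) * ennreal (exp (v * s\<^sup>2 / 2)) \<partial>gaussian_iso m v)"
        using ij by (subst nn_integral_cmult)
          (simp_all only: nn_integral_gaussian_exp[OF v_nonneg] unit measurable_gaussian_exp)
      also have "\<dots> = ennreal (exp (v * s\<^sup>2 / 2)) * ennreal (exp (v * s\<^sup>2 / 2))"
        using ij by (subst nn_integral_multc)
          (simp_all only: nn_integral_gaussian_exp[OF v_nonneg] unit measurable_gaussian_exp)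
      also have "\<dots> = ennreal (exp (4 * l))"
        using s by (simp add: ennreal_mult'[symmetric] exp_add[symmetric] mult.commute)
      finally show "(\<integral>\<^sup>+e. ennreal (exp (s * ?X (a, e))) \<partial>G) = ennreal (exp (4 * l))" .
    qed
    also have "\<dots> = ennreal (exp (4 * l))" by (simp add: A.emeasure_space_1)
    finally show ?thesis .
  qed
  have "(\<integral>\<^sup>+\<omega>. ennreal (cosh (t * ?X \<omega>)) \<partial>D) \<le> ennreal (exp (4 * l))"
  proof -
    have X: "?X \<in> borel_measurable D" using ij by measurable
    have t': "(- t)\<^sup>2 * v = 4 * l" using t(2) by simp
    show ?thesis
      by (rule nn_integral_cosh_le[OF X _ eq_refl[OF mgf[OF t(2)]] eq_refl[OF mgf[OF t']]]) simp
  qed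
  from emeasure_abs_tail_le_cosh[OF _ t(1) _ this, of "4 * sqrt (l * v)"] ij
  have "emeasure D {\<omega> \<in> space D. 4 * sqrt (l * v) < \<bar>?X \<omega>\<bar>} \<le> ennreal (2 * exp (- (8 * l)) * exp (4 * l))"
    by (simp add: tx)
  also have "2 * exp (- (8 * l)) * exp (4 * l) = 2 * exp (- 4 * l)"
    by (simp add: mult.assoc exp_add[symmetric])
  finally show ?thesis .
qed

text \<open>Only one tail matters: noise is harmful when it shortens the component of a point along
  its own signal. There are N such events, so N^-2 suffices for each.\<close>

lemma own_noise_tail:
  assumes i: "i \<in> I" and l: "0 \<le> l"
  shows "emeasure D {\<omega> \<in> space D. 2 * sqrt (l * v) < - (\<Sum>r<m. sig (fst \<omega>) i r * snd \<omega> i r)} \<le> ennreal (exp (- 2 * l))"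
proof (cases "v = 0")
  case True
  have "AE \<omega> in D. \<forall>i\<in>I. \<forall>r<m. snd \<omega> i r = 0" by (rule AE_D_snd[OF AE_G_zero[OF True]])
  then have "AE \<omega> in D. \<not> (2 * sqrt (l * v) < - (\<Sum>r<m. sig (fst \<omega>) i r * snd \<omega> i r))"
    by eventually_elim (use i True in simp)
  then show ?thesis by (simp only: emeasure_D_null) simp
next
  case False
  then have v: "v > 0" using v_nonneg by simp
  define t where "t = 2 * sqrt (l / v)"
  have t: "t \<ge> 0" "t\<^sup>2 * v = 4 * l" using v l by (auto simp: t_def power_mult_distrib)
  have tx: "t * (2 * sqrt (l * v)) = 4 * l"
    using v l by (simp add: t_def real_sqrt_divide real_sqrt_mult)
  let ?X = "\<lambda>\<omega>. - (\<Sum>r<m. sig (fst \<omega>) i r * snd \<omega> i r)"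
  have "(\<integral>\<^sup>+\<omega>. ennreal (exp (t * ?X \<omega>)) \<partial>D) = (\<integral>\<^sup>+a. (\<integral>\<^sup>+e. ennreal (exp (t * ?X (a, e))) \<partial>G) \<partial>A)"
    using i by (intro nn_integral_D(1)) measurable
  also have "\<dots> = (\<integral>\<^sup>+a. ennreal (exp (2 * l)) \<partial>A)"
  proof (rule nn_integral_cong_AE, use AE_A_unit in eventually_elim)
    fix a :: "'i \<Rightarrow> nat \<Rightarrow> real" assume a: "\<forall>i\<in>I. (\<Sum>k<d i. (a i k)\<^sup>2) = 1"
    have unit: "(\<Sum>r<m. (- t * sig a i r)\<^sup>2) = t\<^sup>2"
      using a sum_sig_squares[OF i, of a] i by (simp add: power_mult_distrib sum_distrib_left[symmetric])
    have "t * ?X (a, e) = (\<Sum>r<m. (- t * sig a i r) * e i r)" for e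
      by (simp add: sum_distrib_left sum_negf mult.assoc)
    then have "(\<integral>\<^sup>+e. ennreal (exp (t * ?X (a, e))) \<partial>G) = (\<integral>\<^sup>+e. ennreal (exp (\<Sum>r<m. (- t * sig a i r) * e i r)) \<partial>G)"
      by simp
    also have "\<dots> = (\<integral>\<^sup>+x. ennreal (exp (\<Sum>r<m. (- t * sig a i r) * x r)) \<partial>gaussian_iso m v)"
      unfolding G_def using i by (intro nn_integral_PiM_component prob_space_gaussian_iso v_nonneg measurable_gaussian_exp)
    also have "\<dots> = ennreal (exp (2 * l))"
      unfolding nn_integral_gaussian_exp[OF v_nonneg] unit using t(2) by (simp add: mult.commute)
    finally show "(\<integral>\<^sup>+e. ennreal (exp (t * ?X (a, e))) \<partial>G) = ennreal (exp (2 * l))" .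
  qed
  also have "\<dots> = ennreal (exp (2 * l))" by (simp add: A.emeasure_space_1)
  finally have "(\<integral>\<^sup>+\<omega>. ennreal (exp (t * ?X \<omega>)) \<partial>D) \<le> ennreal (exp (2 * l))" by simp
  from emeasure_tail_le_exp[OF _ t(1) _ this, of "2 * sqrt (l * v)"] i
  have "emeasure D {\<omega> \<in> space D. 2 * sqrt (l * v) < ?X \<omega>} \<le> ennreal (exp (- (4 * l)) * exp (2 * l))"
    by (simp add: tx)
  also have "exp (- (4 * l)) * exp (2 * l) = exp (- 2 * l)"
    by (simp add: exp_add[symmetric])
  finally show ?thesis .
qed

text \<open>Each coordinate contributes 1/sqrt(1 - x) with x = l/m. Since \<open>m\<close> is at
  least 6l, \<open>x\<close> stays below 1/2, all coordinates together cost at most exp(l), and 3l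
  of the 4l in the exponent remain.\<close>

lemma noise_noise_tail:
  assumes ij: "i \<in> I" "j \<in> I" "i \<noteq> j" and l: "0 \<le> l" "6 * l \<le> real m" and m: "0 < m"
  shows "emeasure D {\<omega> \<in> space D. 4 * sqrt l * v * sqrt m < \<bar>\<Sum>r<m. snd \<omega> i r * snd \<omega> j r\<bar>}
    \<le> ennreal (2 * exp (- 3 * l))"
proof (cases "v = 0")
  case True
  have "AE \<omega> in D. \<forall>i\<in>I. \<forall>r<m. snd \<omega> i r = 0" by (rule AE_D_snd[OF AE_G_zero[OF True]])
  then have "AE \<omega> in D. \<not> (4 * sqrt l * v * sqrt m < \<bar>\<Sum>r<m. snd \<omega> i r * snd \<omega> j r\<bar>)"
    by eventually_elim (use ij True in simp)
  then show ?thesis by (simp only: emeasure_D_null) simp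
next
  case False
  then have v: "v > 0" using v_nonneg by simp
  define t where "t = sqrt l / (v * sqrt m)"
  define x where "x = l / m"
  have x: "0 \<le> x" "x \<le> 1/2" using l m by (auto simp: x_def field_simps)
  have t: "t \<ge> 0" "(t * v)\<^sup>2 = x" using v l m by (auto simp: t_def x_def power_divide power_mult_distrib)
  have tx: "t * (4 * sqrt l * v * sqrt m) = 4 * l" using v l m by (simp add: t_def)
  let ?X = "\<lambda>\<omega>. \<Sum>r<m. snd \<omega> i r * snd \<omega> j r"
  have "1 / sqrt (1 - x) \<le> exp x"
  proof -
    \<comment> \<open>The difference of the two sides is x(1 - 2x), nonnegative for x between 0 and
      1/2.\<close>
    have "1 \<le> (1 - x) * (1 + 2 * x)"
    proof -
      have "0 \<le> x * (1 - 2 * x)" using x by (intro mult_nonneg_nonneg) auto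
      then show ?thesis by (simp add: algebra_simps)
    qed
    also have "\<dots> \<le> (1 - x) * exp (2 * x)"
      using x exp_ge_add_one_self[of "2 * x"] by (intro mult_left_mono) auto
    finally have "sqrt 1 \<le> sqrt ((1 - x) * exp (2 * x))" by (rule real_sqrt_le_mono)
    also have "exp (2 * x) = (exp x)\<^sup>2" by (simp add: power2_eq_square exp_add[symmetric])
    finally have "1 \<le> sqrt (1 - x) * exp x" by (simp add: real_sqrt_mult)
    then show ?thesis using x by (simp add: pos_divide_le_eq mult.commute)
  qed
  then have "(1 / sqrt (1 - x)) ^ m \<le> exp x ^ m" using x by (intro power_mono) auto
  also have "\<dots> = exp l" using m by (simp add: exp_of_nat_mult[symmetric] x_def)
  finally have pow: "(1 / sqrt (1 - x)) ^ m \<le> exp l" .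
  have mgf: "(\<integral>\<^sup>+\<omega>. ennreal (exp (s * ?X \<omega>)) \<partial>D) \<le> ennreal (exp l)" if s: "(s * v)\<^sup>2 = x" for s
  proof -
    let ?f = "\<lambda>x y. ennreal (exp (s * (\<Sum>r<m. x r * y r)))"
    have "(\<integral>\<^sup>+\<omega>. ennreal (exp (s * ?X \<omega>)) \<partial>D) = (\<integral>\<^sup>+a. (\<integral>\<^sup>+e. ?f (e i) (e j) \<partial>G) \<partial>A)"
      using ij by (subst nn_integral_D(1)) auto
    also have "\<dots> = (\<integral>\<^sup>+e. ?f (e i) (e j) \<partial>G)" by (simp add: A.emeasure_space_1)
    also have "\<dots> = (\<integral>\<^sup>+x. (\<integral>\<^sup>+y. ?f x y \<partial>gaussian_iso m v) \<partial>gaussian_iso m v)"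
      by (rule nn_integral_G_pair[OF ij]) measurable
    also have "\<dots> = ennreal ((1 / sqrt (1 - x)) ^ m)"
      using x s by (subst nn_integral_gaussian_bilinear_exp[OF v_nonneg]) auto
    also have "\<dots> \<le> ennreal (exp l)" by (rule ennreal_leI[OF pow])
    finally show ?thesis .
  qed
  have "(\<integral>\<^sup>+\<omega>. ennreal (cosh (t * ?X \<omega>)) \<partial>D) \<le> ennreal (exp l)"
    using ij t(2) by (intro nn_integral_cosh_le mgf) auto
  from emeasure_abs_tail_le_cosh[OF _ t(1) _ this, of "4 * sqrt l * v * sqrt m"] ij
  have "emeasure D {\<omega> \<in> space D. 4 * sqrt l * v * sqrt m < \<bar>?X \<omega>\<bar>} \<le> ennreal (2 * exp (- (4 * l)) * exp l)"
    by (simp only: tx) simp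
  also have "2 * exp (- (4 * l)) * exp l = 2 * exp (- 3 * l)"
    by (simp add: mult.assoc exp_add[symmetric])
  finally show ?thesis .
qed

section \<open>Many large inner products within a cluster\<close>

definition coeff :: "('i \<Rightarrow> nat \<Rightarrow> real) \<times> ('i \<Rightarrow> nat \<Rightarrow> real) \<Rightarrow> 'i \<Rightarrow> 'i \<Rightarrow> nat \<Rightarrow> real" where
  "coeff \<omega> i j k = (\<Sum>r<m. W j r k * pt \<omega> i r)"

text \<open>Half of the root mean square, over the sphere variable of \<open>j\<close>, of the first sum in \<open>ip_eq_coeff\<close> below.\<close>

definition level :: "('i \<Rightarrow> nat \<Rightarrow> real) \<times> ('i \<Rightarrow> nat \<Rightarrow> real) \<Rightarrow> 'i \<Rightarrow> 'i \<Rightarrow> real" where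
  "level \<omega> i j = L2_set (coeff \<omega> i j) {..<d j} / (2 * sqrt (d j))"

lemma measurable_level [measurable]: "i \<in> I \<Longrightarrow> (\<lambda>\<omega>. level \<omega> i j) \<in> borel_measurable D"
  unfolding level_def coeff_def L2_set_def by measurable

text \<open>For \<open>j\<close> different from \<open>i\<close>, neither the coefficients nor the
  second sum involves the sphere variable of \<open>j\<close>; so this is a linear form in that
  variable plus a constant shift, as the small ball bound requires.\<close>

lemma ip_eq_coeff:
  "ip \<omega> i j = (\<Sum>k<d j. coeff \<omega> i j k * fst \<omega> j k) + (\<Sum>r<m. pt \<omega> i r * snd \<omega> j r)"
proof -
  have "(\<Sum>r<m. pt \<omega> i r * sig (fst \<omega>) j r) = (\<Sum>r<m. \<Sum>k<d j. W j r k * pt \<omega> i r * fst \<omega> j k)"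
    by (simp add: sig_def sum_distrib_left mult_ac)
  also have "\<dots> = (\<Sum>k<d j. \<Sum>r<m. W j r k * pt \<omega> i r * fst \<omega> j k)"
    by (rule sum.swap)
  also have "\<dots> = (\<Sum>k<d j. coeff \<omega> i j k * fst \<omega> j k)"
    by (simp add: coeff_def sum_distrib_right)
  finally show ?thesis by (simp add: ip_def pt_def[of \<omega> j] distrib_left sum.distrib)
qed

text \<open>Markov's inequality for exp(-count/10), which is a product over \<open>C\<close>. Once
  all noise and the sphere variable of \<open>i\<close> are fixed, its factors are independent, each
  with mean at most exp(-1/55), whatever the fixed values are.\<close>

lemma few_neighbours_tail:
  assumes i: "i \<in> I" and C: "C \<subseteq> I - {i}"
  shows "emeasure D {\<omega> \<in> space D. card {j \<in> C. level \<omega> i j \<le> \<bar>ip \<omega> i j\<bar>} < q}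
    \<le> ennreal (exp (q / 10 - card C / 55))"
proof -
  have finC: "finite C" using C finite_I by (auto intro: finite_subset)
  have CI: "j \<in> I" "j \<noteq> i" if "j \<in> C" for j using C that by auto
  let ?S = "\<lambda>\<omega>. {j \<in> C. level \<omega> i j \<le> \<bar>ip \<omega> i j\<bar>}"
  define g where "g j \<omega> = (if level \<omega> i j \<le> \<bar>ip \<omega> i j\<bar> then exp (- 1/10) else 1 :: real)" for j \<omega>
  have [measurable]: "g j \<in> borel_measurable D" if "j \<in> C" for j
    unfolding g_def using CI[OF that] i by measurable
  have g0: "0 \<le> g j \<omega>" for j \<omega> by (simp add: g_def)
  have prod_g: "(\<Prod>j\<in>C. g j \<omega>) = exp (- real (card (?S \<omega>)) / 10)" for \<omega>
  proof -
    have "(\<Prod>j\<in>C. g j \<omega>) = (\<Prod>j\<in>?S \<omega>. exp (- 1/10))"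
      unfolding g_def by (rule prod.inter_filter[OF finC, symmetric])
    then show ?thesis by (simp add: exp_of_nat_mult[symmetric])
  qed
  have main: "(\<integral>\<^sup>+\<omega>. (\<Prod>j\<in>C. ennreal (g j \<omega>)) \<partial>D) \<le> ennreal (exp (- real (card C) / 55))"
  proof -
    have "(\<integral>\<^sup>+\<omega>. (\<Prod>j\<in>C. ennreal (g j \<omega>)) \<partial>D) = (\<integral>\<^sup>+e. (\<integral>\<^sup>+a. (\<Prod>j\<in>C. ennreal (g j (a, e))) \<partial>A) \<partial>G)"
      by (rule nn_integral_D(2)) measurable
    also have "\<dots> \<le> (\<integral>\<^sup>+e. ennreal (exp (- real (card C) / 55)) \<partial>G)"
    proof (rule nn_integral_mono)
      fix e assume e: "e \<in> space G"
      let ?M = "\<lambda>i. sphere_uniform (d i)"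
      interpret product_sigma_finite ?M
        by (rule product_sigma_finite.intro) (rule prob_space_imp_sigma_finite[OF prob_space_sphere_uniform])
      \<comment> \<open>Splitting off \<open>i\<close> puts the integral over its sphere variable
        outermost and leaves an inner product measure on \<open>I - {i}\<close>.\<close>
      have I: "I = insert i (I - {i})" using i by auto
      \<comment> \<open>This is \<open>g\<close> with its dependence on the two sphere variables
        made explicit. The value 1 outside \<open>C\<close> extends the product to all of
        \<open>I - {i}\<close>, where it can be integrated factor by factor.\<close>
      define h where "h x j y = (if j \<in> C then
         if L2_set (\<lambda>k. \<Sum>r<m. W j r k * ((\<Sum>k<d i. W i r k * x k) + e i r)) {..<d j} / (2 * sqrt (d j))
            \<le> \<bar>(\<Sum>k<d j. (\<Sum>r<m. W j r k * ((\<Sum>k<d i. W i r k * x k) + e i r)) * y k) +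
               (\<Sum>r<m. ((\<Sum>k<d i. W i r k * x k) + e i r) * e j r)\<bar>
         then exp (- 1/10) else 1 else 1 :: real)" for x j and y :: "nat \<Rightarrow> real"
      have gh: "g j (a, e) = h (a i) j (a j)" if "j \<in> C" for a j
        using that by (simp add: g_def h_def ip_eq_coeff level_def coeff_def[abs_def] pt_def sig_def)
      have "(\<lambda>a. \<Prod>j\<in>C. ennreal (g j (a, e))) \<in> borel_measurable A"
      proof (rule borel_measurable_prod_ennreal)
        fix j assume "j \<in> C"
        then have "g j \<in> borel_measurable D" by measurable
        then have "g j \<in> borel_measurable (A \<Otimes>\<^sub>M G)" by (simp only: D_def)
        then have "(\<lambda>a. g j (a, e)) \<in> borel_measurable A" using e by measurable
        then show "(\<lambda>a. ennreal (g j (a, e))) \<in> borel_measurable A" by measurable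
      qed
      then have meas: "(\<lambda>a. \<Prod>j\<in>C. ennreal (g j (a, e))) \<in> borel_measurable (PiM (insert i (I - {i})) ?M)"
        using I by (simp add: A_def)
      have "(\<integral>\<^sup>+a. (\<Prod>j\<in>C. ennreal (g j (a, e))) \<partial>PiM (insert i (I - {i})) ?M) =
        (\<integral>\<^sup>+x. (\<integral>\<^sup>+a. (\<Prod>j\<in>C. ennreal (g j (fun_upd a i x, e))) \<partial>PiM (I - {i}) ?M) \<partial>?M i)"
        by (rule product_nn_integral_insert_rev[OF _ _ meas]) (use finite_I in simp_all)
      also have "\<dots> \<le> (\<integral>\<^sup>+x. ennreal (exp (- real (card C) / 55)) \<partial>?M i)"
      proof (rule nn_integral_mono)
        fix x :: "nat \<Rightarrow> real"
        have "(\<integral>\<^sup>+a. (\<Prod>j\<in>C. ennreal (g j (fun_upd a i x, e))) \<partial>PiM (I - {i}) ?M) =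
          (\<integral>\<^sup>+a. (\<Prod>j\<in>I - {i}. ennreal (h x j (a j))) \<partial>PiM (I - {i}) ?M)"
        proof (rule nn_integral_cong)
          fix a
          have "(\<Prod>j\<in>C. ennreal (g j (fun_upd a i x, e))) = (\<Prod>j\<in>C. ennreal (h x j (a j)))"
            by (intro prod.cong refl) (simp add: gh CI)
          also have "\<dots> = (\<Prod>j\<in>I - {i}. ennreal (h x j (a j)))"
            using C finite_I by (intro prod.mono_neutral_left) (auto simp: h_def)
          finally show "(\<Prod>j\<in>C. ennreal (g j (fun_upd a i x, e))) = (\<Prod>j\<in>I - {i}. ennreal (h x j (a j)))" .
        qed
        also have "\<dots> = (\<Prod>j\<in>I - {i}. \<integral>\<^sup>+y. ennreal (h x j y) \<partial>?M j)"
        proof (rule product_nn_integral_prod)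
          show "(\<lambda>y. ennreal (h x j y)) \<in> borel_measurable (?M j)" for j
          proof (cases "j \<in> C")
            case True
            then show ?thesis by (simp only: h_def if_True measurable_sphere_threshold)
          qed (simp add: h_def)
        qed (use finite_I in simp)
        also have "\<dots> = (\<Prod>j\<in>C. \<integral>\<^sup>+y. ennreal (h x j y) \<partial>?M j)"
          using C finite_I
          by (intro prod.mono_neutral_right) (auto simp: h_def prob_space.emeasure_space_1[OF prob_space_sphere_uniform])
        also have "\<dots> \<le> (\<Prod>j\<in>C. ennreal (exp (- 1/55)))"
        proof (rule prod_mono_ennreal)
          fix j assume j: "j \<in> C"
          then show "(\<integral>\<^sup>+y. ennreal (h x j y) \<partial>?M j) \<le> ennreal (exp (- 1/55))"
            unfolding h_def using nn_integral_sphere_small_ball[OF d_pos] CI by simp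
        qed
        also have "\<dots> = ennreal (exp (- real (card C) / 55))"
          by (simp add: ennreal_power exp_of_nat_mult[symmetric])
        finally show "(\<integral>\<^sup>+a. (\<Prod>j\<in>C. ennreal (g j (fun_upd a i x, e))) \<partial>PiM (I - {i}) ?M)
           \<le> ennreal (exp (- real (card C) / 55))" .
      qed
      also have "\<dots> = ennreal (exp (- real (card C) / 55))"
        by (simp add: prob_space.emeasure_space_1[OF prob_space_sphere_uniform])
      finally show "(\<integral>\<^sup>+a. (\<Prod>j\<in>C. ennreal (g j (a, e))) \<partial>A) \<le> ennreal (exp (- real (card C) / 55))"
        unfolding A_def using I by simp
    qed
    also have "\<dots> = ennreal (exp (- real (card C) / 55))" by (simp add: G.emeasure_space_1)
    finally show ?thesis .
  qed
  have "emeasure D {\<omega> \<in> space D. card (?S \<omega>) < q} \<le> (\<integral>\<^sup>+\<omega>. ennreal (exp (q / 10)) * (\<Prod>j\<in>C. ennreal (g j \<omega>)) \<partial>D)"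
  proof (cases "{\<omega> \<in> space D. card (?S \<omega>) < q} \<in> sets D")
    case True
    then have "emeasure D {\<omega> \<in> space D. card (?S \<omega>) < q} = (\<integral>\<^sup>+\<omega>. indicator {\<omega> \<in> space D. card (?S \<omega>) < q} \<omega> \<partial>D)"
      by simp
    also have "\<dots> \<le> (\<integral>\<^sup>+\<omega>. ennreal (exp (q / 10)) * (\<Prod>j\<in>C. ennreal (g j \<omega>)) \<partial>D)"
    proof (rule nn_integral_mono)
      fix \<omega>
      have eq: "ennreal (exp (q / 10)) * (\<Prod>j\<in>C. ennreal (g j \<omega>)) = ennreal (exp (q / 10 - real (card (?S \<omega>)) / 10))"
        using g0 by (simp add: prod_ennreal prod_g ennreal_mult'[symmetric] exp_add[symmetric])
      have "1 \<le> ennreal (exp (q / 10 - real (card (?S \<omega>)) / 10))" if "card (?S \<omega>) < q"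
      proof -
        have "1 \<le> exp (q / 10 - real (card (?S \<omega>)) / 10)" using that by simp
        then show ?thesis by (metis ennreal_1 ennreal_leI)
      qed
      then show "indicator {\<omega> \<in> space D. card (?S \<omega>) < q} \<omega> \<le> ennreal (exp (q / 10)) * (\<Prod>j\<in>C. ennreal (g j \<omega>))"
        unfolding eq by (auto simp: indicator_def)
    qed
    finally show ?thesis .
  qed (simp add: emeasure_notin_sets)
  also have "\<dots> = ennreal (exp (q / 10)) * (\<integral>\<^sup>+\<omega>. (\<Prod>j\<in>C. ennreal (g j \<omega>)) \<partial>D)"
    by (rule nn_integral_cmult) measurable
  also have "\<dots> \<le> ennreal (exp (q / 10)) * ennreal (exp (- real (card C) / 55))"
    by (intro mult_left_mono main) simp
  also have "\<dots> = ennreal (exp (q / 10 - card C / 55))"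
    by (simp add: ennreal_mult'[symmetric] exp_add[symmetric])
  finally show ?thesis .
qed

end

section \<open>Success of the algorithm\<close>

lemma measurable_card_filter:
  assumes "finite C" "\<And>j. j \<in> C \<Longrightarrow> Measurable.pred M (\<lambda>\<omega>. P \<omega> j)"
  shows "(\<lambda>\<omega>. real (card {j \<in> C. P \<omega> j})) \<in> borel_measurable M"
proof -
  have "real (card {j \<in> C. P \<omega> j}) = (\<Sum>j\<in>C. if P \<omega> j then 1 else 0)" for \<omega>
    using assms(1) by (simp add: sum.If_cases Int_def)
  moreover have "(\<lambda>\<omega>. \<Sum>j\<in>C. if P \<omega> j then 1 else 0 :: real) \<in> borel_measurable M"
  proof (rule borel_measurable_sum)
    fix j assume "j \<in> C"
    from assms(2)[OF this] show "(\<lambda>\<omega>. if P \<omega> j then 1 else 0 :: real) \<in> borel_measurable M"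
      by measurable
  qed
  ultimately show ?thesis by simp
qed

text \<open>With at least \<open>q\<close> points of the own cluster above \<open>\<tau> i\<close>,
  none of the \<open>q\<close> largest inner products can lie below it, however ties are broken;
  points of other clusters are all below. Positivity of the threshold makes the selected entries
  nonzero.\<close>

lemma subspace_detection_if_separated:
  assumes "finite I"
    and cross: "\<And>i j. i \<in> I \<Longrightarrow> j \<in> I \<Longrightarrow> lab j \<noteq> lab i \<Longrightarrow> \<bar>x i \<bullet> x j\<bar> < \<tau> i"
    and pos: "\<And>i. i \<in> I \<Longrightarrow> 0 < \<tau> i"
    and many: "\<And>i. i \<in> I \<Longrightarrow> q \<le> card {j \<in> I - {i}. lab j = lab i \<and> \<tau> i \<le> \<bar>x i \<bullet> x j\<bar>}"
    and T: "tsc_neighbours I x q T"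
  shows "subspace_detection I lab q (tsc_adjacency x T)"
proof -
  have TI: "T i \<subseteq> I - {i}" "card (T i) = q" if "i \<in> I" for i
    using T that by (auto simp: tsc_neighbours_def)
  have large: "\<tau> i \<le> \<bar>x i \<bullet> x j\<bar>" if i: "i \<in> I" and j: "j \<in> T i" for i j
  proof (rule ccontr)
    assume small: "\<not> \<tau> i \<le> \<bar>x i \<bullet> x j\<bar>"
    let ?K = "{j \<in> I - {i}. lab j = lab i \<and> \<tau> i \<le> \<bar>x i \<bullet> x j\<bar>}"
    have fin: "finite (T i)" using TI[OF i] assms(1) by (auto intro: finite_subset)
    \<comment> \<open>The set \<open>T i\<close> has \<open>q\<close> elements and one of them,
      \<open>j\<close>, lies outside \<open>?K\<close>; an inclusion would leave \<open>?K\<close>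
      with fewer than \<open>q\<close>.\<close>
    have "\<not> ?K \<subseteq> T i"
    proof
      assume "?K \<subseteq> T i"
      with small j have "?K \<subset> T i" by auto
      from psubset_card_mono[OF fin this] many[OF i] TI(2)[OF i] show False by simp
    qed
    then obtain p where p: "p \<in> ?K" "p \<notin> T i" by auto
    then have "\<bar>x i \<bullet> x p\<bar> \<le> \<bar>x i \<bullet> x j\<bar>"
      using T i j by (auto simp: tsc_neighbours_def)
    with p small show False by auto
  qed
  have same: "lab j = lab i" if "i \<in> I" "j \<in> T i" for i j
    using cross[of i j] large[OF that] that TI(1)[OF that(1)] by force
  have nonzero: "tsc_adjacency x T i j \<noteq> 0" if "i \<in> I" "j \<in> T i" for i j
  proof -
    have "0 < \<bar>x i \<bullet> x j\<bar>" using large[OF that] pos[OF that(1)] by linarith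
    moreover have "\<bar>x i \<bullet> x j\<bar> \<le> tsc_adjacency x T i j"
      using that(2) by (simp add: tsc_adjacency_def tsc_coeff_def)
    ultimately show ?thesis by linarith
  qed
  show ?thesis
    unfolding subspace_detection_def
  proof (intro conjI ballI impI)
    fix i j assume "i \<in> I" "j \<in> I" "tsc_adjacency x T i j \<noteq> 0"
    then have "j \<in> T i \<or> i \<in> T j"
      by (auto simp: tsc_adjacency_def tsc_coeff_def split: if_splits)
    with same \<open>i \<in> I\<close> \<open>j \<in> I\<close> show "lab i = lab j" by metis
  next
    fix i assume i: "i \<in> I"
    \<comment> \<open>The selected neighbours themselves are the \<open>q\<close> required
      connections.\<close>
    have "T i \<subseteq> {j \<in> I. lab j = lab i \<and> tsc_adjacency x T i j \<noteq> 0}"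
      using same[OF i] nonzero[OF i] TI(1)[OF i] by auto
    then have "card (T i) \<le> card {j \<in> I. lab j = lab i \<and> tsc_adjacency x T i j \<noteq> 0}"
      using assms(1) by (intro card_mono) auto
    then show "q \<le> card {j \<in> I. lab j = lab i \<and> tsc_adjacency x T i j \<noteq> 0}"
      using TI(2)[OF i] by simp
  qed
qed

text \<open>Ties may be broken in any way, even depending on the sample, so the event has to cover
  all choices at once.\<close>

definition tsc_succeeds :: "'i set \<Rightarrow> ('i \<Rightarrow> 'l) \<Rightarrow> nat \<Rightarrow> ('i \<Rightarrow> real vec) \<Rightarrow> bool" where
  "tsc_succeeds I lab q x \<longleftrightarrow> (\<forall>T. tsc_neighbours I x q T \<longrightarrow> subspace_detection I lab q (tsc_adjacency x T))"

text \<open>Only the values of a neighbour choice on \<open>I\<close> matter, so that finitely many choices suffice.\<close>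

lemma tsc_succeeds_finite:
  "tsc_succeeds I lab q x \<longleftrightarrow>
     (\<forall>T\<in>I \<rightarrow>\<^sub>E Pow I. tsc_neighbours I x q T \<longrightarrow> subspace_detection I lab q (tsc_adjacency x T))"
proof
  assume fin: "\<forall>T\<in>I \<rightarrow>\<^sub>E Pow I. tsc_neighbours I x q T \<longrightarrow> subspace_detection I lab q (tsc_adjacency x T)"
  show "tsc_succeeds I lab q x"
    unfolding tsc_succeeds_def
  proof (intro allI impI)
    fix T assume T: "tsc_neighbours I x q T"
    let ?T = "restrict T I"
    have "?T \<in> I \<rightarrow>\<^sub>E Pow I" using T by (auto simp: tsc_neighbours_def)
    moreover have "tsc_neighbours I x q ?T" using T by (simp add: tsc_neighbours_def)
    ultimately have "subspace_detection I lab q (tsc_adjacency x ?T)" using fin by blast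
    moreover have "tsc_adjacency x ?T i j = tsc_adjacency x T i j" if "i \<in> I" "j \<in> I" for i j
      using that by (simp add: tsc_adjacency_def tsc_coeff_def)
    ultimately show "subspace_detection I lab q (tsc_adjacency x T)"
      by (simp add: subspace_detection_def cong: conj_cong)
  qed
qed (simp add: tsc_succeeds_def)

text \<open>For finitely many choices the event is a finite Boolean combination of conditions on the
  inner products, through which alone the points enter.\<close>

lemma pred_tsc_succeeds:
  assumes "finite I"
    and [measurable]: "\<And>i j. i \<in> I \<Longrightarrow> j \<in> I \<Longrightarrow> (\<lambda>\<omega>. x \<omega> i \<bullet> x \<omega> j) \<in> borel_measurable M"
  shows "Measurable.pred M (\<lambda>\<omega>. tsc_succeeds I lab q (x \<omega>))"
  unfolding tsc_succeeds_finite
proof (intro pred_intros_finite pred_intros_logic)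
  show "finite (I \<rightarrow>\<^sub>E Pow I)" using assms(1) by (intro finite_PiE) auto
  fix T assume T: "T \<in> I \<rightarrow>\<^sub>E Pow I"
  have TI: "T j \<subseteq> I" if "j \<in> I" for j using T that by auto
  show "Measurable.pred M (\<lambda>\<omega>. tsc_neighbours I (x \<omega>) q T)"
    unfolding tsc_neighbours_def
  proof (intro pred_intros_finite(3)[OF assms(1)] pred_intros_logic)
    fix j assume j: "j \<in> I"
    have "finite (T j)" using TI[OF j] assms(1) by (rule finite_subset)
    moreover have "Measurable.pred M (\<lambda>\<omega>. \<bar>x \<omega> j \<bullet> x \<omega> p\<bar> \<le> \<bar>x \<omega> j \<bullet> x \<omega> i\<bar>)" if "i \<in> T j" "p \<in> I" for i p
    proof -
      have [measurable]: "(\<lambda>\<omega>. x \<omega> j \<bullet> x \<omega> p) \<in> borel_measurable M" "(\<lambda>\<omega>. x \<omega> j \<bullet> x \<omega> i) \<in> borel_measurable M"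
        using assms(2) that j TI[OF j] by auto
      show ?thesis by measurable
    qed
    ultimately show "Measurable.pred M (\<lambda>\<omega>. \<forall>i\<in>T j. \<forall>p\<in>I. p \<notin> T j \<longrightarrow> p \<noteq> j \<longrightarrow> \<bar>x \<omega> j \<bullet> x \<omega> p\<bar> \<le> \<bar>x \<omega> j \<bullet> x \<omega> i\<bar>)"
      using assms(1) by (intro pred_intros_finite(3) pred_intros_logic) auto
  qed simp_all
  have A0: "Measurable.pred M (\<lambda>\<omega>. tsc_adjacency (x \<omega>) T i j = 0)" if "i \<in> I" "j \<in> I" for i j
  proof -
    have [measurable]: "(\<lambda>\<omega>. x \<omega> j \<bullet> x \<omega> i) \<in> borel_measurable M" "(\<lambda>\<omega>. x \<omega> i \<bullet> x \<omega> j) \<in> borel_measurable M"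
      using assms(2) that by auto
    show ?thesis unfolding tsc_adjacency_def tsc_coeff_def by measurable
  qed
  show "Measurable.pred M (\<lambda>\<omega>. subspace_detection I lab q (tsc_adjacency (x \<omega>) T))"
    unfolding subspace_detection_def
  proof (intro pred_intros_logic pred_intros_finite(3)[OF assms(1)] A0)
    fix i assume i: "i \<in> I"
    have "(\<lambda>\<omega>. real (card {j \<in> I. lab j = lab i \<and> tsc_adjacency (x \<omega>) T i j \<noteq> 0})) \<in> borel_measurable M"
      by (intro measurable_card_filter assms(1) pred_intros_logic A0[OF i]) simp_all
    then have "Measurable.pred M (\<lambda>\<omega>. real q \<le> real (card {j \<in> I. lab j = lab i \<and> tsc_adjacency (x \<omega>) T i j \<noteq> 0}))"
      by measurable
    then show "Measurable.pred M (\<lambda>\<omega>. q \<le> card {j \<in> I. lab j = lab i \<and> tsc_adjacency (x \<omega>) T i j \<noteq> 0})"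
      by simp
  qed simp_all
qed

context noisy_subspace_data
begin

lemma ip_split:
  "ip \<omega> i j = (\<Sum>r<m. sig (fst \<omega>) i r * sig (fst \<omega>) j r) +
     (\<Sum>r<m. sig (fst \<omega>) j r * snd \<omega> i r + sig (fst \<omega>) i r * snd \<omega> j r) +
     (\<Sum>r<m. snd \<omega> i r * snd \<omega> j r)"
  unfolding ip_def pt_def sum.distrib[symmetric] by (intro sum.cong refl) (simp add: algebra_simps)

text \<open>By Cauchy-Schwarz the length of the coefficient vector is at least its inner product
  with the unit vector of \<open>i\<close>. In the same subspace this is the inner product of the
  point with its own signal, which is 1 plus noise and so at least 5/6; \<open>level\<close> halves
  it.\<close>

lemma level_ge:
  assumes i: "i \<in> I" and unit: "(\<Sum>k<d i. (fst \<omega> i k)\<^sup>2) = 1"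
    and same: "W j = W i" "d j = d i"
    and noise: "- (\<Sum>r<m. sig (fst \<omega>) i r * snd \<omega> i r) \<le> 1/6"
  shows "5 / (12 * sqrt (d i)) \<le> level \<omega> i j"
proof -
  have "(\<Sum>k<d i. coeff \<omega> i j k * fst \<omega> i k) = (\<Sum>r<m. pt \<omega> i r * sig (fst \<omega>) i r)"
  proof -
    have "(\<Sum>k<d i. coeff \<omega> i j k * fst \<omega> i k) = (\<Sum>k<d i. \<Sum>r<m. W i r k * pt \<omega> i r * fst \<omega> i k)"
      by (simp add: coeff_def same sum_distrib_right)
    also have "\<dots> = (\<Sum>r<m. \<Sum>k<d i. W i r k * pt \<omega> i r * fst \<omega> i k)" by (rule sum.swap)
    also have "\<dots> = (\<Sum>r<m. pt \<omega> i r * sig (fst \<omega>) i r)"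
      by (simp add: sig_def sum_distrib_left mult_ac)
    finally show ?thesis .
  qed
  also have "\<dots> = (\<Sum>r<m. (sig (fst \<omega>) i r)\<^sup>2) + (\<Sum>r<m. sig (fst \<omega>) i r * snd \<omega> i r)"
    unfolding pt_def sum.distrib[symmetric]
    by (intro sum.cong refl) (simp add: power2_eq_square algebra_simps)
  also have "(\<Sum>r<m. (sig (fst \<omega>) i r)\<^sup>2) = 1" using sum_sig_squares[OF i] unit by simp
  finally have "5/6 \<le> (\<Sum>k<d i. coeff \<omega> i j k * fst \<omega> i k)" using noise by simp
  also have "\<dots> \<le> (\<Sum>k<d i. \<bar>coeff \<omega> i j k\<bar> * \<bar>fst \<omega> i k\<bar>)"
    by (intro sum_mono) (simp add: abs_mult[symmetric])
  also have "\<dots> \<le> L2_set (coeff \<omega> i j) {..<d i} * L2_set (fst \<omega> i) {..<d i}"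
    by (rule L2_set_mult_ineq)
  also have "L2_set (fst \<omega> i) {..<d i} = 1" using unit by (simp add: L2_set_def)
  finally have "5/6 \<le> L2_set (coeff \<omega> i j) {..<d j}" by (simp add: same)
  then have "5/6 / (2 * sqrt (d i)) \<le> L2_set (coeff \<omega> i j) {..<d j} / (2 * sqrt (d i))"
    by (intro divide_right_mono) auto
  then show ?thesis by (simp add: level_def same)
qed

theorem tsc_succeeds_probability:
  fixes lab :: "'i \<Rightarrow> 'l" and q :: nat and x :: "_ \<Rightarrow> 'i \<Rightarrow> real vec"
  assumes N: "2 \<le> card I" and m: "6 * ln (card I) \<le> real m"
    and x: "\<And>\<omega> i j. i \<in> I \<Longrightarrow> j \<in> I \<Longrightarrow> x \<omega> i \<bullet> x \<omega> j = ip \<omega> i j"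
    and same: "\<And>i j. i \<in> I \<Longrightarrow> j \<in> I \<Longrightarrow> lab i = lab j \<Longrightarrow> W i = W j \<and> d i = d j"
    and cross: "\<And>i j. i \<in> I \<Longrightarrow> j \<in> I \<Longrightarrow> lab i \<noteq> lab j \<Longrightarrow>
      4 * ln (card I) * sqrt (frob2 i j / (real (d i) * real (d j))) + 4 * sqrt (ln (card I) * v) +
        4 * sqrt (ln (card I)) * v * sqrt m \<le> 1 / (3 * sqrt (d i))"
    and own: "2 * sqrt (ln (card I) * v) \<le> 1 / 6"
  shows "1 - 10 / real (card I) - (\<Sum>i\<in>I. exp (q / 10 - real (card {j \<in> I - {i}. lab j = lab i}) / 55))
    \<le> measure D {\<omega> \<in> space D. tsc_succeeds I lab q (x \<omega>)}"
proof -
  interpret prob_space D by (rule prob_space_D)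
  define n where "n = real (card I)"
  define l where "l = ln n"
  have n: "n \<ge> 2" using N by (simp add: n_def)
  have l0: "l > 0" using n by (simp add: l_def)
  have lm: "6 * l \<le> real m" using m by (simp add: l_def n_def)
  have m0: "0 < m" using lm l0 by (cases "m = 0") auto
  define C where "C i = {j \<in> I - {i}. lab j = lab i}" for i
  define P1 where "P1 p = {\<omega> \<in> space D. 4 * l * sqrt (frob2 (fst p) (snd p) / (real (d (fst p)) * real (d (snd p)))) <
    \<bar>\<Sum>r<m. sig (fst \<omega>) (fst p) r * sig (fst \<omega>) (snd p) r\<bar>}" for p
  define P2 where "P2 p = {\<omega> \<in> space D. 4 * sqrt (l * v) <
      \<bar>\<Sum>r<m. sig (fst \<omega>) (snd p) r * snd \<omega> (fst p) r + sig (fst \<omega>) (fst p) r * snd \<omega> (snd p) r\<bar>}" for p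
  define P3 where "P3 p = {\<omega> \<in> space D. 4 * sqrt l * v * sqrt m < \<bar>\<Sum>r<m. snd \<omega> (fst p) r * snd \<omega> (snd p) r\<bar>}" for p
  define Q where "Q i = {\<omega> \<in> space D. 2 * sqrt (l * v) < - (\<Sum>r<m. sig (fst \<omega>) i r * snd \<omega> i r)}" for i
  define R where "R i = {\<omega> \<in> space D. card {j \<in> C i. level \<omega> i j \<le> \<bar>ip \<omega> i j\<bar>} < q}" for i
  define J where "J = {p \<in> I \<times> I. fst p \<noteq> snd p}"
  have finJ: "finite J" unfolding J_def using finite_I by simp
  have cardJ: "real (card J) \<le> n\<^sup>2"
  proof -
    have "card J \<le> card (I \<times> I)" unfolding J_def using finite_I by (intro card_mono) auto
    then have "real (card J) \<le> real (card I * card I)" by (intro of_nat_mono) (simp add: card_cartesian_product)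
    then show ?thesis by (simp add: n_def power2_eq_square)
  qed
  define Good where "Good = {\<omega> \<in> space D. tsc_succeeds I lab q (x \<omega>)}"
  have Good: "Good \<in> events"
  proof -
    have "Measurable.pred D (\<lambda>\<omega>. tsc_succeeds I lab q (x \<omega>))"
      by (rule pred_tsc_succeeds[OF finite_I]) (simp add: x measurable_ip)
    then show ?thesis unfolding Good_def by measurable
  qed
  have CI: "C i \<subseteq> I - {i}" "finite (C i)" for i using finite_I by (auto simp: C_def)
  have P1m: "P1 p \<in> events" and P2m: "P2 p \<in> events" and P3m: "P3 p \<in> events" if "p \<in> J" for p
  proof -
    have p: "fst p \<in> I" "snd p \<in> I" using that by (auto simp: J_def)
    show "P1 p \<in> events" unfolding P1_def using p by measurable
    show "P2 p \<in> events" unfolding P2_def using p by measurable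
    show "P3 p \<in> events" unfolding P3_def using p by measurable
  qed
  have Qm: "Q i \<in> events" if "i \<in> I" for i unfolding Q_def using that by measurable
  have Rm: "R i \<in> events" if i: "i \<in> I" for i
  proof -
    have "Measurable.pred D (\<lambda>\<omega>. level \<omega> i j \<le> \<bar>ip \<omega> i j\<bar>)" if "j \<in> C i" for j
    proof -
      have "j \<in> I" using that CI by auto
      with i show ?thesis by measurable
    qed
    then have "(\<lambda>\<omega>. real (card {j \<in> C i. level \<omega> i j \<le> \<bar>ip \<omega> i j\<bar>})) \<in> borel_measurable D"
      by (rule measurable_card_filter[OF CI(2)])
    from borel_measurable_less[OF this borel_measurable_const[of "real q"]]
    show ?thesis by (simp add: R_def)
  qed
  have emb: "prob X \<le> c" if "emeasure D X \<le> ennreal c" "0 \<le> c" for X c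
    using that by (simp add: emeasure_eq_measure)
  have en: "exp (- l) = 1 / n" using n by (simp add: l_def exp_minus inverse_eq_divide)
  have e2: "exp (- 2 * l) = 1 / n ^ 2" using en exp_of_nat_mult[of 2 "- l"] by (simp add: power_divide)
  have e3: "exp (- 3 * l) = 1 / n ^ 3" using en exp_of_nat_mult[of 3 "- l"] by (simp add: power_divide)
  have e4: "exp (- 4 * l) = 1 / n ^ 4" using en exp_of_nat_mult[of 4 "- l"] by (simp add: power_divide)
  have p1: "prob (P1 p) \<le> 32 / 7 * exp (- 3 * l)" if "p \<in> J" for p
    unfolding P1_def by (intro emb cross_signal_tail) (use that in \<open>auto simp: J_def\<close>)
  have p2: "prob (P2 p) \<le> 2 * exp (- 4 * l)" if "p \<in> J" for p
    unfolding P2_def by (intro emb cross_noise_tail) (use that l0 in \<open>auto simp: J_def\<close>)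
  have p3: "prob (P3 p) \<le> 2 * exp (- 3 * l)" if "p \<in> J" for p
    unfolding P3_def by (intro emb noise_noise_tail) (use that l0 lm m0 in \<open>auto simp: J_def\<close>)
  have pq: "prob (Q i) \<le> exp (- 2 * l)" if "i \<in> I" for i
    unfolding Q_def by (intro emb own_noise_tail) (use that l0 in auto)
  have pr: "prob (R i) \<le> exp (q / 10 - real (card (C i)) / 55)" if "i \<in> I" for i
    unfolding R_def by (intro emb few_neighbours_tail that CI) simp
  define Bad where "Bad = (\<Union>p\<in>J. P1 p \<union> (P2 p \<union> P3 p)) \<union> ((\<Union>i\<in>I. Q i) \<union> (\<Union>i\<in>I. R i))"
  have Bad: "Bad \<in> events"
    unfolding Bad_def using finJ finite_I P1m P2m P3m Qm Rm by (intro sets.Un sets.finite_UN) auto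
  have "prob (space D - Good) \<le> prob Bad"
  \<comment> \<open>Sphere variables have length 1 only almost surely, so failure lies in
    \<open>Bad\<close> only up to a null set.\<close>
  proof (rule finite_measure_mono_AE[OF _ Bad])
    have "AE \<omega> in D. \<forall>i\<in>I. (\<Sum>k<d i. (fst \<omega> i k)\<^sup>2) = 1" by (rule AE_D_fst[OF AE_A_unit])
    with AE_space show "AE \<omega> in D. \<omega> \<in> space D - Good \<longrightarrow> \<omega> \<in> Bad"
    proof eventually_elim
      fix \<omega> assume \<omega>: "\<omega> \<in> space D" and unit: "\<forall>i\<in>I. (\<Sum>k<d i. (fst \<omega> i k)\<^sup>2) = 1"
      show "\<omega> \<in> space D - Good \<longrightarrow> \<omega> \<in> Bad"
      proof (rule impI, rule ccontr)
        assume bad: "\<omega> \<in> space D - Good" and "\<omega> \<notin> Bad"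
        then have nP: "\<omega> \<notin> P1 p" "\<omega> \<notin> P2 p" "\<omega> \<notin> P3 p" if "p \<in> J" for p
          using that by (auto simp: Bad_def)
        have nQ: "\<omega> \<notin> Q i" "\<omega> \<notin> R i" if "i \<in> I" for i
          using that \<open>\<omega> \<notin> Bad\<close> by (auto simp: Bad_def)
        have "tsc_succeeds I lab q (x \<omega>)"
          unfolding tsc_succeeds_def
        proof (intro allI impI)
          fix T assume "tsc_neighbours I (x \<omega>) q T"
          then show "subspace_detection I lab q (tsc_adjacency (x \<omega>) T)"
          proof (rule subspace_detection_if_separated[OF finite_I, where \<tau>="\<lambda>i. 5 / (12 * sqrt (d i))", rotated 3])
            fix i assume i: "i \<in> I"
            have di: "sqrt (d i) > 0" using d_pos[OF i] by simp
            then show "0 < 5 / (12 * sqrt (d i))" by simp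
            have noise: "- (\<Sum>r<m. sig (fst \<omega>) i r * snd \<omega> i r) \<le> 1/6"
              using nQ(1)[OF i] \<omega> own by (simp add: Q_def l_def n_def)
            have sub: "{j \<in> C i. level \<omega> i j \<le> \<bar>ip \<omega> i j\<bar>} \<subseteq>
               {j \<in> I - {i}. lab j = lab i \<and> 5 / (12 * sqrt (d i)) \<le> \<bar>x \<omega> i \<bullet> x \<omega> j\<bar>}"
            proof
              fix j assume "j \<in> {j \<in> C i. level \<omega> i j \<le> \<bar>ip \<omega> i j\<bar>}"
              then have j: "j \<in> I" "j \<noteq> i" "lab j = lab i" "level \<omega> i j \<le> \<bar>ip \<omega> i j\<bar>" by (auto simp: C_def)
              have "5 / (12 * sqrt (d i)) \<le> level \<omega> i j"
                using same[OF j(1) i j(3)] unit i noise by (intro level_ge) auto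
              with j i show "j \<in> {j \<in> I - {i}. lab j = lab i \<and> 5 / (12 * sqrt (d i)) \<le> \<bar>x \<omega> i \<bullet> x \<omega> j\<bar>}"
                by (simp add: x)
            qed
            have "q \<le> card {j \<in> C i. level \<omega> i j \<le> \<bar>ip \<omega> i j\<bar>}"
              using nQ(2)[OF i] \<omega> by (simp add: R_def not_less)
            also have "\<dots> \<le> card {j \<in> I - {i}. lab j = lab i \<and> 5 / (12 * sqrt (d i)) \<le> \<bar>x \<omega> i \<bullet> x \<omega> j\<bar>}"
              using finite_I by (intro card_mono sub) auto
            finally show "q \<le> card {j \<in> I - {i}. lab j = lab i \<and> 5 / (12 * sqrt (d i)) \<le> \<bar>x \<omega> i \<bullet> x \<omega> j\<bar>}" .
          next
            fix i j assume i: "i \<in> I" and j: "j \<in> I" and lab: "lab j \<noteq> lab i"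
            have di: "sqrt (d i) > 0" using d_pos[OF i] by simp
            have J: "(i, j) \<in> J" using i j lab by (auto simp: J_def)
            have "\<bar>x \<omega> i \<bullet> x \<omega> j\<bar> \<le> 4 * l * sqrt (frob2 i j / (real (d i) * real (d j))) + 4 * sqrt (l * v) + 4 * sqrt l * v * sqrt m"
              using nP[OF J] \<omega> unfolding x[OF i j] ip_split by (simp add: P1_def P2_def P3_def not_less)
            also have "\<dots> \<le> 1 / (3 * sqrt (d i))"
              using cross[OF i j lab[symmetric]] by (simp add: l_def n_def)
            also have "\<dots> < 5 / (12 * sqrt (d i))"
              using di by (simp add: field_simps)
            finally show "\<bar>x \<omega> i \<bullet> x \<omega> j\<bar> < 5 / (12 * sqrt (d i))" .
          qed
        qed
        with bad show False by (simp add: Good_def)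
      qed
    qed
  qed
  also have "prob Bad \<le> prob (\<Union>p\<in>J. P1 p \<union> (P2 p \<union> P3 p)) + (prob (\<Union>i\<in>I. Q i) + prob (\<Union>i\<in>I. R i))"
    unfolding Bad_def using finJ finite_I P1m P2m P3m Qm Rm
    by (intro order_trans[OF measure_Un_le] add_left_mono measure_Un_le sets.Un sets.finite_UN) auto
  also have "\<dots> \<le> (\<Sum>p\<in>J. prob (P1 p \<union> (P2 p \<union> P3 p))) + ((\<Sum>i\<in>I. prob (Q i)) + (\<Sum>i\<in>I. prob (R i)))"
    using finJ finite_I P1m P2m P3m Qm Rm
    by (intro add_mono finite_measure_subadditive_finite) auto
  \<comment> \<open>The constants 32/7 and 2 of the signal and the noise-noise terms, both decaying
    like N^-3, add up to 46/7.\<close>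
  also have "\<dots> \<le> (\<Sum>p\<in>J. 46 / 7 * exp (- 3 * l) + 2 * exp (- 4 * l)) +
     ((\<Sum>i\<in>I. exp (- 2 * l)) + (\<Sum>i\<in>I. exp (q / 10 - real (card (C i)) / 55)))"
  proof (intro add_mono sum_mono pq pr)
    fix p assume p: "p \<in> J"
    have "prob (P1 p \<union> (P2 p \<union> P3 p)) \<le> prob (P1 p) + (prob (P2 p) + prob (P3 p))"
      using P1m[OF p] P2m[OF p] P3m[OF p]
      by (intro order_trans[OF measure_Un_le] add_left_mono measure_Un_le) auto
    also have "\<dots> \<le> 46 / 7 * exp (- 3 * l) + 2 * exp (- 4 * l)"
      using p1[OF p] p2[OF p] p3[OF p] by simp
    finally show "prob (P1 p \<union> (P2 p \<union> P3 p)) \<le> 46 / 7 * exp (- 3 * l) + 2 * exp (- 4 * l)" .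
  qed auto
  also have "(\<Sum>p\<in>J. 46 / 7 * exp (- 3 * l) + 2 * exp (- 4 * l)) + ((\<Sum>i\<in>I. exp (- 2 * l)) + (\<Sum>i\<in>I. exp (q / 10 - real (card (C i)) / 55)))
     \<le> 10 / n + (\<Sum>i\<in>I. exp (q / 10 - real (card (C i)) / 55))"
  proof -
    \<comment> \<open>At most N^2 pairs give 46/(7N) plus 2/N^2 \<le> 1/N; the N points add another
      1/N. The total 60/(7N) is below 10/N.\<close>
    have "(\<Sum>p\<in>J. 46 / 7 * exp (- 3 * l) + 2 * exp (- 4 * l)) \<le> n\<^sup>2 * (46 / 7 * exp (- 3 * l) + 2 * exp (- 4 * l))"
      using cardJ by (simp del: exp_ge_zero) (intro mult_right_mono, auto)
    also have "\<dots> = 46 / 7 / n + 2 / n\<^sup>2"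
      unfolding e3 e4 using n by (simp add: field_simps power2_eq_square power3_eq_cube power4_eq_xxxx)
    also have "2 / n\<^sup>2 \<le> 1 / n" using n by (simp add: field_simps power2_eq_square)
    finally have "(\<Sum>p\<in>J. 46 / 7 * exp (- 3 * l) + 2 * exp (- 4 * l)) \<le> 53 / 7 / n" using n by (simp add: field_simps)
    moreover have "(\<Sum>i\<in>I. exp (- 2 * l)) = 1 / n"
      unfolding e2 using n by (simp add: n_def[symmetric] power2_eq_square)
    moreover have "53 / 7 / n + 1 / n \<le> 10 / n" using n by (simp add: field_simps)
    ultimately show ?thesis by linarith
  qed
  finally have "prob (space D - Good) \<le> 10 / n + (\<Sum>i\<in>I. exp (q / 10 - real (card (C i)) / 55))" by simp
  moreover have "prob (space D - Good) = 1 - prob Good" by (rule prob_compl[OF Good])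
  ultimately show ?thesis by (simp add: Good_def n_def C_def)
qed

end

section \<open>Translation from matrices to the model, and the choice of the constant\<close>

lemma data_point_index:
  assumes "U (fst i) \<in> carrier_mat m (d (fst i))" "r < m"
  shows "data_point m U \<omega> i $ r = (\<Sum>k<d (fst i). U (fst i) $$ (r, k) * fst \<omega> i k) + snd \<omega> i r"
  using assms by (simp add: data_point_def scalar_prod_def atLeast0LessThan)

lemma dim_data_point [simp]: "dim_vec (data_point m U \<omega> i) = m"
  by (simp add: data_point_def)

lemma aff_eq_sum:
  assumes "U \<in> carrier_mat m d" "V \<in> carrier_mat m p"
  shows "aff U V = sqrt (\<Sum>k'<p. \<Sum>k<d. (\<Sum>r<m. U $$ (r, k) * V $$ (r, k'))\<^sup>2) / sqrt (real (min d p))"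
proof -
  have "frobenius_norm (transpose_mat U * V) = sqrt (\<Sum>k<d. \<Sum>k'<p. (\<Sum>r<m. U $$ (r, k) * V $$ (r, k'))\<^sup>2)"
    using assms by (simp add: frobenius_norm_def scalar_prod_def atLeast0LessThan)
  also have "(\<Sum>k<d. \<Sum>k'<p. (\<Sum>r<m. U $$ (r, k) * V $$ (r, k'))\<^sup>2) =
      (\<Sum>k'<p. \<Sum>k<d. (\<Sum>r<m. U $$ (r, k) * V $$ (r, k'))\<^sup>2)"
    by (rule sum.swap)
  finally show ?thesis using assms by (simp add: aff_def)
qed

text \<open>The margin is 1/55 - 1/60 = 1/660 per point; for large clusters it leaves room for the
  rate 1/10000 and for the 1/60 lost in passing from n to n - 1.\<close>

lemma neighbour_count_exponent:
  fixes n q :: real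
  assumes "6 * q \<le> n" "10000 \<le> n - 1"
  shows "q / 10 - (n - 1) / 55 \<le> - (1 / 10000) * (n - 1)"
  using assms by (simp add: field_simps)

theorem theorem1:
  shows "\<exists>c>(0::real). \<forall>(L::nat) (m::nat) (q::nat) (d::nat \<Rightarrow> nat) (n::nat \<Rightarrow> nat) (\<rho>::nat \<Rightarrow> real)
      (\<sigma>::real) (S::nat \<Rightarrow> real vec set) (U::nat \<Rightarrow> real mat).
    let I = point_index L n;
        N = real (\<Sum>l<L. n l);
        dmax = real (Max (d ` {..<L}));
        maxaff = Max (insert 0 {aff (U k) (U l) | k l. k < L \<and> l < L \<and> k \<noteq> l})
    in
      1 \<le> L \<longrightarrow>
      (\<forall>l<L. 1 \<le> d l \<and>
         VectorSpace.subspace class_ring (S l) (module_vec TYPE(real) m) \<and>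
         vectorspace.dim class_ring ((module_vec TYPE(real) m)\<lparr>carrier := S l\<rparr>) = d l \<and>
         U l \<in> carrier_mat m (d l) \<and> orthonormal_basis_mat m (S l) (U l)) \<longrightarrow>
      0 \<le> \<sigma> \<longrightarrow>
      1 \<le> q \<longrightarrow>
      (\<forall>l<L. real (n l) = \<rho> l * real q \<and> 6 \<le> \<rho> l) \<longrightarrow>
      6 * ln N \<le> real m \<longrightarrow>
      maxaff + \<sigma> * (1 + \<sigma>) / sqrt (ln N) * (sqrt dmax / sqrt (real m)) \<le> 1 / (12 * ln N) \<longrightarrow>
      1 - 10 / N - (\<Sum>l<L. real (n l) * exp (- c * (real (n l) - 1)))
        \<le> measure (data_model L n d m \<sigma>)
             {\<omega> \<in> space (data_model L n d m \<sigma>).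
                \<forall>T. tsc_neighbours I (data_point m U \<omega>) q T \<longrightarrow>
                    subspace_detection I fst q (tsc_adjacency (data_point m U \<omega>) T)}"
proof (intro exI[of _ "1 / 10000"] conjI allI)
  fix L m q :: nat and d n :: "nat \<Rightarrow> nat" and \<rho> :: "nat \<Rightarrow> real" and \<sigma> :: real
    and S :: "nat \<Rightarrow> real vec set" and U :: "nat \<Rightarrow> real mat"
  define I where "I = point_index L n"
  define N where "N = real (\<Sum>l<L. n l)"
  define dmax where "dmax = real (Max (d ` {..<L}))"
  define maxaff where "maxaff = Max (insert 0 {aff (U k) (U l) | k l. k < L \<and> l < L \<and> k \<noteq> l})"
  let ?c = "1 / 10000 :: real"
  let ?good = "{\<omega> \<in> space (data_model L n d m \<sigma>). tsc_succeeds I fst q (data_point m U \<omega>)}"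
  have main: "1 - 10 / N - (\<Sum>l<L. real (n l) * exp (- ?c * (real (n l) - 1))) \<le> measure (data_model L n d m \<sigma>) ?good"
    if L: "1 \<le> L"
      and sub: "\<And>l. l < L \<Longrightarrow> 1 \<le> d l \<and> U l \<in> carrier_mat m (d l) \<and> orthonormal_basis_mat m (S l) (U l)"
      and \<sigma>: "0 \<le> \<sigma>" and q: "1 \<le> q"
      and n: "\<And>l. l < L \<Longrightarrow> real (n l) = \<rho> l * real q \<and> 6 \<le> \<rho> l"
      and m: "6 * ln N \<le> real m"
      and H: "maxaff + \<sigma> * (1 + \<sigma>) / sqrt (ln N) * (sqrt dmax / sqrt (real m)) \<le> 1 / (12 * ln N)"
  proof -
    have nq: "6 * real q \<le> real (n l)" if "l < L" for l
      using n[OF that] by (simp add: mult_right_mono)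
    then have n6: "6 \<le> real (n l)" if "l < L" for l
      using nq[OF that] q by simp
    have "n 0 \<le> (\<Sum>l<L. n l)" using L by (intro member_le_sum) auto
    then have "real (n 0) \<le> N" unfolding N_def by (rule of_nat_mono)
    then have N6: "6 \<le> N" using n6[of 0] L by simp
    show ?thesis
    \<comment> \<open>A cluster with c(n - 1) < 1 and n \<ge> 6 contributes at least 6/e \<ge> 2 to
      the subtracted sum, so the claimed lower bound is not positive.\<close>
    proof (cases "\<exists>l<L. real (n l) - 1 < 10000")
      case True
      then obtain l where l: "l < L" "real (n l) - 1 < 10000" by auto
      have "1 \<le> 6 * (1 / 3 :: real)" by simp
      also have "\<dots> \<le> real (n l) * exp (- 1)"
        using n6[OF l(1)] exp_le by (intro mult_mono) (auto simp: exp_minus field_simps)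
      also have "\<dots> \<le> real (n l) * exp (- ?c * (real (n l) - 1))"
        using l(2) by (intro mult_left_mono) auto
      also have "\<dots> \<le> (\<Sum>l<L. real (n l) * exp (- ?c * (real (n l) - 1)))"
        using l(1) by (intro member_le_sum) auto
      finally have "1 - 10 / N - (\<Sum>l<L. real (n l) * exp (- ?c * (real (n l) - 1))) \<le> 0"
        using N6 by (smt (verit) divide_nonneg_nonneg)
      then show ?thesis using measure_nonneg order_trans by blast
    next
      case False
      then have big: "10000 \<le> real (n l) - 1" if "l < L" for l using that by auto
      define v where "v = \<sigma>\<^sup>2 / real m"
      have I_iff: "(a, b) \<in> I \<longleftrightarrow> a < L \<and> b < n a" for a b
        by (auto simp: I_def point_index_def)
      have IL: "fst i < L" if "i \<in> I" for i using that I_iff by (cases i) auto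
      interpret noisy_subspace_data I "\<lambda>i. d (fst i)" m v "\<lambda>i r k. U (fst i) $$ (r, k)"
      proof
        show "finite I" by (simp add: I_def point_index_def)
        show "0 \<le> v" by (simp add: v_def)
        show "1 \<le> d (fst i)" if "i \<in> I" for i using sub[OF IL[OF that]] by simp
        show "(\<Sum>r<m. U (fst i) $$ (r, k) * U (fst i) $$ (r, k')) = (if k = k' then 1 else 0)"
          if "i \<in> I" "k < d (fst i)" "k' < d (fst i)" for i k k'
        proof -
          have U: "U (fst i) \<in> carrier_mat m (d (fst i))" using sub[OF IL[OF that(1)]] by simp
          then have "col (U (fst i)) k \<bullet> col (U (fst i)) k' = (if k = k' then 1 else 0)"
            using sub[OF IL[OF that(1)]] that by (auto simp: orthonormal_basis_mat_def)
          then show ?thesis using U that by (simp add: scalar_prod_def atLeast0LessThan)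
        qed
      qed
      have D: "data_model L n d m \<sigma> = D"
        unfolding D_def A_def G_def by (simp add: data_model_def I_def v_def)
      have card_I: "card I = (\<Sum>l<L. n l)" by (simp add: I_def point_index_def)
      have N: "N = real (card I)" by (simp add: N_def card_I)
      define l where "l = ln N"
      have l0: "0 < l" using N6 by (simp add: l_def)
      have m0: "0 < real m" using m l0 by (simp add: l_def)
      have fin: "finite (insert 0 {aff (U k) (U l) | k l. k < L \<and> l < L \<and> k \<noteq> l})"
      proof -
        have "{aff (U k) (U l) | k l. k < L \<and> l < L \<and> k \<noteq> l} \<subseteq> (\<lambda>(k, l). aff (U k) (U l)) ` ({..<L} \<times> {..<L})"
          by auto
        from finite_subset[OF this] show ?thesis by simp
      qed
      \<comment> \<open>The inserted 0 is what remains of the maximum when there is a single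
        subspace and hence no pair.\<close>
      have maxaff0: "0 \<le> maxaff" unfolding maxaff_def using fin by (intro Max_ge) auto
      have maxaff: "aff (U a) (U b) \<le> maxaff" if "a < L" "b < L" "a \<noteq> b" for a b
        unfolding maxaff_def using fin that by (intro Max_ge) auto
      have dmax: "real (d a) \<le> dmax" if "a < L" for a
        unfolding dmax_def using that by (intro of_nat_mono Max_ge) auto
      have dmax1: "1 \<le> dmax" using dmax[of 0] sub[of 0] L by force
      have sqrtv: "sqrt v = \<sigma> / sqrt m" using \<sigma> by (simp add: v_def real_sqrt_divide)
      have vm: "v * sqrt m = \<sigma>\<^sup>2 / sqrt m" using m0 by (simp add: v_def field_simps)
      let ?noise = "\<sigma> * (1 + \<sigma>) * sqrt dmax / sqrt m"
      \<comment> \<open>The assumption is multiplied by l = log N, so that l / sqrt l becomes sqrt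
        l. A factor 4 will turn 1/12 into the 1/3 of the cross bound.\<close>
      have H': "l * maxaff + sqrt l * ?noise \<le> 1 / 12"
      proof -
        have "l * (maxaff + \<sigma> * (1 + \<sigma>) / sqrt l * (sqrt dmax / sqrt m)) \<le> l * (1 / (12 * l))"
          using H l0 by (intro mult_left_mono) (simp_all add: l_def)
        also have "l * (maxaff + \<sigma> * (1 + \<sigma>) / sqrt l * (sqrt dmax / sqrt m)) = l * maxaff + (l / sqrt l) * ?noise"
        proof -
          have "l * (a + x / s * (y / z)) = l * a + l / s * (x * y / z)" for a x s y z :: real
            by (simp add: distrib_left mult_ac)
          then show ?thesis .
        qed
        also have "l / sqrt l = sqrt l" using l0 by (simp add: real_div_sqrt)
        finally show ?thesis using l0 by simp
      qed
      have "1 - 10 / real (card I) - (\<Sum>i\<in>I. exp (real q / 10 - real (card {j \<in> I - {i}. fst j = fst i}) / 55))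
        \<le> measure D {\<omega> \<in> space D. tsc_succeeds I fst q (data_point m U \<omega>)}"
      proof (rule tsc_succeeds_probability)
        show "2 \<le> card I" using N6 N by simp
        show "6 * ln (card I) \<le> real m" using m N by simp
        show "(\<lambda>r k. U (fst i) $$ (r, k)) = (\<lambda>r k. U (fst j) $$ (r, k)) \<and> d (fst i) = d (fst j)"
          if "fst i = fst j" for i j :: "nat \<times> nat" using that by simp
        show "data_point m U \<omega> i \<bullet> data_point m U \<omega> j = ip \<omega> i j" if "i \<in> I" "j \<in> I" for \<omega> i j
          using sub[OF IL[OF that(1)]] sub[OF IL[OF that(2)]]
          by (simp add: scalar_prod_def ip_def pt_def sig_def data_point_index[where d=d] atLeast0LessThan)
        have sd: "sqrt (l * v) = sqrt l * (\<sigma> / sqrt m)" by (simp add: real_sqrt_mult sqrtv)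
        show "2 * sqrt (ln (card I) * v) \<le> 1 / 6"
        proof -
          \<comment> \<open>Since (1 + \<sigma>) sqrt dmax \<ge> 1, the noise term of the assumption
            dominates sqrt(l v), which is therefore at most 1/12.\<close>
          have "sqrt l * (\<sigma> / sqrt m) \<le> sqrt l * ?noise"
          proof (intro mult_left_mono divide_right_mono)
            have "1 \<le> (1 + \<sigma>) * sqrt dmax"
              using mult_mono[of 1 "1 + \<sigma>" 1 "sqrt dmax"] \<sigma> dmax1 by simp
            then have "\<sigma> * 1 \<le> \<sigma> * ((1 + \<sigma>) * sqrt dmax)"
              using \<sigma> by (intro mult_left_mono)
            then show "\<sigma> \<le> \<sigma> * (1 + \<sigma>) * sqrt dmax" by (simp add: mult.assoc)
          qed (use l0 in auto)
          moreover have "0 \<le> l * maxaff" using l0 maxaff0 by simp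
          ultimately have "2 * sqrt (l * v) \<le> 1 / 6" using H' unfolding sd by linarith
          then show ?thesis by (simp add: l_def N)
        qed
        fix i j assume i: "i \<in> I" and j: "j \<in> I" and ij: "fst i \<noteq> fst j"
        have di: "1 \<le> d (fst i)" and dj: "1 \<le> d (fst j)" using i j d_pos by auto
        let ?x = "frob2 i j"
        have x0: "0 \<le> ?x" by (simp add: frob2_def sum_nonneg)
        have aff: "aff (U (fst i)) (U (fst j)) = sqrt ?x / sqrt (real (min (d (fst i)) (d (fst j))))"
          using sub[OF IL[OF i]] sub[OF IL[OF j]] by (subst aff_eq_sum[of _ m "d (fst i)" _ "d (fst j)"]) (auto simp: frob2_def gram_def)
        \<comment> \<open>Multiplying by the root of the dimension of \<open>i\<close> cancels it
          and leaves that of \<open>j\<close>, which is at least the minimum in the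
          affinity.\<close>
        have "sqrt (?x / (real (d (fst i)) * real (d (fst j)))) * sqrt (d (fst i)) = sqrt ?x / sqrt (d (fst j))"
          using di by (simp add: real_sqrt_divide real_sqrt_mult)
        also have "\<dots> \<le> aff (U (fst i)) (U (fst j))"
          unfolding aff using x0 di dj by (intro divide_left_mono) auto
        also have "\<dots> \<le> maxaff" by (rule maxaff[OF IL[OF i] IL[OF j] ij])
        finally have 1: "sqrt (?x / (real (d (fst i)) * real (d (fst j)))) * sqrt (d (fst i)) \<le> maxaff" .
        have 2: "sqrt (d (fst i)) \<le> sqrt dmax" using dmax[OF IL[OF i]] by simp
        have "(4 * l * sqrt (?x / (real (d (fst i)) * real (d (fst j)))) + 4 * sqrt (l * v) + 4 * sqrt l * v * sqrt m) * sqrt (d (fst i)) =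
          4 * l * (sqrt (?x / (real (d (fst i)) * real (d (fst j)))) * sqrt (d (fst i))) +
          4 * sqrt l * ((\<sigma> + \<sigma>\<^sup>2) / sqrt m) * sqrt (d (fst i))"
        proof -
          \<comment> \<open>Signal-noise terms contribute \<sigma>/sqrt m and noise-noise terms
            \<sigma>^2/sqrt m, whence the factor \<sigma>(1 + \<sigma>) of the assumption.\<close>
          have "(a + 4 * (r * (\<sigma> / z)) + 4 * r * v * z) * y = a * y + 4 * r * ((\<sigma> + \<sigma>\<^sup>2) / z) * y"
            if "v * z = \<sigma>\<^sup>2 / z" for a r y z
          proof -
            have "4 * r * v * z = 4 * r * (\<sigma>\<^sup>2 / z)" by (simp only: mult.assoc that)
            then show ?thesis by (simp add: add_divide_distrib distrib_left distrib_right)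
          qed
          from this[OF vm] show ?thesis unfolding sd by (simp only: mult.assoc)
        qed
        also have "\<dots> \<le> 4 * l * maxaff + 4 * sqrt l * ((\<sigma> + \<sigma>\<^sup>2) / sqrt m) * sqrt dmax"
          using l0 \<sigma> 1 2 by (intro add_mono mult_left_mono) auto
        also have "4 * sqrt l * ((\<sigma> + \<sigma>\<^sup>2) / sqrt m) * sqrt dmax = 4 * (sqrt l * ?noise)"
        proof -
          have "4 * r * ((\<sigma> + \<sigma>\<^sup>2) / z) * y = 4 * (r * (\<sigma> * (1 + \<sigma>) * y / z))" for r z y
            by (simp add: power2_eq_square distrib_left distrib_right)
          then show ?thesis .
        qed
        also have "4 * l * maxaff + 4 * (sqrt l * ?noise) \<le> 1 / 3" using H' by linarith
        finally have "4 * l * sqrt (?x / (real (d (fst i)) * real (d (fst j)))) + 4 * sqrt (l * v) + 4 * sqrt l * v * sqrt m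
            \<le> 1 / 3 / sqrt (d (fst i))"
          using di by (subst pos_le_divide_eq) auto
        then show "4 * ln (card I) * sqrt (?x / (real (d (fst i)) * real (d (fst j)))) + 4 * sqrt (ln (card I) * v) +
          4 * sqrt (ln (card I)) * v * sqrt m \<le> 1 / (3 * sqrt (d (fst i)))"
          by (simp add: l_def N)
      qed
      moreover have "(\<Sum>i\<in>I. exp (real q / 10 - real (card {j \<in> I - {i}. fst j = fst i}) / 55))
         \<le> (\<Sum>l<L. real (n l) * exp (- ?c * (real (n l) - 1)))"
      proof -
        have "(\<Sum>i\<in>I. exp (real q / 10 - real (card {j \<in> I - {i}. fst j = fst i}) / 55))
          \<le> (\<Sum>i\<in>I. exp (- ?c * (real (n (fst i)) - 1)))"
        proof (rule sum_mono)
          fix i assume i: "i \<in> I"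
          obtain a b where ab: "i = (a, b)" "a < L" "b < n a" using i I_iff by (cases i) auto
          \<comment> \<open>A point is not its own neighbour; this is where n - 1 instead of n
            enters the exponent.\<close>
          have "{j \<in> I - {i}. fst j = fst i} = Pair a ` ({..<n a} - {b})"
            using ab by (auto simp: I_iff image_iff)
          then have "card {j \<in> I - {i}. fst j = fst i} = n a - 1"
            using ab by (simp add: card_image inj_on_def)
          then have "real (card {j \<in> I - {i}. fst j = fst i}) = real (n a) - 1"
            using ab by (simp add: of_nat_diff)
          then show "exp (real q / 10 - real (card {j \<in> I - {i}. fst j = fst i}) / 55) \<le> exp (- ?c * (real (n (fst i)) - 1))"
            using neighbour_count_exponent[OF nq[OF ab(2)] big[OF ab(2)]] ab(1) by simp
        qed
        also have "\<dots> = (\<Sum>l<L. \<Sum>j<n l. exp (- ?c * (real (n l) - 1)))"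
          unfolding I_def point_index_def by (subst sum.Sigma) (auto simp: split_beta')
        finally show ?thesis by simp
      qed
      ultimately show ?thesis by (simp add: D N)
    qed
  qed
  show "let I = point_index L n;
        N = real (\<Sum>l<L. n l);
        dmax = real (Max (d ` {..<L}));
        maxaff = Max (insert 0 {aff (U k) (U l) | k l. k < L \<and> l < L \<and> k \<noteq> l})
    in
      1 \<le> L \<longrightarrow>
      (\<forall>l<L. 1 \<le> d l \<and>
         VectorSpace.subspace class_ring (S l) (module_vec TYPE(real) m) \<and>
         vectorspace.dim class_ring ((module_vec TYPE(real) m)\<lparr>carrier := S l\<rparr>) = d l \<and>
         U l \<in> carrier_mat m (d l) \<and> orthonormal_basis_mat m (S l) (U l)) \<longrightarrow>
      0 \<le> \<sigma> \<longrightarrow>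
      1 \<le> q \<longrightarrow>
      (\<forall>l<L. real (n l) = \<rho> l * real q \<and> 6 \<le> \<rho> l) \<longrightarrow>
      6 * ln N \<le> real m \<longrightarrow>
      maxaff + \<sigma> * (1 + \<sigma>) / sqrt (ln N) * (sqrt dmax / sqrt (real m)) \<le> 1 / (12 * ln N) \<longrightarrow>
      1 - 10 / N - (\<Sum>l<L. real (n l) * exp (- (1 / 10000) * (real (n l) - 1)))
        \<le> measure (data_model L n d m \<sigma>)
             {\<omega> \<in> space (data_model L n d m \<sigma>).
                \<forall>T. tsc_neighbours I (data_point m U \<omega>) q T \<longrightarrow>
                    subspace_detection I fst q (tsc_adjacency (data_point m U \<omega>) T)}"
    unfolding Let_def I_def[symmetric] N_def[symmetric] dmax_def[symmetric] maxaff_def[symmetric]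
      tsc_succeeds_def[symmetric]
    by (intro impI main) simp_all
qed simp

end
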